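(* Let $P\in\mathcal{A}$ be a self-adjoint projection with $\tau(P)=\alpha\in(0,1]$, and let $(Y_t)_{t\ge 0}$ be a free unitary Brownian motion in $(\mathcal{A},\tau)$ such that $P$ and $(Y_t)_{t\ge0}$ are $\star$-free. Then for all integers $n\ge 0$ and all $t\ge 0$, $$\tau\big[(PY_t)^n\big]=\alpha\, e^{-nt/2}\,Q_n(\alpha t),$$ where $Q_0\equiv 1$ and $Q_n(t):=e^{nt/2}\tau(Y_t^n)$ for $n\ge 1$ (and, for $n=0$, $(PY_t)^0$ is understood as $P$).
   Context: $(\mathcal{A},\tau)$ is a non-commutative $\star$-probability space: $\mathcal{A}$ is a unital von Neumann algebra with a faithful tracial state $\tau$. A free unitary Brownian motion $(Y_t)_{t\ge0}$ is the unitary-valued solution of the free stochastic differential equation $dY_t=iY_t\,dX_t-\frac12Y_t\,dt$, $Y_0=\mathbf 1$, where $(X_t)_{t\ge0}$ is a free additive Brownian motion in $\mathcal{A}$. It is known that for $n\ge1$, $\tau(Y_t^n)=\frac{e^{-nt/2}}{n}\sum_{r=0}^{n-1}\binom{n}{r+1}\frac{(-nt)^r}{r!}$, so $Q_n(t)=\frac1n\sum_{r=0}^{n-1}\binom{n}{r+1}\frac{(-nt)^r}{r!}$. *)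

theory Defs
  imports "HOL-Analysis.Analysis"
begin

section \<open>Complex Hilbert spaces and bounded operators\<close>

text \<open>
  The inner product is conjugate-linear in the first argument; \<^const>\<open>inner\<close> is its real part, so
  norm, metric and completeness are those of the underlying real Hilbert space.
\<close>

class complex_hilbert_space = real_inner + banach +
  fixes scaleC :: "complex \<Rightarrow> 'a \<Rightarrow> 'a" (infixr "*\<^sub>C" 75)
    and cinner :: "'a \<Rightarrow> 'a \<Rightarrow> complex"
  assumes scaleC_add_right: "c *\<^sub>C (x + y) = c *\<^sub>C x + c *\<^sub>C y"
    and scaleC_add_left: "(c + d) *\<^sub>C x = c *\<^sub>C x + d *\<^sub>C x"
    and scaleC_scaleC: "c *\<^sub>C d *\<^sub>C x = (c * d) *\<^sub>C x"
    and scaleC_of_real: "complex_of_real r *\<^sub>C x = r *\<^sub>R x"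
    and cinner_commute: "cinner x y = cnj (cinner y x)"
    and cinner_add_right: "cinner x (y + z) = cinner x y + cinner x z"
    and cinner_scaleC_right: "cinner x (c *\<^sub>C y) = c * cinner x y"
    and Re_cinner: "Re (cinner x y) = inner x y"

lemma cinner_add_left:
  "cinner (x + y) z = cinner x z + cinner (y::'a::complex_hilbert_space) z"
  by (metis cinner_commute cinner_add_right complex_cnj_add)

lemma cinner_scaleC_left:
  "cinner (c *\<^sub>C x) y = cnj c * cinner x (y::'a::complex_hilbert_space)"
  by (metis cinner_commute cinner_scaleC_right complex_cnj_mult)

lemma Im_cinner: "Im (cinner x y) = inner (\<i> *\<^sub>C x) (y::'a::complex_hilbert_space)"
  by (simp flip: Re_cinner add: cinner_scaleC_left)

lemma cinner_eq_iff_inner: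
  fixes x y u v :: "'a::complex_hilbert_space"
  shows "cinner x y = cinner u v \<longleftrightarrow>
    inner x y = inner u v \<and> inner (\<i> *\<^sub>C x) y = inner (\<i> *\<^sub>C u) v"
  by (simp add: complex_eq_iff Im_cinner Re_cinner)

lemma norm_scaleC: "norm (c *\<^sub>C x) = cmod c * norm (x::'a::complex_hilbert_space)"
proof -
  have "(norm (c *\<^sub>C x))\<^sup>2 = Re (cnj c * c * cinner x x)"
    by (simp add: power2_norm_eq_inner cinner_scaleC_left cinner_scaleC_right mult_ac flip: Re_cinner)
  also have "cnj c * c = complex_of_real ((cmod c)\<^sup>2)"
    by (metis complex_norm_square mult.commute)
  also have "Re (complex_of_real ((cmod c)\<^sup>2) * cinner x x) = (cmod c * norm x)\<^sup>2"
    by (simp del: of_real_power add: Re_cinner power2_norm_eq_inner power_mult_distrib)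
  finally show ?thesis
    by (simp add: power2_eq_iff_nonneg)
qed

typedef (overloaded) 'h bop =
  "{T :: 'h::complex_hilbert_space \<Rightarrow>\<^sub>L 'h. \<forall>c x. blinfun_apply T (c *\<^sub>C x) = c *\<^sub>C blinfun_apply T x}"
  morphisms blinfun_of_bop bop_of_blinfun
  by (rule exI[of _ id_blinfun]) simp

setup_lifting type_definition_bop

lift_definition bop_apply :: "'h::complex_hilbert_space bop \<Rightarrow> 'h \<Rightarrow> 'h" is blinfun_apply .

lemma bop_eqI: "(\<And>x. bop_apply S x = bop_apply T x) \<Longrightarrow> S = T"
  by transfer (rule blinfun_eqI)

lemma scaleC_zero_right [simp]: "c *\<^sub>C (0::'a::complex_hilbert_space) = 0"
  using norm_scaleC[of c "0::'a"] by simp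

lemma scaleC_minus_right [simp]: "c *\<^sub>C (- x) = - (c *\<^sub>C (x::'a::complex_hilbert_space))"
  by (metis scaleC_add_right add_eq_0_iff scaleC_zero_right)

lemma scaleC_diff_right: "c *\<^sub>C (x - y) = c *\<^sub>C x - c *\<^sub>C (y::'a::complex_hilbert_space)"
  using scaleC_add_right[of c x "- y"] by simp

lemma scaleC_scaleR_commute:
  "c *\<^sub>C (r *\<^sub>R x) = r *\<^sub>R (c *\<^sub>C (x::'a::complex_hilbert_space))"
  by (simp flip: scaleC_of_real add: scaleC_scaleC mult.commute)

lemma bounded_linear_scaleC: "bounded_linear ((*\<^sub>C) c :: 'a::complex_hilbert_space \<Rightarrow> 'a)"
  by (rule bounded_linear_intro[where K = "cmod c"])
    (simp_all add: scaleC_add_right scaleC_scaleR_commute norm_scaleC)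

instantiation bop :: (complex_hilbert_space) real_normed_vector
begin

lift_definition zero_bop :: "'a bop" is 0 by simp
lift_definition plus_bop :: "'a bop \<Rightarrow> 'a bop \<Rightarrow> 'a bop" is "(+)"
  by (simp add: blinfun.add_left scaleC_add_right)
lift_definition uminus_bop :: "'a bop \<Rightarrow> 'a bop" is uminus
  by (simp add: blinfun.minus_left)
lift_definition minus_bop :: "'a bop \<Rightarrow> 'a bop \<Rightarrow> 'a bop" is "(-)"
  by (simp add: blinfun.diff_left scaleC_diff_right)
lift_definition scaleR_bop :: "real \<Rightarrow> 'a bop \<Rightarrow> 'a bop" is "(*\<^sub>R)"
  by (simp add: blinfun.scaleR_left scaleC_scaleR_commute)
lift_definition norm_bop :: "'a bop \<Rightarrow> real" is norm .
definition sgn_bop :: "'a bop \<Rightarrow> 'a bop" where "sgn_bop T = scaleR (inverse (norm T)) T"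
definition dist_bop :: "'a bop \<Rightarrow> 'a bop \<Rightarrow> real" where "dist_bop S T = norm (S - T)"
definition uniformity_bop :: "('a bop \<times> 'a bop) filter"
  where "uniformity_bop = (INF e\<in>{0<..}. principal {(S, T). dist S T < e})"
definition open_bop :: "'a bop set \<Rightarrow> bool"
  where "open_bop U = (\<forall>S\<in>U. \<forall>\<^sub>F (S', T) in uniformity. S' = S \<longrightarrow> T \<in> U)"

instance
proof
  fix a b c :: "'a bop" and r s :: real
  show "a + b + c = a + (b + c)" by transfer simp
  show "a + b = b + a" by transfer simp
  show "0 + a = a" by transfer simp
  show "- a + a = 0" by transfer simp
  show "a - b = a + - b" by transfer simp
  show "r *\<^sub>R (a + b) = r *\<^sub>R a + r *\<^sub>R b" by transfer (simp add: scaleR_add_right)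
  show "(r + s) *\<^sub>R a = r *\<^sub>R a + s *\<^sub>R a" by transfer (simp add: scaleR_add_left)
  show "r *\<^sub>R s *\<^sub>R a = (r * s) *\<^sub>R a" by transfer simp
  show "1 *\<^sub>R a = a" by transfer simp
  show "norm a = 0 \<longleftrightarrow> a = 0" by transfer simp
  show "norm (a + b) \<le> norm a + norm b" by transfer (rule norm_triangle_ineq)
  show "norm (r *\<^sub>R a) = \<bar>r\<bar> * norm a" by transfer simp
qed (simp_all add: sgn_bop_def dist_bop_def uniformity_bop_def open_bop_def)

end

instantiation bop :: (complex_hilbert_space) real_normed_algebra
begin

lift_definition times_bop :: "'a bop \<Rightarrow> 'a bop \<Rightarrow> 'a bop" is "(o\<^sub>L)"
  by simp

instance
proof
  fix a b c :: "'a bop" and r :: real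
  show "a * b * c = a * (b * c)" by transfer (auto intro: blinfun_eqI)
  show "(a + b) * c = a * c + b * c" by transfer (auto intro: blinfun_eqI simp: blinfun.add_left blinfun.add_right blinfun.scaleR_left blinfun.scaleR_right)
  show "a * (b + c) = a * b + a * c" by transfer (auto intro: blinfun_eqI simp: blinfun.add_left blinfun.add_right blinfun.scaleR_left blinfun.scaleR_right)
  show "r *\<^sub>R a * b = r *\<^sub>R (a * b)"
    by transfer (auto intro: blinfun_eqI simp: blinfun.add_left blinfun.add_right blinfun.scaleR_left blinfun.scaleR_right)
  show "a * r *\<^sub>R b = r *\<^sub>R (a * b)"
    by transfer (auto intro: blinfun_eqI simp: blinfun.add_left blinfun.add_right blinfun.scaleR_left blinfun.scaleR_right)
  show "norm (a * b) \<le> norm a * norm b" by transfer (rule norm_blinfun_compose)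
qed

end

text \<open>
  Only \<^class>\<open>monoid_mult\<close> is instantiated, since \<open>0 \<noteq> 1\<close> fails on the zero Hilbert space.
\<close>

instantiation bop :: (complex_hilbert_space) monoid_mult
begin

lift_definition one_bop :: "'a bop" is id_blinfun by simp

instance
  by standard (transfer, auto intro: blinfun_eqI)+

end

instance bop :: (complex_hilbert_space) banach
proof
  fix X :: "nat \<Rightarrow> 'a bop"
  assume "Cauchy X"
  have d: "dist (blinfun_of_bop S) (blinfun_of_bop T) = dist S T" for S T :: "'a bop"
    by (simp add: dist_norm norm_bop.rep_eq minus_bop.rep_eq)
  from \<open>Cauchy X\<close> have "Cauchy (\<lambda>n. blinfun_of_bop (X n))"
    by (simp add: Cauchy_def d)
  then obtain L where L: "(\<lambda>n. blinfun_of_bop (X n)) \<longlonglongrightarrow> L"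
    by (auto simp: Cauchy_convergent_iff convergent_def)
  have "blinfun_apply L (c *\<^sub>C x) = c *\<^sub>C blinfun_apply L x" for c x
  proof (rule LIMSEQ_unique)
    show "(\<lambda>n. blinfun_apply (blinfun_of_bop (X n)) (c *\<^sub>C x)) \<longlonglongrightarrow> blinfun_apply L (c *\<^sub>C x)"
      by (intro tendsto_intros L)
    have "(\<lambda>n. c *\<^sub>C blinfun_apply (blinfun_of_bop (X n)) x) \<longlonglongrightarrow> c *\<^sub>C blinfun_apply L x"
      by (intro bounded_linear.tendsto[OF bounded_linear_scaleC] tendsto_intros L)
    moreover have "c *\<^sub>C blinfun_apply (blinfun_of_bop (X n)) x
        = blinfun_apply (blinfun_of_bop (X n)) (c *\<^sub>C x)" for n
      using blinfun_of_bop[of "X n"] by simp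
    ultimately show "(\<lambda>n. blinfun_apply (blinfun_of_bop (X n)) (c *\<^sub>C x))
        \<longlonglongrightarrow> c *\<^sub>C blinfun_apply L x"
      by simp
  qed
  then have "blinfun_of_bop (bop_of_blinfun L) = L"
    by (intro bop_of_blinfun_inverse) simp
  with L have "(\<lambda>n. dist (blinfun_of_bop (X n)) (blinfun_of_bop (bop_of_blinfun L))) \<longlonglongrightarrow> 0"
    by (simp flip: tendsto_dist_iff)
  then have "X \<longlonglongrightarrow> bop_of_blinfun L"
    unfolding d by (simp flip: tendsto_dist_iff)
  then show "convergent X"
    by (auto simp: convergent_def)
qed

lift_definition scaleC_bop :: "complex \<Rightarrow> 'h::complex_hilbert_space bop \<Rightarrow> 'h bop"  (infixr "\<cdot>\<^sub>C" 75)
  is "\<lambda>c T. Blinfun ((*\<^sub>C) c) o\<^sub>L T"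
  by (simp add: bounded_linear_Blinfun_apply bounded_linear_scaleC scaleC_scaleC mult.commute)

lemma bop_apply_scaleC: "bop_apply (c \<cdot>\<^sub>C T) x = c *\<^sub>C bop_apply T x"
  by transfer (simp add: bounded_linear_Blinfun_apply bounded_linear_scaleC)


subsection \<open>The adjoint\<close>

definition star :: "'h::complex_hilbert_space bop \<Rightarrow> 'h bop"
  where "star T = (THE S. \<forall>x y. cinner (bop_apply S x) y = cinner x (bop_apply T y))"

text \<open>The Riesz representation theorem, which shows that \<^const>\<open>star\<close> is well defined.\<close>

lemma riesz_representation:
  fixes f :: "'a::{real_inner,banach} \<Rightarrow> real"
  assumes "bounded_linear f"
  shows "\<exists>u. \<forall>x. f x = inner u x"
proof -
  interpret f: bounded_linear f by fact
  define g where "g x = inner x x - 2 * f x" for x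
  obtain K where K: "\<And>x. norm (f x) \<le> norm x * K"
    using f.bounded by blast
  have "g x \<ge> - K\<^sup>2" for x
  proof -
    have "2 * f x \<le> 2 * (norm x * K)" using K[of x] by simp
    moreover have "0 \<le> (norm x - K)\<^sup>2" by simp
    ultimately show ?thesis
      by (simp add: g_def power2_diff power2_norm_eq_inner)
  qed
  then have bdd: "bdd_below (range g)" by (intro bdd_belowI2[of _ "- K\<^sup>2"]) simp
  define m where "m = Inf (range g)"
  have m: "m \<le> g x" for x unfolding m_def using bdd by (intro cInf_lower) auto
  have "\<exists>x. g x < m + 1 / Suc n" for n
  proof -
    have "Inf (range g) < m + 1 / Suc n" by (simp add: m_def)
    then show ?thesis using bdd by (subst (asm) cInf_less_iff) auto
  qed
  then obtain x where x: "\<And>n. g (x n) < m + 1 / Suc n" by metis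
  have par: "(norm (a - b))\<^sup>2 = 2 * g a + 2 * g b - 4 * g ((1/2) *\<^sub>R (a + b))" for a b
    by (simp add: g_def f.scaleR f.add power2_norm_eq_inner inner_add_left inner_add_right
        inner_diff_left inner_diff_right inner_commute algebra_simps)
  have dist2: "(norm (x k - x l))\<^sup>2 \<le> 2 / Suc k + 2 / Suc l" for k l
    using par[of "x k" "x l"] x[of k] x[of l] m[of "(1/2) *\<^sub>R (x k + x l)"] by argo
  have "Cauchy x"
  proof (rule metric_CauchyI)
    fix e :: real assume e: "0 < e"
    then obtain N where N: "4 / e\<^sup>2 < real N" using reals_Archimedean2 by blast
    have "dist (x k) (x l) < e" if "N \<le> k" "N \<le> l" for k l
    proof -
      have N1: "4 / (real N + 1) < e\<^sup>2" using N e by (simp add: field_simps add_strict_increasing)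
      have "2 / real (Suc k) \<le> 2 / (real N + 1)" "2 / real (Suc l) \<le> 2 / (real N + 1)"
        using that by (auto intro!: divide_left_mono)
      then have "(norm (x k - x l))\<^sup>2 < e\<^sup>2" using dist2[of k l] N1 by argo
      then show ?thesis using e by (simp add: dist_norm power_less_imp_less_base)
    qed
    then show "\<exists>N. \<forall>k\<ge>N. \<forall>l\<ge>N. dist (x k) (x l) < e" by blast
  qed
  then obtain u where u: "x \<longlonglongrightarrow> u"
    by (auto simp: Cauchy_convergent_iff convergent_def)
  have "(\<lambda>n. g (x n)) \<longlonglongrightarrow> g u"
    unfolding g_def by (intro tendsto_intros f.tendsto u)
  moreover have "(\<lambda>n. m + 1 / Suc n) \<longlonglongrightarrow> m + 0"
    by (intro tendsto_intros LIMSEQ_Suc[OF lim_1_over_n])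
  ultimately have gu: "g u \<le> m"
    using LIMSEQ_le[of "\<lambda>n. g (x n)" "g u" "\<lambda>n. m + 1 / Suc n" m] x by (auto intro: less_imp_le)
  have "f v = inner u v" for v
  proof -
    define D where "D = inner u v - f v"
    have exp: "g (u + t *\<^sub>R v) = g u + 2 * t * D + t\<^sup>2 * inner v v" for t
      by (simp add: g_def D_def f.scaleR f.add inner_add_left inner_add_right inner_commute
          algebra_simps power2_eq_square)
    have q: "0 \<le> 2 * t * D + t\<^sup>2 * inner v v" for t
      using m[of "u + t *\<^sub>R v"] gu exp[of t] by simp
    define w where "w = inner v v + 1"
    have w: "w > 0" "inner v v = w - 1" by (simp_all add: w_def add_nonneg_pos)
    have "0 \<le> (2 * (- D / w) * D + (- D / w)\<^sup>2 * (w - 1)) * w\<^sup>2"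
      using q[of "- D / w"] w by simp
    also have "\<dots> = - (D\<^sup>2 * (w + 1))"
      using w(1) by (simp add: field_simps power2_eq_square)
    finally have "D\<^sup>2 * (w + 1) \<le> 0" by simp
    then have "D = 0" using w(1)
      by (smt (verit) mult_pos_pos zero_less_power2)
    then show ?thesis by (simp add: D_def)
  qed
  then show ?thesis by blast
qed

lemma bounded_linear_bop_apply: "bounded_linear (bop_apply T)"
  by transfer (rule blinfun.bounded_linear_right)

lemma bop_apply_scaleC_right: "bop_apply T (c *\<^sub>C x) = c *\<^sub>C bop_apply T x"
  by transfer simp

lemma ex1_adjoint:
  fixes T :: "'h::complex_hilbert_space bop"
  shows "\<exists>!S. \<forall>x y. cinner (bop_apply S x) y = cinner x (bop_apply T y)"
proof -
  have uniq: "a = b" if "\<And>y. cinner a y = cinner b y" for a b :: 'h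
  proof -
    have "inner (a - b) (a - b) = 0"
      using that[of "a - b"] by (simp add: inner_diff_left cinner_eq_iff_inner)
    then show ?thesis by simp
  qed
  have "\<exists>u. \<forall>y. inner x (bop_apply T y) = inner u y" for x
    by (rule riesz_representation)
      (intro bounded_linear_compose[OF bounded_linear_inner_right bounded_linear_bop_apply])
  then obtain A where A: "\<And>x y. inner x (bop_apply T y) = inner (A x) y" by metis
  have i: "inner (\<i> *\<^sub>C x) y = - inner x (\<i> *\<^sub>C y)" for x y :: 'h
    by (simp flip: Re_cinner add: cinner_scaleC_left cinner_scaleC_right)
  have cA: "cinner (A x) y = cinner x (bop_apply T y)" for x y
    by (simp add: cinner_eq_iff_inner A i bop_apply_scaleC_right flip: A)
  have add: "A (x + y) = A x + A y" for x y
    by (rule uniq) (simp add: cA cinner_add_left)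
  have sc: "A (c *\<^sub>C x) = c *\<^sub>C A x" for c x
    by (rule uniq) (simp add: cA cinner_scaleC_left)
  have bl: "bounded_linear A"
  proof (rule bounded_linear_intro)
    show "A (x + y) = A x + A y" for x y by (rule add)
    show "A (r *\<^sub>R x) = r *\<^sub>R A x" for r x
      using sc[of "complex_of_real r" x] by (simp add: scaleC_of_real)
    show "norm (A x) \<le> norm x * norm T" for x
    proof (cases "A x = 0")
      case False
      have "norm (A x) * norm (A x) = inner x (bop_apply T (A x))"
        by (simp add: A power2_norm_eq_inner flip: power2_eq_square)
      also have "\<dots> \<le> norm x * norm (bop_apply T (A x))"
        by (rule norm_cauchy_schwarz)
      also have "\<dots> \<le> norm x * (norm T * norm (A x))"
        by (intro mult_left_mono) (transfer, auto intro: norm_blinfun)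
      finally show ?thesis using False by (simp add: mult.assoc[symmetric])
    qed simp
  qed
  then have ap: "bop_apply (bop_of_blinfun (Blinfun A)) = A"
    by (simp add: bop_apply.rep_eq bop_of_blinfun_inverse bounded_linear_Blinfun_apply sc)
  show ?thesis
  proof (rule ex1I)
    show "\<forall>x y. cinner (bop_apply (bop_of_blinfun (Blinfun A)) x) y = cinner x (bop_apply T y)"
      by (simp add: ap cA)
    fix S :: "'h bop"
    assume "\<forall>x y. cinner (bop_apply S x) y = cinner x (bop_apply T y)"
    then show "S = bop_of_blinfun (Blinfun A)"
      by (intro bop_eqI uniq) (simp add: ap cA)
  qed
qed

lemma cinner_star: "cinner (bop_apply (star T) x) y = cinner x (bop_apply T y)"
  unfolding star_def using theI'[OF ex1_adjoint[of T]] by blast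

lemma star_eqI: "(\<And>x y. cinner (bop_apply S x) y = cinner x (bop_apply T y)) \<Longrightarrow> star T = S"
  unfolding star_def by (rule the1_equality[OF ex1_adjoint]) simp


section \<open>Von Neumann algebras with a faithful tracial state\<close>

definition commutant :: "'h::complex_hilbert_space bop set \<Rightarrow> 'h bop set"
  where "commutant S = {T. \<forall>A\<in>S. A * T = T * A}"

definition von_neumann_algebra :: "'h::complex_hilbert_space bop set \<Rightarrow> bool"
  where "von_neumann_algebra M \<longleftrightarrow> (\<forall>a\<in>M. star a \<in> M) \<and> commutant (commutant M) = M"

text \<open>States are only relevant on \<open>M\<close>; their values elsewhere are unconstrained.\<close>

definition tracial_state ::
    "'h::complex_hilbert_space bop set \<Rightarrow> ('h bop \<Rightarrow> complex) \<Rightarrow> bool"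
  where "tracial_state M \<tau> \<longleftrightarrow>
    (\<forall>a\<in>M. \<forall>b\<in>M. \<tau> (a + b) = \<tau> a + \<tau> b) \<and>
    (\<forall>c. \<forall>a\<in>M. \<tau> (c \<cdot>\<^sub>C a) = c * \<tau> a) \<and>
    (\<forall>a\<in>M. \<exists>r\<ge>0. \<tau> (star a * a) = complex_of_real r) \<and>
    \<tau> 1 = 1 \<and>
    (\<forall>a\<in>M. \<forall>b\<in>M. \<tau> (a * b) = \<tau> (b * a))"

definition faithful_on ::
    "'h::complex_hilbert_space bop set \<Rightarrow> ('h bop \<Rightarrow> complex) \<Rightarrow> bool"
  where "faithful_on M \<tau> \<longleftrightarrow> (\<forall>a\<in>M. \<tau> (star a * a) = 0 \<longrightarrow> a = 0)"

definition nc_probability_space ::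
    "'h::complex_hilbert_space bop set \<Rightarrow> ('h bop \<Rightarrow> complex) \<Rightarrow> bool"
  where "nc_probability_space M \<tau> \<longleftrightarrow>
    von_neumann_algebra M \<and> tracial_state M \<tau> \<and> faithful_on M \<tau>"

definition l2norm :: "('h::complex_hilbert_space bop \<Rightarrow> complex) \<Rightarrow> 'h bop \<Rightarrow> real"
  where "l2norm \<tau> a = sqrt (Re (\<tau> (star a * a)))"


section \<open>Freeness\<close>

text \<open>The unital \<open>\<star>\<close>-algebra generated by a set of operators.\<close>

inductive_set star_algebra ::
    "'h::complex_hilbert_space bop set \<Rightarrow> 'h bop set" for S
  where
    "a \<in> S \<Longrightarrow> a \<in> star_algebra S"
  | "1 \<in> star_algebra S"
  | "a \<in> star_algebra S \<Longrightarrow> b \<in> star_algebra S \<Longrightarrow> a + b \<in> star_algebra S"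
  | "a \<in> star_algebra S \<Longrightarrow> b \<in> star_algebra S \<Longrightarrow> a * b \<in> star_algebra S"
  | "a \<in> star_algebra S \<Longrightarrow> c \<cdot>\<^sub>C a \<in> star_algebra S"
  | "a \<in> star_algebra S \<Longrightarrow> star a \<in> star_algebra S"

text \<open>
  A family of unital subalgebras is free if every alternating product
  \<open>a\<^sub>1 \<cdots> a\<^sub>n\<close> (\<open>n \<ge> 1\<close>) of centred elements is centred; \<open>is ! k\<close> is the index of the
  algebra containing \<open>as ! k\<close>.
\<close>

definition free_subalgebras ::
    "('h::complex_hilbert_space bop \<Rightarrow> complex) \<Rightarrow> 'i set \<Rightarrow> ('i \<Rightarrow> 'h bop set) \<Rightarrow> bool"
  where "free_subalgebras \<tau> I \<A> \<longleftrightarrow>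
    (\<forall>is as. as \<noteq> [] \<longrightarrow> length is = length as \<longrightarrow> set is \<subseteq> I \<longrightarrow>
      (\<forall>k. Suc k < length is \<longrightarrow> is ! k \<noteq> is ! Suc k) \<longrightarrow>
      (\<forall>k < length as. as ! k \<in> \<A> (is ! k) \<and> \<tau> (as ! k) = 0) \<longrightarrow>
      \<tau> (prod_list as) = 0)"

definition star_free ::
    "('h::complex_hilbert_space bop \<Rightarrow> complex) \<Rightarrow> 'h bop set \<Rightarrow> 'h bop set \<Rightarrow> bool"
  where "star_free \<tau> S T \<longleftrightarrow>
    free_subalgebras \<tau> UNIV (\<lambda>b. if b then star_algebra S else star_algebra T)"


section \<open>Free Brownian motions\<close>

text \<open>
  For a self-adjoint element of a von Neumann algebra the distribution is compactly supported, hence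
  given by its moments.
\<close>

definition semicircular ::
    "('h::complex_hilbert_space bop \<Rightarrow> complex) \<Rightarrow> real \<Rightarrow> 'h bop \<Rightarrow> bool"
  where "semicircular \<tau> v a \<longleftrightarrow> star a = a \<and>
    (\<forall>n. \<tau> (a ^ n) = complex_of_real
       (integral {- 2 * sqrt v .. 2 * sqrt v} (\<lambda>x. x ^ n * (sqrt (4 * v - x\<^sup>2) / (2 * pi * v)))))"

definition filtration ::
    "'h::complex_hilbert_space bop set \<Rightarrow> (real \<Rightarrow> 'h bop set) \<Rightarrow> bool"
  where "filtration M \<F> \<longleftrightarrow>
    (\<forall>t\<ge>0. von_neumann_algebra (\<F> t) \<and> \<F> t \<subseteq> M) \<and>
    (\<forall>s t. 0 \<le> s \<longrightarrow> s \<le> t \<longrightarrow> \<F> s \<subseteq> \<F> t)"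

definition free_brownian_motion ::
    "('h::complex_hilbert_space bop \<Rightarrow> complex) \<Rightarrow> (real \<Rightarrow> 'h bop set) \<Rightarrow> (real \<Rightarrow> 'h bop) \<Rightarrow> bool"
  where "free_brownian_motion \<tau> \<F> X \<longleftrightarrow>
    X 0 = 0 \<and>
    (\<forall>t\<ge>0. X t \<in> \<F> t \<and> star (X t) = X t) \<and>
    (\<forall>s t. 0 \<le> s \<longrightarrow> s < t \<longrightarrow>
       semicircular \<tau> (t - s) (X t - X s) \<and> star_free \<tau> {X t - X s} (\<F> s))"

text \<open>
  \<open>I\<close> is the free Ito integral \<open>\<integral>\<^sub>0\<^sup>t U\<^sub>s dX\<^sub>s\<close>: the \<open>L\<^sup>2\<close>-limit of the integrals of simple adapted
  processes \<open>\<Sum>k<m. a\<^sub>k 1\<^bsub>[p\<^sub>k, p\<^sub>k\<^sub>+\<^sub>1)\<^esub>\<close> approximating \<open>U\<close> in \<open>L\<^sup>2([0,t]; L\<^sup>2(\<tau>))\<close>. By the free Ito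
  isometry, \<open>I\<close> does not depend on the approximation. Only integrands multiplying \<open>dX\<close> from the
  left occur here.
\<close>

definition simple_process ::
    "nat \<Rightarrow> (nat \<Rightarrow> real) \<Rightarrow> (nat \<Rightarrow> 'h::complex_hilbert_space bop) \<Rightarrow> real \<Rightarrow> 'h bop"
  where "simple_process m p a s = (\<Sum>k<m. indicat_real {p k..<p (Suc k)} s *\<^sub>R a k)"

definition has_free_ito_integral ::
    "'h::complex_hilbert_space bop set \<Rightarrow> ('h bop \<Rightarrow> complex) \<Rightarrow> (real \<Rightarrow> 'h bop set) \<Rightarrow>
     (real \<Rightarrow> 'h bop) \<Rightarrow> (real \<Rightarrow> 'h bop) \<Rightarrow> real \<Rightarrow> 'h bop \<Rightarrow> bool"
  where "has_free_ito_integral M \<tau> \<F> X U t I \<longleftrightarrow> I \<in> M \<and>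
    (\<exists>m p a.
      (\<forall>n. p n 0 = 0 \<and> p n (m n) = t \<and>
           (\<forall>k < m n. p n k \<le> p n (Suc k) \<and> a n k \<in> \<F> (p n k))) \<and>
      (\<forall>n. (\<lambda>s. (l2norm \<tau> (simple_process (m n) (p n) (a n) s - U s))\<^sup>2) integrable_on {0..t}) \<and>
      (\<lambda>n. integral {0..t} (\<lambda>s. (l2norm \<tau> (simple_process (m n) (p n) (a n) s - U s))\<^sup>2)) \<longlonglongrightarrow> 0 \<and>
      (\<lambda>n. l2norm \<tau> ((\<Sum>k < m n. a n k * (X (p n (Suc k)) - X (p n k))) - I)) \<longlonglongrightarrow> 0)"

text \<open>
  Unitary solutions of \<open>dY = \<i> Y dX - Y/2 dt\<close>, \<open>Y\<^sub>0 = 1\<close>, in integrated form. As usual for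
  solutions of stochastic differential equations, \<open>Y\<close> is adapted and has (norm-)continuous paths.
  The initial condition is the instance \<open>t = 0\<close>.
\<close>

definition free_unitary_brownian_motion ::
    "'h::complex_hilbert_space bop set \<Rightarrow> ('h bop \<Rightarrow> complex) \<Rightarrow> (real \<Rightarrow> 'h bop) \<Rightarrow> bool"
  where "free_unitary_brownian_motion M \<tau> Y \<longleftrightarrow>
    (\<exists>\<F> X. filtration M \<F> \<and> free_brownian_motion \<tau> \<F> X \<and>
      continuous_on {0..} Y \<and>
      (\<forall>t\<ge>0. Y t \<in> \<F> t \<and> star (Y t) * Y t = 1 \<and> Y t * star (Y t) = 1 \<and>
        (\<exists>I. has_free_ito_integral M \<tau> \<F> X Y t I \<and>
             Y t = 1 + \<i> \<cdot>\<^sub>C I - (1/2) *\<^sub>R integral {0..t} Y)))"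

definition normalized_moment ::
    "('h::complex_hilbert_space bop \<Rightarrow> complex) \<Rightarrow> (real \<Rightarrow> 'h bop) \<Rightarrow> nat \<Rightarrow> real \<Rightarrow> complex"
  where "normalized_moment \<tau> Y n t =
    (if n = 0 then 1 else complex_of_real (exp (real n * t / 2)) * \<tau> (Y t ^ n))"

end

theory Submission
  imports Defs "HOL-Complex_Analysis.Laurent_Convergence"
begin

text \<open>
  The Ito isometry identifies an increment of \<open>Y\<close>, up to an error of smaller order in \<open>L\<^sup>2\<close>, with
  \<open>\<i> Y\<^sub>s (X\<^sub>t - X\<^sub>s) - Y\<^sub>s (t - s) / 2\<close>, where \<open>X\<^sub>t - X\<^sub>s\<close> is free from \<open>Y\<^sub>s\<close>. A second order expansion
  of \<open>\<tau> (Y\<^sub>t\<^sup>n)\<close> then shows that \<open>\<psi> = \<Sum>n\<ge>1. Q\<^sub>n X\<^sup>n\<close> solves the Burgers equation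
  \<open>\<partial>\<^sub>t \<psi> = - \<psi> X \<partial>\<psi>/\<partial>X\<close> and hence, by characteristics, \<open>\<psi> e\<^bsup>t\<psi>\<^esup> = X (1 + \<psi>)\<close>. On the other hand
  freeness of \<open>P\<close> and \<open>y = e\<^bsup>t/2\<^esup> Y\<^sub>t\<close> gives \<open>G \<circ> Z = \<psi>\<close> for \<open>G = \<Sum>n\<ge>1. \<tau> ((P y)\<^sup>n) X\<^sup>n\<close> and
  \<open>Z = X (1 + \<psi>) / (\<alpha> + \<psi>)\<close>, so that \<open>G e\<^bsup>tG\<^esup> = X (\<alpha> + G)\<close>. The series \<open>\<alpha> \<psi>\<close> at time \<open>\<alpha> t\<close>
  solves the same equation, which has only one solution without constant term.
\<close>

section \<open>Bounded operators\<close>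

text \<open>The order of the expansion is dictated by sizes: in L2 an increment of \<open>Y\<close>
  over a time h is of order sqrt h, so products of two increments still count at order h. Products
  of three cannot be estimated by L2 norms alone, since a trace is controlled by two L2 norms times
  operator norms of all other factors; norm continuity of \<open>Y\<close> supplies the missing
  small factor. The quadratic term of the Burgers equation is the free Ito rule: an increment d of
  \<open>X\<close> and elements a, b of its past satisfy tau(a d b d) = (t - s) tau(a) tau(b). The
  exponential equations enter only through their logarithmic derivatives, which avoids exponentials
  of formal series. Differentiation loses a multiplicative constant, so the linear coefficients have
  to be compared separately. The time change comes from substituting psi = G / alpha: at time alpha
  t the equation psi e^(alpha t psi) = X (1 + psi) becomes G e^(t G) = X (alpha + G).\<close>

lemma bop_apply_simps [simp]:
  fixes S T :: "'h::complex_hilbert_space bop"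
  shows "bop_apply (S + T) x = bop_apply S x + bop_apply T x"
    and "bop_apply (S - T) x = bop_apply S x - bop_apply T x"
    and "bop_apply (- T) x = - bop_apply T x"
    and "bop_apply 0 x = 0"
    and "bop_apply (S * T) x = bop_apply S (bop_apply T x)"
    and "bop_apply 1 x = x"
    and "bop_apply (r *\<^sub>R T) x = r *\<^sub>R bop_apply T x"
    and "bop_apply (c \<cdot>\<^sub>C T) x = c *\<^sub>C bop_apply T x"
  by (transfer, simp add: blinfun.add_left blinfun.diff_left blinfun.minus_left blinfun.scaleR_left
      bounded_linear_Blinfun_apply bounded_linear_scaleC)+

lemma norm_bop_apply: "norm (bop_apply T x) \<le> norm T * norm x"
  by transfer (rule norm_blinfun)

lemma norm_bop_bound: "0 \<le> b \<Longrightarrow> (\<And>x. norm (bop_apply T x) \<le> b * norm x) \<Longrightarrow> norm T \<le> b"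
  by transfer (rule norm_blinfun_bound)

text \<open>Equality fails on the zero Hilbert space, where the identity is 0; upper bounds by 1
  suffice below.\<close>

lemma norm_one_bop: "norm (1 :: 'h::complex_hilbert_space bop) \<le> 1"
  by (rule norm_bop_bound) auto

lemma norm_power_bop: "norm ((T :: 'h::complex_hilbert_space bop) ^ n) \<le> norm T ^ n"
proof (induction n)
  case 0
  show ?case using norm_one_bop by simp
next
  case (Suc n)
  have "norm (T * T ^ n) \<le> norm T * norm (T ^ n)" by (rule norm_mult_ineq)
  also have "\<dots> \<le> norm T * norm T ^ n" by (intro mult_left_mono Suc.IH) auto
  finally show ?case by simp
qed

lemma scaleC_bop_simps:
  fixes S T :: "'h::complex_hilbert_space bop"
  shows "c \<cdot>\<^sub>C (S + T) = c \<cdot>\<^sub>C S + c \<cdot>\<^sub>C T"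
    and "(c + d) \<cdot>\<^sub>C T = c \<cdot>\<^sub>C T + d \<cdot>\<^sub>C T"
    and "c \<cdot>\<^sub>C (S - T) = c \<cdot>\<^sub>C S - c \<cdot>\<^sub>C T"
    and "(c - d) \<cdot>\<^sub>C T = c \<cdot>\<^sub>C T - d \<cdot>\<^sub>C T"
    and "c \<cdot>\<^sub>C d \<cdot>\<^sub>C T = (c * d) \<cdot>\<^sub>C T"
    and "c \<cdot>\<^sub>C 0 = (0 :: 'h bop)"
    and "c \<cdot>\<^sub>C (- T) = - (c \<cdot>\<^sub>C T)"
  by (rule bop_eqI, simp add: scaleC_add_right scaleC_add_left scaleC_diff_right scaleC_scaleC;
      metis scaleC_add_left add_diff_cancel_right' diff_add_cancel)+

lemma scaleC_bop_of_real: "complex_of_real r \<cdot>\<^sub>C T = r *\<^sub>R T"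
  by (rule bop_eqI) (simp add: scaleC_of_real)

lemma scaleC_bop_one [simp]: "1 \<cdot>\<^sub>C T = T"
  using scaleC_bop_of_real[of 1 T] by simp

lemma scaleC_bop_zero [simp]: "0 \<cdot>\<^sub>C T = 0"
  using scaleC_bop_of_real[of 0 T] by simp

lemma scaleC_bop_minus_one: "(- c) \<cdot>\<^sub>C T = - (c \<cdot>\<^sub>C T)"
  using scaleC_bop_simps(4)[of 0 c T] by simp

lemma mult_scaleC_bop [simp]:
  fixes S T :: "'h::complex_hilbert_space bop"
  shows "(c \<cdot>\<^sub>C S) * T = c \<cdot>\<^sub>C (S * T)"
    and "S * (c \<cdot>\<^sub>C T) = c \<cdot>\<^sub>C (S * T)"
  by (rule bop_eqI, simp add: bop_apply_scaleC_right)+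

lemma norm_scaleC_bop: "norm (c \<cdot>\<^sub>C T) = cmod c * norm T"
proof -
  have le: "norm (c \<cdot>\<^sub>C S) \<le> cmod c * norm S" for c and S :: "'a bop"
  proof (rule norm_bop_bound)
    fix x
    have "cmod c * norm (bop_apply S x) \<le> cmod c * (norm S * norm x)"
      by (intro mult_left_mono norm_bop_apply) auto
    then show "norm (bop_apply (c \<cdot>\<^sub>C S) x) \<le> cmod c * norm S * norm x"
      by (simp add: norm_scaleC mult.assoc)
  qed auto
  show ?thesis
  proof (cases "c = 0")
    case False
    have "norm T = norm (inverse c \<cdot>\<^sub>C c \<cdot>\<^sub>C T)"
      using False by (simp add: scaleC_bop_simps(5))
    also have "\<dots> \<le> cmod (inverse c) * norm (c \<cdot>\<^sub>C T)" by (rule le)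
    finally have "cmod c * norm T \<le> norm (c \<cdot>\<^sub>C T)"
      using False by (simp add: norm_inverse inverse_eq_divide norm_divide field_simps)
    with le[of c T] show ?thesis by simp
  qed simp
qed

lemma power_scaleC_bop: "(c \<cdot>\<^sub>C T) ^ n = (c ^ n) \<cdot>\<^sub>C (T ^ n)"
  by (induction n) (auto simp: scaleC_bop_simps(5) mult.commute[of c])

lemma cinner_star_right: "cinner x (bop_apply (star T) y) = cinner (bop_apply T x) y"
  by (metis cinner_star cinner_commute)

lemma star_star [simp]: "star (star T) = T"
  by (rule star_eqI) (simp add: cinner_star_right)

lemma star_zero [simp]: "star 0 = 0"
  by (rule star_eqI) (simp add: Re_cinner cinner_eq_iff_inner)

lemma star_one [simp]: "star 1 = 1"
  by (rule star_eqI) simp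

lemma star_add [simp]: "star (S + T) = star S + star T"
  by (rule star_eqI) (simp add: cinner_add_left cinner_add_right cinner_star)

lemma star_mult [simp]: "star (S * T) = star T * star S"
  by (rule star_eqI) (simp add: cinner_star)

lemma star_scaleC [simp]: "star (c \<cdot>\<^sub>C T) = cnj c \<cdot>\<^sub>C star T"
  by (rule star_eqI) (simp add: cinner_scaleC_left cinner_scaleC_right cinner_star)

lemma star_uminus [simp]: "star (- T) = - star T"
  using star_scaleC[of "-1" T] by (simp add: scaleC_bop_minus_one)

lemma star_diff [simp]: "star (S - T) = star S - star T"
  using star_add[of S "- T"] by (simp del: star_add)

lemma star_scaleR [simp]: "star (r *\<^sub>R T) = r *\<^sub>R star T"
  using star_scaleC[of "complex_of_real r" T] by (simp add: scaleC_bop_of_real)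

lemma norm_star [simp]: "norm (star T) = norm T"
proof -
  have le: "norm (star S) \<le> norm S" for S :: "'a bop"
  proof (rule norm_bop_bound)
    fix x
    let ?y = "bop_apply (star S) x"
    have "norm ?y * norm ?y = Re (cinner ?y ?y)"
      by (simp add: Re_cinner power2_norm_eq_inner flip: power2_eq_square)
    also have "\<dots> = inner x (bop_apply S ?y)" by (simp add: cinner_star Re_cinner)
    also have "\<dots> \<le> norm x * norm (bop_apply S ?y)" by (rule norm_cauchy_schwarz)
    also have "\<dots> \<le> norm x * (norm S * norm ?y)" by (intro mult_left_mono norm_bop_apply) auto
    finally show "norm ?y \<le> norm S * norm x"
      by (cases "?y = 0") (auto simp: mult.assoc[symmetric] mult.commute)
  qed auto
  show ?thesis using le[of T] le[of "star T"] by simp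
qed

lemma norm_unitary: "star (U :: 'h::complex_hilbert_space bop) * U = 1 \<Longrightarrow> norm U \<le> 1"
proof (rule norm_bop_bound)
  fix x assume U: "star U * U = 1"
  have "(norm (bop_apply U x))\<^sup>2 = Re (cinner x (bop_apply (star U * U) x))"
    by (simp add: cinner_star_right Re_cinner power2_norm_eq_inner)
  also have "\<dots> = (norm x)\<^sup>2" by (simp add: U Re_cinner power2_norm_eq_inner)
  finally show "norm (bop_apply U x) \<le> 1 * norm x" by (simp add: power2_eq_iff_nonneg)
qed auto

lemma bounded_linear_star: "bounded_linear (star :: 'h::complex_hilbert_space bop \<Rightarrow> _)"
  by (rule bounded_linear_intro[where K = 1]) auto

section \<open>Von Neumann algebras\<close>

lemma commutant_closed_under:
  assumes "S \<in> commutant N" "T \<in> commutant (N :: 'h::complex_hilbert_space bop set)"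
  shows "S + T \<in> commutant N" "S * T \<in> commutant N" "c \<cdot>\<^sub>C S \<in> commutant N"
  using assms unfolding commutant_def
  by (auto simp: algebra_simps) (metis mult.assoc)

lemma one_in_commutant: "1 \<in> commutant N"
  by (auto simp: commutant_def)

lemma closed_commutant: "closed (commutant (N :: 'h::complex_hilbert_space bop set))"
proof -
  have "commutant N = (\<Inter>A\<in>N. {T. A * T = T * A})" by (auto simp: commutant_def)
  also have "closed \<dots>"
    by (intro closed_INT ballI closed_Collect_eq continuous_intros)
  finally show ?thesis .
qed

locale vn_algebra =
  fixes M :: "'h::complex_hilbert_space bop set"
  assumes vn: "von_neumann_algebra M"
begin

lemma M_eq: "M = commutant (commutant M)"
  using vn by (simp add: von_neumann_algebra_def)

lemma one_mem [simp, intro]: "1 \<in> M"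
  by (subst M_eq) (rule one_in_commutant)

lemma add_mem [intro]: "a \<in> M \<Longrightarrow> b \<in> M \<Longrightarrow> a + b \<in> M"
  and mult_mem [intro]: "a \<in> M \<Longrightarrow> b \<in> M \<Longrightarrow> a * b \<in> M"
  and scaleC_mem [intro]: "a \<in> M \<Longrightarrow> c \<cdot>\<^sub>C a \<in> M"
  using commutant_closed_under[of _ "commutant M"] M_eq by metis+

lemma star_mem [intro]: "a \<in> M \<Longrightarrow> star a \<in> M"
  using vn by (simp add: von_neumann_algebra_def)

lemma scaleR_mem [intro]: "a \<in> M \<Longrightarrow> r *\<^sub>R a \<in> M"
  by (metis scaleC_mem scaleC_bop_of_real)

lemma uminus_mem [intro]: "a \<in> M \<Longrightarrow> - a \<in> M"
  using scaleR_mem[of a "-1"] by simp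

lemma diff_mem [intro]: "a \<in> M \<Longrightarrow> b \<in> M \<Longrightarrow> a - b \<in> M"
  using add_mem[of a "- b"] uminus_mem by auto

lemma zero_mem [simp, intro]: "0 \<in> M"
  using diff_mem[of 1 1] by simp

lemma power_mem [intro]: "a \<in> M \<Longrightarrow> a ^ n \<in> M"
  by (induction n) auto

lemma sum_mem [intro]: "(\<And>k. k \<in> A \<Longrightarrow> f k \<in> M) \<Longrightarrow> sum f A \<in> M"
  by (induction A rule: infinite_finite_induct) auto

lemma closed: "closed M"
  by (subst M_eq) (rule closed_commutant)

text \<open>\<open>1 - z\<close> is the square root: \<open>(1 - z)\<^sup>2 = 1 - y\<close> is the fixed point equation \<open>z = (y + z\<^sup>2) / 2\<close>.\<close>

lemma ex_sqrt:
  assumes y: "y \<in> M" "star y = y" "norm y < 1"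
  shows "\<exists>c\<in>M. star c = c \<and> c * c = 1 - y"
proof -
  define r where "r = norm y"
  \<comment> \<open>Membership in \<open>M\<close> and self-adjointness are built into the complete
    set on which the map contracts, so the fixed point inherits both. On the ball of radius
    \<open>r\<close> the Lipschitz constant is (\<open>norm u + norm v\<close>) / 2, which is at
    most \<open>r < 1\<close>.\<close>
  let ?s = "M \<inter> {z. star z = z} \<inter> cball 0 r"
  let ?f = "\<lambda>z. (1/2) *\<^sub>R (y + z * z)"
  have "closed {z :: 'h bop. star z = z}"
    by (intro closed_Collect_eq continuous_intros bounded_linear.continuous_on[OF bounded_linear_star])
  then have "complete ?s"
    by (simp add: complete_eq_closed closed closed_Int)
  moreover have "?s \<noteq> {}" by (auto simp: r_def intro!: exI[of _ 0])
  moreover have "?f ` ?s \<subseteq> ?s"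
  proof (rule image_subsetI)
    fix z assume "z \<in> ?s"
    then have z: "z \<in> M" "star z = z" "norm z \<le> r" by auto
    have "norm (z * z) \<le> norm z * norm z" by (rule norm_mult_ineq)
    also have "\<dots> \<le> r * 1" using z y by (intro mult_mono) (auto simp: r_def)
    finally have "norm (y + z * z) \<le> 2 * r" using norm_triangle_ineq[of y "z * z"] by (simp add: r_def)
    with z y show "?f z \<in> ?s" by (auto simp del: scaleR_add_right)
  qed
  moreover have "dist (?f u) (?f v) \<le> r * dist u v" if "u \<in> ?s" "v \<in> ?s" for u v
  proof -
    have "?f u - ?f v = (1/2) *\<^sub>R (u * (u - v) + (u - v) * v)"
      by (simp add: algebra_simps)
    then have "dist (?f u) (?f v) = norm (u * (u - v) + (u - v) * v) / 2"
      by (simp add: dist_norm)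
    also have "norm (u * (u - v) + (u - v) * v) \<le> norm u * norm (u - v) + norm (u - v) * norm v"
      by (rule order_trans[OF norm_triangle_ineq]) (intro add_mono norm_mult_ineq)
    also have "\<dots> \<le> r * norm (u - v) + norm (u - v) * r"
      using that by (intro add_mono mult_mono) (auto simp: r_def)
    finally show ?thesis by (simp add: dist_norm)
  qed
  ultimately have "\<exists>!z\<in>?s. ?f z = z"
    using y by (intro Banach_fix) (auto simp: r_def)
  then obtain z where z: "z \<in> M" "star z = z" "?f z = z" by blast
  then have "y + z * z = z + z" by (metis scaleR_half_double scaleR_add_right)
  then have "(1 - z) * (1 - z) = 1 - y" by (simp add: algebra_simps)
  with z show ?thesis by (intro bexI[of _ "1 - z"]) auto
qed

end

section \<open>Tracial states\<close>

locale tracial = vn_algebra M for M :: "'h::complex_hilbert_space bop set" +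
  fixes \<tau> :: "'h bop \<Rightarrow> complex"
  assumes tracial: "tracial_state M \<tau>"
begin

lemma tr_add: "a \<in> M \<Longrightarrow> b \<in> M \<Longrightarrow> \<tau> (a + b) = \<tau> a + \<tau> b"
  and tr_scaleC: "a \<in> M \<Longrightarrow> \<tau> (c \<cdot>\<^sub>C a) = c * \<tau> a"
  and tr_one [simp]: "\<tau> 1 = 1"
  and tr_commute: "a \<in> M \<Longrightarrow> b \<in> M \<Longrightarrow> \<tau> (a * b) = \<tau> (b * a)"
  and tr_positive: "a \<in> M \<Longrightarrow> \<exists>r\<ge>0. \<tau> (star a * a) = complex_of_real r"
  using tracial unfolding tracial_state_def by blast+

lemma tr_zero [simp]: "\<tau> 0 = 0"
  using tr_scaleC[of 0 0] by simp

lemma tr_uminus: "a \<in> M \<Longrightarrow> \<tau> (- a) = - \<tau> a"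
  using tr_scaleC[of a "-1"] by (simp add: scaleC_bop_minus_one)

lemma tr_diff: "a \<in> M \<Longrightarrow> b \<in> M \<Longrightarrow> \<tau> (a - b) = \<tau> a - \<tau> b"
  using tr_add[of a "- b"] tr_uminus[of b] by auto

lemma tr_scaleR: "a \<in> M \<Longrightarrow> \<tau> (r *\<^sub>R a) = of_real r * \<tau> a"
  by (metis tr_scaleC scaleC_bop_of_real)

lemma tr_sum: "(\<And>k. k \<in> A \<Longrightarrow> f k \<in> M) \<Longrightarrow> \<tau> (sum f A) = (\<Sum>k\<in>A. \<tau> (f k))"
proof (induction A rule: infinite_finite_induct)
  case (insert x F)
  then show ?case by (subst sum.insert) (auto simp: tr_add sum_mem)
qed auto

text \<open>Positivity makes \<open>\<tau> (star b * b)\<close> real. For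
  \<open>b = 1 + c \<cdot>\<^sub>C a\<close> this forces
  \<open>c * \<tau> a + cnj c * \<tau> (star a)\<close> to be real; c = 1 and c = i then determine
  both parts of \<open>\<tau> (star a)\<close>.\<close>

lemma tr_star: "a \<in> M \<Longrightarrow> \<tau> (star a) = cnj (\<tau> a)"
proof -
  assume a: "a \<in> M"
  have 1: "\<tau> (star (1 + c \<cdot>\<^sub>C a) * (1 + c \<cdot>\<^sub>C a))
      = 1 + c * \<tau> a + cnj c * \<tau> (star a) + cnj c * c * \<tau> (star a * a)" for c
  proof -
    have "star (1 + c \<cdot>\<^sub>C a) * (1 + c \<cdot>\<^sub>C a)
        = (1 + c \<cdot>\<^sub>C a) + (cnj c \<cdot>\<^sub>C star a + (cnj c * c) \<cdot>\<^sub>C (star a * a))"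
      by (simp add: distrib_left distrib_right scaleC_bop_simps)
        (metis mult.commute)
    with a show ?thesis
      by (subst \<open>_ = _\<close>) (simp add: tr_add tr_scaleC add_mem scaleC_mem star_mem mult_mem)
  qed
  have re: "Im (\<tau> (star b * b)) = 0" if "b \<in> M" for b
    using tr_positive[OF that] by auto
  have "Im (c * \<tau> a + cnj c * \<tau> (star a)) = 0" for c
  proof -
    have "cnj c * c = complex_of_real ((cmod c)\<^sup>2)"
      by (metis complex_norm_square mult.commute)
    then have "Im (cnj c * c * \<tau> (star a * a)) = 0" using re[OF a] by (simp del: of_real_power)
    moreover have "Im (\<tau> (star (1 + c \<cdot>\<^sub>C a) * (1 + c \<cdot>\<^sub>C a))) = 0"
      by (rule re) (use a in auto)
    ultimately show ?thesis unfolding 1 by (simp only: plus_complex.sel one_complex.sel)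
  qed
  from this[of 1] this[of \<i>] show ?thesis by (simp add: complex_eq_iff)
qed

lemma l2_nonneg [simp]: "0 \<le> l2norm \<tau> a" if "a \<in> M"
  using tr_positive[OF that] by (auto simp: l2norm_def)

lemma tr_star_self: "a \<in> M \<Longrightarrow> \<tau> (star a * a) = of_real ((l2norm \<tau> a)\<^sup>2)"
  using tr_positive[of a] by (auto simp: l2norm_def simp flip: of_real_power)

lemma l2_sq: "a \<in> M \<Longrightarrow> (l2norm \<tau> a)\<^sup>2 = Re (\<tau> (star a * a))"
  by (simp add: tr_star_self del: of_real_power)

lemma l2_star: "a \<in> M \<Longrightarrow> l2norm \<tau> (star a) = l2norm \<tau> a"
  by (simp add: l2norm_def tr_commute star_mem)

lemma l2_scaleC: "a \<in> M \<Longrightarrow> l2norm \<tau> (c \<cdot>\<^sub>C a) = cmod c * l2norm \<tau> a"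
proof -
  assume a: "a \<in> M"
  have "cnj c * c = complex_of_real ((cmod c)\<^sup>2)"
    by (metis complex_norm_square mult.commute)
  then have "\<tau> (star (c \<cdot>\<^sub>C a) * (c \<cdot>\<^sub>C a)) = of_real ((cmod c)\<^sup>2) * of_real ((l2norm \<tau> a)\<^sup>2)"
    using a by (simp add: scaleC_bop_simps tr_scaleC tr_star_self mult_mem star_mem mult.commute)
  then have "(l2norm \<tau> (c \<cdot>\<^sub>C a))\<^sup>2 = (cmod c * l2norm \<tau> a)\<^sup>2"
    using a by (simp add: l2_sq scaleC_mem power_mult_distrib del: of_real_power flip: of_real_mult)
  then show ?thesis
    using a by (simp add: power2_eq_iff_nonneg scaleC_mem)
qed

lemma l2_uminus: "a \<in> M \<Longrightarrow> l2norm \<tau> (- a) = l2norm \<tau> a"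
  using l2_scaleC[of a "-1"] by (simp add: scaleC_bop_minus_one)

lemma l2_scaleR: "a \<in> M \<Longrightarrow> l2norm \<tau> (r *\<^sub>R a) = \<bar>r\<bar> * l2norm \<tau> a"
  using l2_scaleC[of a "of_real r"] by (simp add: scaleC_bop_of_real)

lemma l2_one [simp]: "l2norm \<tau> 1 = 1"
  by (simp add: l2norm_def)

lemma l2_zero [simp]: "l2norm \<tau> 0 = 0"
  by (simp add: l2norm_def)

lemma l2_add_sq:
  assumes "a \<in> M" "b \<in> M"
  shows "(l2norm \<tau> (a + b))\<^sup>2 = (l2norm \<tau> a)\<^sup>2 + 2 * Re (\<tau> (star a * b)) + (l2norm \<tau> b)\<^sup>2"
proof -
  have "\<tau> (star b * a) = cnj (\<tau> (star a * b))"
    using tr_star[of "star a * b"] assms by auto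
  then show ?thesis
    using assms by (simp add: l2_sq add_mem distrib_left distrib_right tr_add star_mem mult_mem)
qed

text \<open>The squared L2 norm of \<open>a\<close> minus r times \<open>cnj p\<close> times
  \<open>b\<close> is a quadratic polynomial in the real number r, minimal at \<open>1 / B\<close>.
  If \<open>B = 0\<close> it is affine, and \<open>r = (A + 1) / (2 * Q)\<close> would give it the
  value -1. This case is not trivial, because without faithfulness a nonzero \<open>b\<close> may
  have L2 norm 0.\<close>

lemma cauchy_schwarz:
  assumes a: "a \<in> M" and b: "b \<in> M"
  shows "cmod (\<tau> (star a * b)) \<le> l2norm \<tau> a * l2norm \<tau> b"
proof -
  define p where "p = \<tau> (star a * b)"
  define A where "A = (l2norm \<tau> a)\<^sup>2"
  define B where "B = (l2norm \<tau> b)\<^sup>2"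
  define Q where "Q = (cmod p)\<^sup>2"
  have q: "0 \<le> A - 2 * r * Q + r\<^sup>2 * Q * B" for r
  proof -
    let ?c = "- complex_of_real r * cnj p"
    have "0 \<le> (l2norm \<tau> (a + ?c \<cdot>\<^sub>C b))\<^sup>2" by simp
    also have "\<dots> = A + 2 * Re (?c * p) + (cmod ?c * l2norm \<tau> b)\<^sup>2"
      using a b by (simp add: l2_add_sq scaleC_mem l2_scaleC A_def p_def tr_scaleC mult_mem star_mem)
    also have "?c * p = complex_of_real (- r * Q)"
      unfolding Q_def by (simp add: complex_norm_square mult_ac del: of_real_power)
    finally show ?thesis
      by (simp add: norm_mult power_mult_distrib B_def Q_def mult_ac)
  qed
  have nn: "0 \<le> A" "0 \<le> B" "0 \<le> Q" by (simp_all add: A_def B_def Q_def)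
  have "Q \<le> A * B"
  proof (cases "B = 0")
    case True
    show ?thesis
    proof (rule ccontr)
      assume "\<not> Q \<le> A * B"
      then have "Q > 0" using True by simp
      with q[of "(A + 1) / (2 * Q)"] True nn show False by simp
    qed
  next
    case False
    with nn have "B > 0" by simp
    with q[of "1 / B"] show ?thesis by (simp add: power2_eq_square field_simps)
  qed
  then have "(cmod p)\<^sup>2 \<le> (l2norm \<tau> a * l2norm \<tau> b)\<^sup>2"
    by (simp add: Q_def A_def B_def power_mult_distrib)
  then show ?thesis
    using a b by (simp add: p_def power2_le_iff_abs_le)
qed

lemma l2_triangle:
  assumes a: "a \<in> M" and b: "b \<in> M"
  shows "l2norm \<tau> (a + b) \<le> l2norm \<tau> a + l2norm \<tau> b"
proof -
  have "Re (\<tau> (star a * b)) \<le> l2norm \<tau> a * l2norm \<tau> b"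
    using cauchy_schwarz[OF a b] complex_Re_le_cmod order_trans by blast
  then have "(l2norm \<tau> (a + b))\<^sup>2 \<le> (l2norm \<tau> a + l2norm \<tau> b)\<^sup>2"
    using a b by (simp add: l2_add_sq power2_sum)
  then show ?thesis
    by (rule power2_le_imp_le) (use a b in auto)
qed

lemma l2_triangle_diff:
  "a \<in> M \<Longrightarrow> b \<in> M \<Longrightarrow> l2norm \<tau> (a - b) \<le> l2norm \<tau> a + l2norm \<tau> b"
  using l2_triangle[of a "- b"] by (simp add: l2_uminus uminus_mem)

lemma l2_add_sq_le:
  assumes a: "a \<in> M" and b: "b \<in> M"
  shows "(l2norm \<tau> (a + b))\<^sup>2 \<le> 2 * (l2norm \<tau> a)\<^sup>2 + 2 * (l2norm \<tau> b)\<^sup>2"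
proof -
  have "(l2norm \<tau> (a + b))\<^sup>2 \<le> (l2norm \<tau> a + l2norm \<tau> b)\<^sup>2"
    by (rule power_mono[OF l2_triangle]) (use a b add_mem in auto)
  also have "\<dots> \<le> 2 * (l2norm \<tau> a)\<^sup>2 + 2 * (l2norm \<tau> b)\<^sup>2"
    using sum_squares_bound[of "l2norm \<tau> a" "l2norm \<tau> b"] by (simp add: power2_sum)
  finally show ?thesis .
qed

text \<open>For r above the squared norm of \<open>a\<close>, the element \<open>star a * a\<close>
  divided by r has norm below 1, so \<open>ex_sqrt\<close> gives a self-adjoint \<open>c\<close> in
  \<open>M\<close> with \<open>c * c\<close> equal to 1 minus it. Positivity of
  \<open>\<tau> (star (c * b) * (c * b))\<close> is then the bound with r, and r is lowered to the
  limit at the end.\<close>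

lemma l2_mult_left:
  assumes a: "a \<in> M" and b: "b \<in> M"
  shows "l2norm \<tau> (a * b) \<le> norm a * l2norm \<tau> b"
proof -
  have *: "(l2norm \<tau> (a * b))\<^sup>2 \<le> r * (l2norm \<tau> b)\<^sup>2" if r: "(norm a)\<^sup>2 < r" for r
  proof -
    have r0: "r > 0" using r by (metis le_less_trans zero_le_power2)
    define y where "y = inverse r *\<^sub>R (star a * a)"
    have "norm (star a * a) \<le> norm (star a) * norm a" by (rule norm_mult_ineq)
    also have "\<dots> < r" using r by (simp add: power2_eq_square)
    finally have "norm y < 1" using r0 by (simp add: y_def field_simps)
    then obtain c where c: "c \<in> M" "star c = c" "c * c = 1 - y"
      using ex_sqrt[of y] a by (auto simp: y_def)
    have "(l2norm \<tau> (c * b))\<^sup>2 = Re (\<tau> (star b * (c * c) * b))"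
    proof -
      have "star (c * b) * (c * b) = star b * (c * c) * b"
        by (simp add: c(2) mult.assoc)
      then show ?thesis using b c by (simp only: l2_sq mult_mem)
    qed
    also have "star b * (c * c) * b = star b * b - inverse r *\<^sub>R (star (a * b) * (a * b))"
      by (simp add: c y_def algebra_simps)
    also have "Re (\<tau> \<dots>) = (l2norm \<tau> b)\<^sup>2 - inverse r * (l2norm \<tau> (a * b))\<^sup>2"
      using a b by (subst tr_diff) (auto simp: tr_scaleR l2_sq mult_mem star_mem simp del: star_mult of_real_inverse)
    finally have "inverse r * (l2norm \<tau> (a * b))\<^sup>2 \<le> (l2norm \<tau> b)\<^sup>2"
      by (smt (verit) zero_le_power2)
    then show ?thesis using r0 by (simp add: field_simps)
  qed
  have "(l2norm \<tau> (a * b))\<^sup>2 \<le> (norm a)\<^sup>2 * (l2norm \<tau> b)\<^sup>2"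
  proof (cases "l2norm \<tau> b = 0")
    case True
    then show ?thesis using *[of "(norm a)\<^sup>2 + 1"] by simp
  next
    case False
    then have pos: "(l2norm \<tau> b)\<^sup>2 > 0" by simp
    show ?thesis
    proof (rule field_le_epsilon)
      fix e :: real assume "e > 0"
      then show "(l2norm \<tau> (a * b))\<^sup>2 \<le> (norm a)\<^sup>2 * (l2norm \<tau> b)\<^sup>2 + e"
        using *[of "(norm a)\<^sup>2 + e / (l2norm \<tau> b)\<^sup>2"] pos False by (simp add: distrib_right)
    qed
  qed
  then have "(l2norm \<tau> (a * b))\<^sup>2 \<le> (norm a * l2norm \<tau> b)\<^sup>2" by (simp add: power_mult_distrib)
  then show ?thesis by (rule power2_le_imp_le) (use b in auto)
qed

text \<open>Adjoints preserve the L2 norm by traciality, which reduces right to left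
  multiplication.\<close>

lemma l2_mult_right:
  assumes a: "a \<in> M" and b: "b \<in> M"
  shows "l2norm \<tau> (b * a) \<le> norm a * l2norm \<tau> b"
  using l2_mult_left[of "star a" "star b"] l2_star[of "b * a"] l2_star[of b] a b
  by (auto simp: mult_mem)

lemma l2_le_norm: "a \<in> M \<Longrightarrow> l2norm \<tau> a \<le> norm a"
  using l2_mult_left[of a 1] by simp

lemma tr_le_l2: "a \<in> M \<Longrightarrow> cmod (\<tau> a) \<le> l2norm \<tau> a"
  using cauchy_schwarz[of 1 a] by simp

lemma tr_le_norm: "a \<in> M \<Longrightarrow> cmod (\<tau> a) \<le> norm a"
  using tr_le_l2 l2_le_norm order_trans by blast

lemma tr_mult_le_l2: "a \<in> M \<Longrightarrow> b \<in> M \<Longrightarrow> cmod (\<tau> (a * b)) \<le> l2norm \<tau> a * l2norm \<tau> b"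
  using cauchy_schwarz[of "star a" b] by (simp add: l2_star star_mem)

lemma tr_tendsto:
  assumes "(f \<longlongrightarrow> a) F" "eventually (\<lambda>x. f x \<in> M) F" "a \<in> M"
  shows "((\<lambda>x. \<tau> (f x)) \<longlongrightarrow> \<tau> a) F"
proof (rule LIM_zero_cancel)
  have lim: "((\<lambda>x. norm (f x - a)) \<longlongrightarrow> 0) F"
    using tendsto_norm[OF tendsto_diff[OF assms(1) tendsto_const[of a]]] by simp
  have "eventually (\<lambda>x. norm (\<tau> (f x) - \<tau> a) \<le> norm (f x - a)) F"
    using assms(2) by eventually_elim (metis assms(3) tr_le_norm tr_diff diff_mem)
  then show "((\<lambda>x. \<tau> (f x) - \<tau> a) \<longlongrightarrow> 0) F"
    by (rule Lim_null_comparison[OF _ lim])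
qed

lemma tr_star_mult_sum3:
  assumes "a \<in> M" "b \<in> M" "c \<in> M" "a' \<in> M" "b' \<in> M" "c' \<in> M"
  shows "\<tau> (star (a + b + c) * (a' + b' + c'))
    = \<tau> (star a * a') + \<tau> (star a * b') + \<tau> (star a * c')
    + \<tau> (star b * a') + \<tau> (star b * b') + \<tau> (star b * c')
    + \<tau> (star c * a') + \<tau> (star c * b') + \<tau> (star c * c')"
  using assms by (simp add: distrib_left distrib_right tr_add mult_mem star_mem add_mem)

end

section \<open>Free Brownian motion\<close>

text \<open>Mean and variance are all that the stochastic calculus below takes from the semicircular
  law. With R = 2 sqrt v the interval is [-R, R]; the square root is not differentiable at its ends,
  hence the interior form of the fundamental theorem.\<close>

lemma semicircular_first_integral:
  assumes v: "v > 0"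
  shows "((\<lambda>x. x * (sqrt (4 * v - x\<^sup>2) / (2 * pi * v))) has_integral 0) {- 2 * sqrt v .. 2 * sqrt v}"
proof -
  define R where "R = 2 * sqrt v"
  have R: "R > 0" "R\<^sup>2 = 4 * v" using v by (auto simp: R_def power2_eq_square)
  let ?F = "\<lambda>x. - (sqrt (R\<^sup>2 - x\<^sup>2) ^ 3) / 3 / (2 * pi * v)"
  have "((\<lambda>x. x * (sqrt (R\<^sup>2 - x\<^sup>2) / (2 * pi * v))) has_integral ?F R - ?F (- R)) {- R .. R}"
  proof (rule fundamental_theorem_of_calculus_interior)
    show "continuous_on {- R .. R} ?F" by (intro continuous_intros) (use v in auto)
    fix x assume x: "x \<in> {- R <..< R}"
    then have "0 < (R - x) * (R + x)" by (intro mult_pos_pos) auto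
    then have p: "R\<^sup>2 - x\<^sup>2 > 0" by (simp add: power2_eq_square algebra_simps)
    define s where "s = sqrt (R\<^sup>2 - x\<^sup>2)"
    have s: "s > 0" using p by (simp add: s_def)
    have ds: "((\<lambda>x. sqrt (R\<^sup>2 - x\<^sup>2)) has_field_derivative - x / s) (at x)"
      unfolding s_def using p by (auto intro!: derivative_eq_intros simp: field_simps)
    have "(?F has_field_derivative - (3 * (- x / s) * s ^ 2) / 3 / (2 * pi * v)) (at x)"
      unfolding s_def by (intro DERIV_cdivide DERIV_minus DERIV_cong[OF DERIV_power[OF ds[unfolded s_def], of 3]]) simp
    also have "- (3 * (- x / s) * s ^ 2) / 3 / (2 * pi * v) = x * (sqrt (R\<^sup>2 - x\<^sup>2) / (2 * pi * v))"
      unfolding s_def[symmetric] using s by (simp add: power2_eq_square)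
    finally have "(?F has_field_derivative x * (sqrt (R\<^sup>2 - x\<^sup>2) / (2 * pi * v))) (at x)" .
    then show "(?F has_vector_derivative x * (sqrt (R\<^sup>2 - x\<^sup>2) / (2 * pi * v))) (at x)"
      by (simp add: has_real_derivative_iff_has_vector_derivative)
  qed (use R in auto)
  then show ?thesis using R by (simp add: R_def)
qed

lemma semicircular_second_integral:
  assumes v: "v > 0"
  shows "((\<lambda>x. x\<^sup>2 * (sqrt (4 * v - x\<^sup>2) / (2 * pi * v))) has_integral v) {- 2 * sqrt v .. 2 * sqrt v}"
proof -
  define R where "R = 2 * sqrt v"
  have R: "R > 0" "R\<^sup>2 = 4 * v" using v by (auto simp: R_def power2_eq_square)
  \<comment> \<open>The numerator is a primitive of 8 x^2 sqrt(R^2 - x^2). Only the arcsine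
    contributes at the endpoints: R^4 pi / (16 pi v), which is v because R^2 = 4 v.\<close>
  let ?F = "\<lambda>x. (x * (2 * x\<^sup>2 - R\<^sup>2) * sqrt (R\<^sup>2 - x\<^sup>2) + R ^ 4 * arcsin (x / R)) / 8 / (2 * pi * v)"
  have "((\<lambda>x. x\<^sup>2 * (sqrt (R\<^sup>2 - x\<^sup>2) / (2 * pi * v))) has_integral ?F R - ?F (- R)) {- R .. R}"
  proof (rule fundamental_theorem_of_calculus_interior)
    show "continuous_on {- R .. R} ?F"
      by (intro continuous_intros continuous_on_compose2[OF continuous_on_arcsin'])
        (use v R in \<open>auto simp: field_simps\<close>)
    fix x assume x: "x \<in> {- R <..< R}"
    define s where "s = sqrt (R\<^sup>2 - x\<^sup>2)"
    have "0 < (R - x) * (R + x)" using x by (intro mult_pos_pos) auto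
    then have p: "R\<^sup>2 - x\<^sup>2 > 0" by (simp add: power2_eq_square algebra_simps)
    then have s: "s > 0" "s * s = R * R - x * x" by (simp_all add: s_def power2_eq_square)
    have q: "- 1 < x / R" "x / R < 1" using x R by (auto simp: field_simps)
    have "(s / R)\<^sup>2 = (R\<^sup>2 - x\<^sup>2) / R\<^sup>2" using p by (simp add: s_def power_divide)
    then have "1 - (x / R)\<^sup>2 = (s / R)\<^sup>2" using R(1) by (simp add: diff_divide_distrib power_divide)
    then have q': "sqrt (1 - (x / R)\<^sup>2) = s / R" using s R by simp
    have ds: "((\<lambda>x. sqrt (R\<^sup>2 - x\<^sup>2)) has_field_derivative - x / s) (at x)"
      unfolding s_def using p by (auto intro!: derivative_eq_intros simp: field_simps)
    have da: "((\<lambda>x. arcsin (x / R)) has_field_derivative 1 / s) (at x)"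
      using q q' s R by (auto intro!: derivative_eq_intros simp: field_simps)
    have dp: "((\<lambda>x. x * (2 * x\<^sup>2 - R\<^sup>2)) has_field_derivative 2 * x\<^sup>2 - R\<^sup>2 + x * (4 * x)) (at x)"
      by (auto intro!: derivative_eq_intros)
    have "((\<lambda>x. x * (2 * x\<^sup>2 - R\<^sup>2) * sqrt (R\<^sup>2 - x\<^sup>2) + R ^ 4 * arcsin (x / R)) has_field_derivative
        (2 * x\<^sup>2 - R\<^sup>2 + x * (4 * x)) * s + x * (2 * x\<^sup>2 - R\<^sup>2) * (- x / s) + R ^ 4 * (1 / s)) (at x)"
      by (rule DERIV_cong[OF DERIV_add[OF DERIV_mult[OF dp ds] DERIV_cmult[OF da, of "R ^ 4"]]])
        (simp add: s_def)
    also have "(2 * x\<^sup>2 - R\<^sup>2 + x * (4 * x)) * s + x * (2 * x\<^sup>2 - R\<^sup>2) * (- x / s) + R ^ 4 * (1 / s)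
        = 8 * x\<^sup>2 * s"
    proof -
      have "((2 * x\<^sup>2 - R\<^sup>2 + x * (4 * x)) * s + x * (2 * x\<^sup>2 - R\<^sup>2) * (- x / s) + R ^ 4 * (1 / s)) * s
          = (2 * x\<^sup>2 - R\<^sup>2 + x * (4 * x)) * (s * s) - x * (2 * x\<^sup>2 - R\<^sup>2) * x + R ^ 4"
        using s(1) by (simp add: field_simps)
      also have "\<dots> = 8 * x\<^sup>2 * (s * s)"
        unfolding s(2) by (simp add: power2_eq_square power4_eq_xxxx algebra_simps)
      finally show ?thesis using s(1) by (simp add: mult.assoc[symmetric])
    qed
    finally have "(?F has_field_derivative 8 * x\<^sup>2 * s / 8 / (2 * pi * v)) (at x)"
      by (intro DERIV_cdivide)
    then show "(?F has_vector_derivative x\<^sup>2 * (sqrt (R\<^sup>2 - x\<^sup>2) / (2 * pi * v))) (at x)"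
      by (simp add: has_real_derivative_iff_has_vector_derivative s_def)
  qed (use R in auto)
  moreover have "?F R - ?F (- R) = v"
  proof -
    have "R ^ 4 = (R\<^sup>2)\<^sup>2" by (simp flip: power_mult)
    also have "\<dots> = 16 * v\<^sup>2" by (simp add: R(2) power_mult_distrib)
    finally have "R ^ 4 = 16 * v\<^sup>2" .
    then show ?thesis using R(1) v by (simp add: power2_eq_square field_simps)
  qed
  ultimately show ?thesis using R by (simp add: R_def)
qed

section \<open>Freeness and the traces of increments against their past\<close>

lemma star_freeD:
  assumes "star_free \<tau> S T" "as \<noteq> []" "length bs = length as"
    and "\<And>k. Suc k < length as \<Longrightarrow> bs ! k \<noteq> bs ! Suc k"
    and "\<And>k. k < length as \<Longrightarrow> as ! k \<in> star_algebra (if bs ! k then S else T)"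
    and "\<And>k. k < length as \<Longrightarrow> \<tau> (as ! k) = 0"
  shows "\<tau> (prod_list as) = 0"
proof -
  have "as ! k \<in> (if bs ! k then star_algebra S else star_algebra T)" if "k < length as" for k
    using assms(5)[OF that] by (cases "bs ! k") auto
  with assms show ?thesis unfolding star_free_def free_subalgebras_def by fastforce
qed

lemma star_free_centred2:
  assumes "star_free \<tau> S T" "a \<in> star_algebra S" "b \<in> star_algebra T" "\<tau> a = 0" "\<tau> b = 0"
  shows "\<tau> (b * a) = 0"
proof -
  have "\<tau> (prod_list [b, a]) = 0"
    by (rule star_freeD[OF assms(1), where bs = "[False, True]"]) (use assms in \<open>auto simp: less_Suc_eq\<close>)
  then show ?thesis by (simp add: mult.assoc)
qed

lemma star_free_centred4:
  assumes "star_free \<tau> S T" "a \<in> star_algebra S" "b \<in> star_algebra T" "\<tau> a = 0" "\<tau> b = 0"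
    and "c \<in> star_algebra S" "d \<in> star_algebra T" "\<tau> c = 0" "\<tau> d = 0"
  shows "\<tau> (b * a * d * c) = 0"
proof -
  have "\<tau> (prod_list [b, a, d, c]) = 0"
    by (rule star_freeD[OF assms(1), where bs = "[False, True, False, True]"]) (use assms in \<open>auto simp: less_Suc_eq\<close>)
  then show ?thesis by (simp add: mult.assoc)
qed

locale free_bm = tracial M \<tau> for M :: "'h::complex_hilbert_space bop set" and \<tau> +
  fixes \<F> :: "real \<Rightarrow> 'h bop set" and X :: "real \<Rightarrow> 'h bop"
  assumes filtration: "filtration M \<F>"
    and bm: "free_brownian_motion \<tau> \<F> X"
begin

lemma F_vn: "0 \<le> t \<Longrightarrow> vn_algebra (\<F> t)"
  using filtration by (simp add: filtration_def vn_algebra_def)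

lemma F_M: "0 \<le> t \<Longrightarrow> a \<in> \<F> t \<Longrightarrow> a \<in> M"
  using filtration by (auto simp: filtration_def)

lemma F_mono: "0 \<le> s \<Longrightarrow> s \<le> t \<Longrightarrow> a \<in> \<F> s \<Longrightarrow> a \<in> \<F> t"
  using filtration unfolding filtration_def by blast

lemma X_F: "0 \<le> t \<Longrightarrow> X t \<in> \<F> t" and X_M: "0 \<le> t \<Longrightarrow> X t \<in> M"
  and X_star [simp]: "0 \<le> t \<Longrightarrow> star (X t) = X t"
  using bm F_M by (auto simp: free_brownian_motion_def)

lemma increment_M: "0 \<le> s \<Longrightarrow> s \<le> t \<Longrightarrow> X t - X s \<in> M"
  by (auto simp: X_M)

lemma increment_moments:
  assumes "0 \<le> s" "s < t"
  shows "\<tau> (X t - X s) = 0" "\<tau> ((X t - X s) * (X t - X s)) = complex_of_real (t - s)"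
proof -
  have sc: "\<tau> ((X t - X s) ^ n) = complex_of_real (integral {- 2 * sqrt (t - s) .. 2 * sqrt (t - s)}
      (\<lambda>x. x ^ n * (sqrt (4 * (t - s) - x\<^sup>2) / (2 * pi * (t - s)))))" for n
    using bm assms by (simp add: free_brownian_motion_def semicircular_def)
  have "t - s > 0" using assms by simp
  from semicircular_first_integral[OF this] semicircular_second_integral[OF this]
  show "\<tau> (X t - X s) = 0" "\<tau> ((X t - X s) * (X t - X s)) = complex_of_real (t - s)"
    using sc[of 1] sc[of 2] by (simp_all only: integral_unique power_one_right power2_eq_square of_real_0)
qed

lemma increment_free: "0 \<le> s \<Longrightarrow> s < t \<Longrightarrow> star_free \<tau> {X t - X s} (\<F> s)"
  using bm by (simp add: free_brownian_motion_def)

text \<open>Splitting \<open>a\<close> into its centred part and \<open>\<tau> a\<close>, freeness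
  kills the first product and the zero mean of the increment the second. Freeness is given only for
  \<open>s < t\<close>; at \<open>s = t\<close> the increment is 0.\<close>

lemma increment_martingale:
  assumes s: "0 \<le> s" "s \<le> t" and a: "a \<in> \<F> s"
  shows "\<tau> (a * (X t - X s)) = 0"
proof (cases "s = t")
  case False
  then have st: "s < t" using s by simp
  interpret F: vn_algebra "\<F> s" by (rule F_vn) fact
  let ?d = "X t - X s" and ?a = "a - \<tau> a \<cdot>\<^sub>C 1"
  have aM: "a \<in> M" "?d \<in> M" "?a \<in> M" using F_M a s increment_M by auto
  have "?a \<in> star_algebra (\<F> s)" using a by (intro star_algebra.intros(1)) auto
  then have "\<tau> (?a * ?d) = 0"
    using increment_moments[OF s(1) st] aM
    by (intro star_free_centred2[OF increment_free[OF s(1) st]])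
      (auto intro: star_algebra.intros simp: tr_diff tr_scaleC scaleC_mem)
  moreover have "a * ?d = ?a * ?d + \<tau> a \<cdot>\<^sub>C ?d" by (simp add: left_diff_distrib)
  ultimately show ?thesis
    using increment_moments(1)[OF s(1) st] aM
    by (metis add.right_neutral mult_mem mult_zero_right scaleC_mem tr_add tr_scaleC)
qed simp

text \<open>The square of the increment, centred by its variance t - s, still lies in the algebra
  generated by the increment, so its product with the centred \<open>a\<close> has trace 0.\<close>

lemma increment_covariance:
  assumes s: "0 \<le> s" "s \<le> t" and a: "a \<in> \<F> s"
  shows "\<tau> (a * ((X t - X s) * (X t - X s))) = of_real (t - s) * \<tau> a"
proof (cases "s = t")
  case False
  then have st: "s < t" using s by simp
  interpret F: vn_algebra "\<F> s" by (rule F_vn) fact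
  let ?d = "X t - X s" and ?a = "a - \<tau> a \<cdot>\<^sub>C 1"
  let ?d2 = "?d * ?d - of_real (t - s) \<cdot>\<^sub>C 1"
  have aM: "a \<in> M" "?d \<in> M" "?a \<in> M" using F_M a s increment_M by auto
  then have "?d2 \<in> M" by (metis diff_mem mult_mem scaleC_mem one_mem)
  note aM = aM this
  have d2: "?d2 = ?d * ?d + (- of_real (t - s)) \<cdot>\<^sub>C 1"
    by (simp only: scaleC_bop_minus_one diff_conv_add_uminus)
  have "?a \<in> star_algebra (\<F> s)" using a by (intro star_algebra.intros(1)) auto
  moreover have "?d2 \<in> star_algebra {?d}" unfolding d2
    by (intro star_algebra.intros) auto
  ultimately have "\<tau> (?a * ?d2) = 0"
    using increment_moments[OF s(1) st] aM
    by (intro star_free_centred2[OF increment_free[OF s(1) st]])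
      (auto simp: tr_diff tr_scaleC scaleC_mem mult_mem)
  moreover have "a * (?d * ?d) = ?a * ?d2 + \<tau> a \<cdot>\<^sub>C ?d2 + of_real (t - s) \<cdot>\<^sub>C a"
    by (simp add: left_diff_distrib right_diff_distrib scaleC_bop_simps mult.commute[of "\<tau> a"])
  moreover have "\<tau> ?d2 = 0"
    using increment_moments[OF s(1) st] aM by (auto simp: tr_diff tr_scaleC scaleC_mem mult_mem)
  ultimately show ?thesis
    using aM by (simp only: tr_add tr_scaleC scaleC_mem mult_mem add_mem) simp
qed simp

text \<open>The free Ito rule, the origin of the nonlinear term in the evolution of the moments.
  With \<open>a\<close> and \<open>b\<close> centred the word alternates between the two free
  algebras and has trace 0; the corrections contain the squared increment next to one element of the
  past, after a cyclic rotation if necessary.\<close>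

lemma increment_free_two:
  assumes s: "0 \<le> s" "s \<le> t" and a: "a \<in> \<F> s" and b: "b \<in> \<F> s"
  shows "\<tau> (a * (X t - X s) * b * (X t - X s)) = of_real (t - s) * (\<tau> a * \<tau> b)"
proof (cases "s = t")
  case False
  then have st: "s < t" using s by simp
  interpret F: vn_algebra "\<F> s" by (rule F_vn) fact
  define d where "d = X t - X s"
  let ?a = "a - \<tau> a \<cdot>\<^sub>C 1" and ?b = "b - \<tau> b \<cdot>\<^sub>C 1"
  have aM: "a \<in> M" "b \<in> M" "d \<in> M" "?a \<in> M" "?b \<in> M"
    using F_M a b s increment_M by (auto simp: d_def)
  have F: "?a \<in> \<F> s" "?b \<in> \<F> s" using a b by auto
  have "\<tau> (?a * d * ?b * d) = 0"
    using increment_moments[OF s(1) st] F aM unfolding d_def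
    by (intro star_free_centred4[OF increment_free[OF s(1) st]])
      (auto intro: star_algebra.intros(1) simp: tr_diff tr_scaleC scaleC_mem)
  moreover have "a * d * b * d = ?a * d * ?b * d + \<tau> b \<cdot>\<^sub>C (a * (d * d)) + \<tau> a \<cdot>\<^sub>C (d * ?b * d)"
    by (simp add: left_diff_distrib right_diff_distrib scaleC_bop_simps mult.assoc mult.commute[of "\<tau> b"])
  moreover have "\<tau> (d * ?b * d) = \<tau> (?b * (d * d))"
    using tr_commute[of "d" "?b * d"] aM by (auto simp: mult.assoc mult_mem)
  moreover have "\<tau> (?b * (d * d)) = 0"
    using increment_covariance[OF s F(2)] aM by (simp add: d_def tr_diff tr_scaleC scaleC_mem)
  moreover have "\<tau> (a * (d * d)) = of_real (t - s) * \<tau> a"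
    using increment_covariance[OF s a] by (simp add: d_def)
  moreover have "?a * d * ?b * d \<in> M" "a * (d * d) \<in> M" "d * ?b * d \<in> M"
    using aM by (intro mult_mem; simp)+
  ultimately show ?thesis
    unfolding d_def[symmetric] by (simp add: tr_add tr_scaleC scaleC_mem add_mem)
qed simp

text \<open>A simple adapted process is a list of triples \<open>(u, v, a)\<close> standing for \<open>a\<close> on \<open>[u, v)\<close>.\<close>

definition adapted :: "(real \<times> real \<times> 'h bop) list \<Rightarrow> bool" where
  "adapted L \<longleftrightarrow> (\<forall>(u, v, a)\<in>set L. 0 \<le> u \<and> u \<le> v \<and> a \<in> \<F> u)"

definition proc :: "(real \<times> real \<times> 'h bop) list \<Rightarrow> real \<Rightarrow> 'h bop" where
  "proc L x = (\<Sum>(u, v, a)\<leftarrow>L. indicat_real {u..<v} x *\<^sub>R a)"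

definition sint :: "(real \<times> real \<times> 'h bop) list \<Rightarrow> 'h bop" where
  "sint L = (\<Sum>(u, v, a)\<leftarrow>L. a * (X v - X u))"

text \<open>The intervals in a list may overlap, so a difference of simple processes is a
  concatenation with a negated list and partitions never need a common refinement.\<close>

definition negate :: "(real \<times> real \<times> 'h bop) list \<Rightarrow> (real \<times> real \<times> 'h bop) list" where
  "negate = map (\<lambda>(u, v, a). (u, v, - a))"

text \<open>Restriction of the process to times from \<open>s\<close> on. An interval that ends
  before \<open>s\<close> becomes the empty interval from \<open>s\<close> to \<open>s\<close>;
  moving a left endpoint up to \<open>s\<close> keeps the process adapted because the filtration
  increases.\<close>

definition from_time :: "real \<Rightarrow> (real \<times> real \<times> 'h bop) list \<Rightarrow> (real \<times> real \<times> 'h bop) list" where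
  "from_time s = map (\<lambda>(u, v, a). (max u s, max v s, a))"

lemma list_simps [simp]:
  "adapted []" "adapted ((u, v, a) # L) \<longleftrightarrow> 0 \<le> u \<and> u \<le> v \<and> a \<in> \<F> u \<and> adapted L"
  "adapted (L @ L') \<longleftrightarrow> adapted L \<and> adapted L'"
  "proc [] x = 0" "proc ((u, v, a) # L) x = indicat_real {u..<v} x *\<^sub>R a + proc L x"
  "proc (L @ L') x = proc L x + proc L' x"
  "sint [] = 0" "sint ((u, v, a) # L) = a * (X v - X u) + sint L"
  "sint (L @ L') = sint L + sint L'"
  by (simp_all add: adapted_def proc_def sint_def ball_Un)

lemma negate_simps [simp]:
  "proc (negate L) x = - proc L x" "sint (negate L) = - sint L"
  "adapted L \<Longrightarrow> adapted (negate L)"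
  "(\<forall>(u, v, a)\<in>set (negate L). P u v) \<longleftrightarrow> (\<forall>(u, v, a)\<in>set L. P u v)"
proof -
  show "proc (negate L) x = - proc L x" "sint (negate L) = - sint L"
    by (induction L) (auto simp: negate_def proc_def sint_def)
  show "adapted L \<Longrightarrow> adapted (negate L)"
    using vn_algebra.uminus_mem[OF F_vn] by (fastforce simp: adapted_def negate_def)
  show "(\<forall>(u, v, a)\<in>set (negate L). P u v) \<longleftrightarrow> (\<forall>(u, v, a)\<in>set L. P u v)"
    by (auto simp: negate_def)
qed

lemma proc_from_time: "proc (from_time s L) x = (if s \<le> x then proc L x else 0)"
  by (induction L) (auto simp: from_time_def proc_def indicator_def)

lemma adapted_from_time: "0 \<le> s \<Longrightarrow> adapted L \<Longrightarrow> adapted (from_time s L)"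
proof (induction L)
  case (Cons l L)
  obtain u v a where l: "l = (u, v, a)" by (cases l) auto
  have "a \<in> \<F> (max u s)" using Cons.prems F_mono[of u "max u s" a] by (simp add: l)
  with Cons show ?case by (simp add: l from_time_def max.coboundedI1)
qed (simp add: from_time_def)

lemma adapted_M:
  assumes "adapted L"
  shows "proc L x \<in> M" "sint L \<in> M"
proof -
  have "proc L x \<in> M \<and> sint L \<in> M"
    using assms
  proof (induction L)
    case (Cons l L)
    obtain u v a where l: "l = (u, v, a)" by (cases l) auto
    have "a \<in> M" "X v - X u \<in> M" using Cons.prems F_M increment_M by (auto simp: l)
    with Cons show ?case by (simp add: l add_mem scaleR_mem mult_mem)
  qed simp
  then show "proc L x \<in> M" "sint L \<in> M" by simp_all
qed

lemma proc_eq_0: "(\<forall>(u, v, a)\<in>set L. v \<le> T) \<Longrightarrow> T \<le> x \<Longrightarrow> proc L x = 0"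
  by (induction L) (auto simp: proc_def indicator_def)

section \<open>The Ito isometry for simple adapted processes\<close>

lemma has_integral_indicator_atLeastLessThan:
  assumes "0 \<le> a" "b \<le> T"
  shows "(indicat_real {a..<b} has_integral max 0 (b - a)) {0..T}"
proof (cases "a \<le> b")
  case True
  have "((\<lambda>x. 1::real) has_integral (b - a)) {a..b}"
    using has_integral_const_real[of "1::real" a b] True by simp
  then have "((\<lambda>x. if x \<in> {a..b} then 1 else 0::real) has_integral (b - a)) {0..T}"
    using assms by (subst has_integral_restrict) auto
  then have "(indicat_real {a..<b} has_integral (b - a)) {0..T}"
    by (rule has_integral_spike_finite[of "{b}", rotated 2]) (auto simp: indicator_def)
  then show ?thesis using True by simp
next
  case False
  then have "indicat_real {a..<b} = (\<lambda>_. 0)" by (auto simp: fun_eq_iff)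
  then show ?thesis using False by simp
qed

text \<open>All factors other than the later increment belong to the algebra at its starting time,
  so the martingale property applies. If the starred product carries the later increment, traciality
  first rotates that increment to the end.\<close>

lemma increment_cross_zero:
  assumes "0 \<le> u" "u \<le> v" "a \<in> \<F> u" "0 \<le> u'" "u' \<le> v'" "a' \<in> \<F> u'"
    and "v \<le> u' \<or> v' \<le> u"
  shows "\<tau> (star (a * (X v - X u)) * (a' * (X v' - X u'))) = 0"
proof -
  have M: "a \<in> M" "X v - X u \<in> M" "a' \<in> M" "X v' - X u' \<in> M"
    using assms F_M increment_M by auto
  show ?thesis
  proof (cases "v \<le> u'")
    case True
    interpret F: vn_algebra "\<F> u'" by (rule F_vn) fact
    have "X v \<in> \<F> u'" "X u \<in> \<F> u'" "a \<in> \<F> u'"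
      using True assms F_mono[of v u'] F_mono[of u u'] X_F by auto
    then have "star (a * (X v - X u)) * a' \<in> \<F> u'"
      using assms by blast
    then have "\<tau> (star (a * (X v - X u)) * a' * (X v' - X u')) = 0"
      using assms by (intro increment_martingale) auto
    then show ?thesis by (simp add: mult.assoc)
  next
    case False
    then have *: "v' \<le> u" using assms by simp
    interpret F: vn_algebra "\<F> u" by (rule F_vn) fact
    have "X v' \<in> \<F> u" "X u' \<in> \<F> u" "a' \<in> \<F> u"
      using * assms F_mono[of v' u] F_mono[of u' u] X_F by auto
    then have "star a * (a' * (X v' - X u')) \<in> \<F> u"
      using assms by blast
    then have "\<tau> (star a * (a' * (X v' - X u')) * (X v - X u)) = 0"
      using increment_martingale[of u v] assms by simp
    moreover have "star (a * (X v - X u)) * (a' * (X v' - X u'))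
        = (X v - X u) * (star a * (a' * (X v' - X u')))"
      using assms by (simp add: mult.assoc)
    ultimately show ?thesis
      using M tr_commute[of "X v - X u" "star a * (a' * (X v' - X u'))"]
      by (simp add: mult_mem star_mem)
  qed
qed

text \<open>The two intervals are cut at the endpoints of their intersection.\<close>

lemma increment_inner:
  assumes uv: "0 \<le> u" "u \<le> v" "a \<in> \<F> u" and uv': "0 \<le> u'" "u' \<le> v'" "a' \<in> \<F> u'"
  shows "\<tau> (star (a * (X v - X u)) * (a' * (X v' - X u')))
    = of_real (max 0 (min v v' - max u u')) * \<tau> (star a * a')"
proof (cases "v \<le> u' \<or> v' \<le> u")
  case True
  then show ?thesis using increment_cross_zero[OF assms] by (auto simp: max_def min_def)
next
  case False
  define l where "l = max u u'"
  define h where "h = min v v'"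
  have l: "u \<le> l" "u' \<le> l" "l \<le> h" "h \<le> v" "h \<le> v'" "0 \<le> l"
    using False assms by (auto simp: l_def h_def)
  have aF: "a \<in> \<F> l" "a' \<in> \<F> l" "a \<in> \<F> h" "a' \<in> \<F> h"
    using F_mono uv uv' l by (meson order_trans)+
  interpret F: vn_algebra "\<F> l" by (rule F_vn) fact
  let ?P = "\<lambda>u v. a * (X v - X u)" and ?P' = "\<lambda>u v. a' * (X v - X u)"
  have M: "?P x y \<in> M" "?P' x y \<in> M" if "0 \<le> x" "x \<le> y" for x y
    using that increment_M mult_mem F_M[OF uv(1,3)] F_M[OF uv'(1,3)] by auto
  have split: "?P u v = ?P u l + ?P l h + ?P h v" "?P' u' v' = ?P' u' l + ?P' l h + ?P' h v'"
    by (simp_all add: algebra_simps)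
  have z: "\<tau> (star (?P u l) * ?P' l h) = 0" "\<tau> (star (?P u l) * ?P' h v') = 0"
    "\<tau> (star (?P l h) * ?P' u' l) = 0" "\<tau> (star (?P l h) * ?P' h v') = 0"
    "\<tau> (star (?P h v) * ?P' u' l) = 0" "\<tau> (star (?P h v) * ?P' l h) = 0"
    using aF l uv uv' by (intro increment_cross_zero; simp)+
  have "\<tau> (star (?P u v) * ?P' u' v')
      = \<tau> (star (?P u l) * ?P' u' l) + \<tau> (star (?P u l) * ?P' l h) + \<tau> (star (?P u l) * ?P' h v')
      + \<tau> (star (?P l h) * ?P' u' l) + \<tau> (star (?P l h) * ?P' l h) + \<tau> (star (?P l h) * ?P' h v')
      + \<tau> (star (?P h v) * ?P' u' l) + \<tau> (star (?P h v) * ?P' l h) + \<tau> (star (?P h v) * ?P' h v')"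
    unfolding split using l uv uv' by (intro tr_star_mult_sum3 M) linarith+
  \<comment> \<open>Since \<open>l\<close> is \<open>u\<close> or \<open>u'\<close>, one of the two
    initial pieces has length 0; likewise for the final pieces at \<open>h\<close>.\<close>
  also have "\<tau> (star (?P u l) * ?P' u' l) = 0"
    using l uv uv' by (cases "u \<le> u'") (auto simp: l_def max_def)
  also have "\<tau> (star (?P h v) * ?P' h v') = 0"
    using l uv uv' by (cases "v \<le> v'") (auto simp: h_def min_def)
  also have "\<tau> (star (?P l h) * ?P' l h) = \<tau> ((star a * a') * ((X h - X l) * (X h - X l)))"
  proof -
    have "star (?P l h) = (X h - X l) * star a" using l by simp
    moreover have "X h - X l \<in> M" "star a * ?P' l h \<in> M"
      using increment_M[of l h] M[of l h] F_M[OF uv(1,3)] l by auto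
    ultimately show ?thesis
      using tr_commute[of "X h - X l" "star a * ?P' l h"] by (simp only: mult.assoc)
  qed
  also have "\<dots> = of_real (h - l) * \<tau> (star a * a')"
    using l aF by (intro increment_covariance) auto
  finally show ?thesis
    using l(3) unfolding l_def[symmetric] h_def[symmetric] z by (simp only: add_0_left add_0_right max_def) simp
qed

text \<open>Both sides are additive in each list, so two nested inductions reduce the claim to two
  single intervals, where it is \<open>increment_inner\<close>. The inner product form is proved
  because the quadratic form alone is not additive and would not pass through the induction.\<close>

lemma ito_isometry_inner:
  assumes "adapted L" "adapted L'" "\<forall>(u, v, a)\<in>set L. v \<le> T" "\<forall>(u, v, a)\<in>set L'. v \<le> T"
  shows "((\<lambda>x. Re (\<tau> (star (proc L x) * proc L' x))) has_integral Re (\<tau> (star (sint L) * sint L'))) {0..T}"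
  using assms(1,3)
proof (induction L)
  case (Cons l L)
  obtain u v a where l: "l = (u, v, a)" by (cases l) auto
  have uv: "0 \<le> u" "u \<le> v" "a \<in> \<F> u" "v \<le> T" and L: "adapted L" "\<forall>(u, v, a)\<in>set L. v \<le> T"
    using Cons.prems by (auto simp: l)
  have aM: "a \<in> M" "X v - X u \<in> M" using uv F_M increment_M by auto
  have "((\<lambda>x. Re (\<tau> (star (indicat_real {u..<v} x *\<^sub>R a) * proc L' x)))
      has_integral Re (\<tau> (star (a * (X v - X u)) * sint L'))) {0..T}"
    using assms(2,4)
  proof (induction L')
    case (Cons l' L')
    obtain u' v' a' where l': "l' = (u', v', a')" by (cases l') auto
    have uv': "0 \<le> u'" "u' \<le> v'" "a' \<in> \<F> u'" "v' \<le> T" and L': "adapted L'" "\<forall>(u, v, a)\<in>set L'. v \<le> T"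
      using Cons.prems by (auto simp: l')
    have aM': "a' \<in> M" "X v' - X u' \<in> M" using uv' F_M increment_M by auto
    have ind: "indicat_real {u'..<v'} x * indicat_real {u..<v} x = indicat_real {max u u'..<min v v'} x" for x
      by (auto simp: indicator_def)
    have "(indicat_real {max u u'..<min v v'} has_integral max 0 (min v v' - max u u')) {0..T}"
      using uv uv' by (intro has_integral_indicator_atLeastLessThan) auto
    from has_integral_mult_left[OF this, of "Re (\<tau> (star a * a'))"]
    have "((\<lambda>x. indicat_real {max u u'..<min v v'} x * Re (\<tau> (star a * a')))
        has_integral Re (\<tau> (star (a * (X v - X u)) * (a' * (X v' - X u'))))) {0..T}"
      using increment_inner[OF uv(1-3) uv'(1-3)] by simp
    from has_integral_add[OF this Cons.IH[OF L']]
    show ?case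
      using aM aM' adapted_M[OF L'(1)] unfolding l' ind[symmetric]
      by (simp add: distrib_left tr_add tr_scaleR scaleR_mem mult_mem star_mem del: star_mult star_diff)
  qed simp
  from has_integral_add[OF this Cons.IH[OF L]]
  show ?case
    using aM adapted_M[OF L(1)] adapted_M[OF assms(2)] unfolding l
    by (simp add: distrib_right tr_add tr_scaleR scaleR_mem mult_mem star_mem del: star_mult star_diff)
qed simp

lemma ito_isometry:
  assumes "adapted L" "\<forall>(u, v, a)\<in>set L. v \<le> T"
  shows "((\<lambda>x. (l2norm \<tau> (proc L x))\<^sup>2) has_integral (l2norm \<tau> (sint L))\<^sup>2) {0..T}"
  using ito_isometry_inner[OF assms(1) assms(1) assms(2) assms(2)] adapted_M[OF assms(1)]
  by (simp add: l2_sq)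

section \<open>Increments of the Ito integral\<close>

lemma ito_integral_approx:
  assumes "has_free_ito_integral M \<tau> \<F> X Y t I"
  obtains L where "\<And>n. adapted (L n)" "\<And>n. \<forall>(u, v, a)\<in>set (L n). v \<le> t"
    "\<And>n. (\<lambda>x. (l2norm \<tau> (proc (L n) x - Y x))\<^sup>2) integrable_on {0..t}"
    "(\<lambda>n. integral {0..t} (\<lambda>x. (l2norm \<tau> (proc (L n) x - Y x))\<^sup>2)) \<longlonglongrightarrow> 0"
    "(\<lambda>n. l2norm \<tau> (sint (L n) - I)) \<longlonglongrightarrow> 0"
proof -
  obtain m p a where p: "\<And>n. p n 0 = 0" "\<And>n. p n (m n) = t"
      "\<And>n k. k < m n \<Longrightarrow> p n k \<le> p n (Suc k)" "\<And>n k. k < m n \<Longrightarrow> a n k \<in> \<F> (p n k)"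
    and int: "\<And>n. (\<lambda>s. (l2norm \<tau> (simple_process (m n) (p n) (a n) s - Y s))\<^sup>2) integrable_on {0..t}"
    and lim: "(\<lambda>n. integral {0..t} (\<lambda>s. (l2norm \<tau> (simple_process (m n) (p n) (a n) s - Y s))\<^sup>2)) \<longlonglongrightarrow> 0"
      "(\<lambda>n. l2norm \<tau> ((\<Sum>k < m n. a n k * (X (p n (Suc k)) - X (p n k))) - I)) \<longlonglongrightarrow> 0"
    using assms unfolding has_free_ito_integral_def by blast
  have mono: "p n i \<le> p n j" if "i \<le> j" "j \<le> m n" for n i j
    using that
  proof (induction j rule: dec_induct)
    case (step k)
    then show ?case using p(3)[of k n] by simp
  qed simp
  define L where "L n = map (\<lambda>k. (p n k, p n (Suc k), a n k)) [0..<m n]" for n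
  have 1: "proc (L n) = simple_process (m n) (p n) (a n)" for n
    by (simp add: fun_eq_iff L_def proc_def simple_process_def o_def interv_sum_list_conv_sum_set_nat
        atLeast0LessThan)
  have 2: "sint (L n) = (\<Sum>k < m n. a n k * (X (p n (Suc k)) - X (p n k)))" for n
    by (simp add: L_def sint_def o_def interv_sum_list_conv_sum_set_nat atLeast0LessThan)
  show thesis
  proof (rule that[of L])
    show "adapted (L n)" for n
      using mono[of 0 _ n] p by (auto simp: adapted_def L_def)
    show "\<forall>(u, v, a)\<in>set (L n). v \<le> t" for n
      using mono[of _ "m n" n] p by (auto simp: L_def)
  qed (use int lim 1 2 in simp_all)
qed

text \<open>\<open>I - J\<close> is the integral of \<open>Y\<close> over [s, t], but
  \<open>I\<close> and \<open>J\<close> come with unrelated approximations. The isometry shows that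
  the approximations of \<open>I\<close>, restricted to times from \<open>s\<close> on, converge to
  \<open>I - J\<close>. These use only increments after \<open>s\<close>, which gives the martingale
  property; comparing them with the constant integrand \<open>Y s\<close> gives the L2
  estimate.\<close>

lemma ito_increment:
  assumes st: "0 \<le> s" "s < t"
    and I: "has_free_ito_integral M \<tau> \<F> X Y t I" and J: "has_free_ito_integral M \<tau> \<F> X Y s J"
    and Y: "\<And>x. 0 \<le> x \<Longrightarrow> Y x \<in> \<F> x"
  shows "b \<in> \<F> s \<Longrightarrow> \<tau> (b * (I - J)) = 0"
    and "(\<And>x. s \<le> x \<Longrightarrow> x \<le> t \<Longrightarrow> norm (Y x - Y s) \<le> e) \<Longrightarrow>
      l2norm \<tau> (I - J - Y s * (X t - X s)) \<le> sqrt (2 * e\<^sup>2 * (t - s))"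
proof -
  have IJ: "I \<in> M" "J \<in> M" "I - J \<in> M" using I J by (auto simp: has_free_ito_integral_def)
  have YM: "Y x \<in> M" if "0 \<le> x" for x using Y[OF that] F_M that by auto
  obtain L where L: "\<And>n. adapted (L n)" "\<And>n. \<forall>(u, v, a)\<in>set (L n). v \<le> t"
    "\<And>n. (\<lambda>x. (l2norm \<tau> (proc (L n) x - Y x))\<^sup>2) integrable_on {0..t}"
    "(\<lambda>n. integral {0..t} (\<lambda>x. (l2norm \<tau> (proc (L n) x - Y x))\<^sup>2)) \<longlonglongrightarrow> 0"
    "(\<lambda>n. l2norm \<tau> (sint (L n) - I)) \<longlonglongrightarrow> 0"
    using ito_integral_approx[OF I] by blast
  obtain K where K: "\<And>n. adapted (K n)" "\<And>n. \<forall>(u, v, a)\<in>set (K n). v \<le> s"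
    "\<And>n. (\<lambda>x. (l2norm \<tau> (proc (K n) x - Y x))\<^sup>2) integrable_on {0..s}"
    "(\<lambda>n. integral {0..s} (\<lambda>x. (l2norm \<tau> (proc (K n) x - Y x))\<^sup>2)) \<longlonglongrightarrow> 0"
    "(\<lambda>n. l2norm \<tau> (sint (K n) - J)) \<longlonglongrightarrow> 0"
    using ito_integral_approx[OF J] by blast
  define R where "R n = from_time s (L n)" for n
  have R: "adapted (R n)" "\<forall>(u, v, a)\<in>set (R n). v \<le> t" for n
    using adapted_from_time[OF st(1) L(1)] L(2)[of n] st by (auto simp: R_def from_time_def)
  have Kt: "\<forall>(u, v, a)\<in>set (K n). v \<le> t" for n using K(2)[of n] st by fastforce
  note mems = IJ adapted_M[OF L(1)] adapted_M[OF K(1)] adapted_M[OF R(1)]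
  define T where "T n = sint (L n) - sint (K n)" for n
  have TM: "T n \<in> M" for n unfolding T_def using mems by (intro diff_mem)
  have IJT: "(\<lambda>n. l2norm \<tau> (I - J - T n)) \<longlonglongrightarrow> 0"
  proof (rule Lim_null_comparison)
    show "\<forall>\<^sub>F n in sequentially. norm (l2norm \<tau> (I - J - T n))
        \<le> l2norm \<tau> (sint (L n) - I) + l2norm \<tau> (sint (K n) - J)"
    proof (rule always_eventually, intro allI)
      fix n
      have "I - J - T n = - ((sint (L n) - I) - (sint (K n) - J))" by (simp add: T_def)
      then have "l2norm \<tau> (I - J - T n) = l2norm \<tau> ((sint (L n) - I) - (sint (K n) - J))"
        using mems by (metis l2_uminus diff_mem)
      also have "\<dots> \<le> l2norm \<tau> (sint (L n) - I) + l2norm \<tau> (sint (K n) - J)"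
        using mems by (intro l2_triangle_diff diff_mem)
      finally show "norm (l2norm \<tau> (I - J - T n)) \<le> l2norm \<tau> (sint (L n) - I) + l2norm \<tau> (sint (K n) - J)"
        using l2_nonneg[of "I - J - T n"] mems(3) TM diff_mem by simp
    qed
    show "(\<lambda>n. l2norm \<tau> (sint (L n) - I) + l2norm \<tau> (sint (K n) - J)) \<longlonglongrightarrow> 0"
      using tendsto_add[OF L(5) K(5)] by simp
  qed
  \<comment> \<open>On [0, s) both simple processes approximate \<open>Y\<close>; their squared
    distance is at most twice the sum of the two squared errors.\<close>
  define c where "c n = 2 * integral {0..t} (\<lambda>x. (l2norm \<tau> (proc (L n) x - Y x))\<^sup>2)
      + 2 * integral {0..s} (\<lambda>x. (l2norm \<tau> (proc (K n) x - Y x))\<^sup>2)" for n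
  have c: "(\<lambda>n. c n) \<longlonglongrightarrow> 0"
    using tendsto_add[OF tendsto_mult_left[OF L(4), of 2] tendsto_mult_left[OF K(4), of 2]]
    by (simp add: c_def)
  have TR: "(l2norm \<tau> (T n - sint (R n)))\<^sup>2 \<le> c n" for n
  proof -
    \<comment> \<open>From \<open>s\<close> on, \<open>K n\<close> vanishes and \<open>R n\<close>
      cancels \<open>L n\<close>; before \<open>s\<close>, \<open>R n\<close> vanishes. Hence the
      process of \<open>N\<close> is that of \<open>L n\<close> minus that of \<open>K n\<close> on
      [0, s) and 0 afterwards.\<close>
    define N where "N = L n @ negate (K n) @ negate (R n)"
    have N: "adapted N" "\<forall>(u, v, a)\<in>set N. v \<le> t"
      using L(1,2)[of n] K(1)[of n] Kt[of n] R[of n]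
      by (simp_all add: N_def ball_Un)
    have sN: "sint N = T n - sint (R n)" by (simp add: N_def T_def)
    have i1: "((\<lambda>x. (l2norm \<tau> (proc N x))\<^sup>2) has_integral (l2norm \<tau> (T n - sint (R n)))\<^sup>2) {0..t}"
      using ito_isometry[OF N] by (simp add: sN)
    have "((\<lambda>x. if x \<in> {0..s} then (l2norm \<tau> (proc (K n) x - Y x))\<^sup>2 else 0) has_integral
        integral {0..s} (\<lambda>x. (l2norm \<tau> (proc (K n) x - Y x))\<^sup>2)) {0..t}"
      using K(3)[of n] st by (subst has_integral_restrict) (auto intro: integrable_integral)
    from has_integral_add[OF has_integral_mult_right[OF integrable_integral[OF L(3)], of 2 n]
        has_integral_mult_right[OF this, of 2]]
    have i2: "((\<lambda>x. 2 * (l2norm \<tau> (proc (L n) x - Y x))\<^sup>2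
        + 2 * (if x \<in> {0..s} then (l2norm \<tau> (proc (K n) x - Y x))\<^sup>2 else 0)) has_integral c n) {0..t}"
      by (simp add: c_def)
    show ?thesis
    proof (rule has_integral_le[OF i1 i2])
      fix x assume x: "x \<in> {0..t}"
      show "(l2norm \<tau> (proc N x))\<^sup>2 \<le> 2 * (l2norm \<tau> (proc (L n) x - Y x))\<^sup>2
        + 2 * (if x \<in> {0..s} then (l2norm \<tau> (proc (K n) x - Y x))\<^sup>2 else 0)"
      proof (cases "s \<le> x")
        case True
        then have "proc N x = 0" using proc_eq_0[OF K(2)[of n]]
          by (simp add: N_def R_def proc_from_time)
        then show ?thesis by simp
      next
        case False
        then have "proc N x = (proc (L n) x - Y x) + - (proc (K n) x - Y x)"
          by (simp add: N_def R_def proc_from_time)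
        then have "(l2norm \<tau> (proc N x))\<^sup>2
            \<le> 2 * (l2norm \<tau> (proc (L n) x - Y x))\<^sup>2 + 2 * (l2norm \<tau> (- (proc (K n) x - Y x)))\<^sup>2"
          using mems YM[of x] x by (metis l2_add_sq_le atLeastAtMost_iff diff_mem uminus_mem)
        moreover have "l2norm \<tau> (- (proc (K n) x - Y x)) = l2norm \<tau> (proc (K n) x - Y x)"
          using mems YM[of x] x by (intro l2_uminus diff_mem) auto
        ultimately show ?thesis using x False by simp
      qed
    qed
  qed
  have IJR: "(\<lambda>n. l2norm \<tau> (I - J - sint (R n))) \<longlonglongrightarrow> 0"
  proof (rule Lim_null_comparison)
    show "\<forall>\<^sub>F n in sequentially. norm (l2norm \<tau> (I - J - sint (R n)))
        \<le> l2norm \<tau> (I - J - T n) + sqrt (c n)"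
    proof (rule always_eventually, intro allI)
      fix n
      have "l2norm \<tau> ((I - J - T n) + (T n - sint (R n)))
          \<le> l2norm \<tau> (I - J - T n) + l2norm \<tau> (T n - sint (R n))"
        using mems TM by (intro l2_triangle diff_mem)
      moreover have "l2norm \<tau> (T n - sint (R n)) \<le> sqrt (c n)"
        using TR[of n] by (simp add: real_le_rsqrt)
      moreover have "0 \<le> l2norm \<tau> (I - J - sint (R n))" using mems by (intro l2_nonneg diff_mem)
      ultimately show "norm (l2norm \<tau> (I - J - sint (R n))) \<le> l2norm \<tau> (I - J - T n) + sqrt (c n)"
        by simp
    qed
    show "(\<lambda>n. l2norm \<tau> (I - J - T n) + sqrt (c n)) \<longlonglongrightarrow> 0"
      using tendsto_add[OF IJT tendsto_real_sqrt[OF c]] by simp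
  qed
  {
    assume b: "b \<in> \<F> s"
    have bM: "b \<in> M" using F_M b st by auto
    \<comment> \<open>Every increment of the restricted process starts at \<open>s\<close> or later,
      when \<open>b\<close> and the coefficient are both in the past.\<close>
    have 0: "\<tau> (b * sint (from_time s N)) = 0" if "adapted N" for N
      using that
    proof (induction N)
      case (Cons l N)
      obtain u v a where l: "l = (u, v, a)" by (cases l) auto
      have u: "0 \<le> max u s" "max u s \<le> max v s" using Cons.prems st by (auto simp: l)
      interpret F: vn_algebra "\<F> (max u s)" by (rule F_vn) fact
      have "a \<in> \<F> (max u s)" "b \<in> \<F> (max u s)"
        using Cons.prems b F_mono[of u "max u s" a] F_mono[of s "max u s" b] st by (auto simp: l)
      then have ba: "b * a \<in> \<F> (max u s)" by blast
      then have "\<tau> (b * a * (X (max v s) - X (max u s))) = 0"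
        by (rule increment_martingale[OF u])
      moreover have "b * a \<in> M" "X (max v s) - X (max u s) \<in> M" "b * sint (from_time s N) \<in> M"
        using F_M[OF u(1) ba] increment_M[OF u] Cons.prems bM adapted_M(2)[OF adapted_from_time[OF st(1)]]
        by (auto simp: l)
      ultimately show ?case
        using Cons by (simp add: l from_time_def distrib_left mult.assoc[symmetric] tr_add mult_mem)
    qed (simp add: from_time_def)
    have "(\<lambda>n. cmod (\<tau> (b * (I - J)))) \<longlonglongrightarrow> 0"
    proof (rule Lim_null_comparison)
      show "\<forall>\<^sub>F n in sequentially. norm (cmod (\<tau> (b * (I - J)))) \<le> l2norm \<tau> b * l2norm \<tau> (I - J - sint (R n))"
      proof (rule always_eventually, intro allI)
        fix n
        have "b * (I - J) = b * (I - J - sint (R n)) + b * sint (R n)" by (simp add: algebra_simps)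
        moreover have "b * (I - J - sint (R n)) \<in> M" "b * sint (R n) \<in> M" "I - J - sint (R n) \<in> M"
          using bM mems by (metis mult_mem diff_mem)+
        ultimately have "\<tau> (b * (I - J)) = \<tau> (b * (I - J - sint (R n)))"
          using 0[OF L(1)[of n]] by (simp add: tr_add R_def)
        then show "norm (cmod (\<tau> (b * (I - J)))) \<le> l2norm \<tau> b * l2norm \<tau> (I - J - sint (R n))"
          using tr_mult_le_l2[OF bM \<open>I - J - sint (R n) \<in> M\<close>] by simp
      qed
      show "(\<lambda>n. l2norm \<tau> b * l2norm \<tau> (I - J - sint (R n))) \<longlonglongrightarrow> 0"
        using tendsto_mult_left[OF IJR, of "l2norm \<tau> b"] by simp
    qed
    then show "\<tau> (b * (I - J)) = 0" by (simp add: LIMSEQ_const_iff)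
  }
  {
    assume e: "\<And>x. s \<le> x \<Longrightarrow> x \<le> t \<Longrightarrow> norm (Y x - Y s) \<le> e"
    define d where "d n = 2 * integral {0..t} (\<lambda>x. (l2norm \<tau> (proc (L n) x - Y x))\<^sup>2) + 2 * e\<^sup>2 * (t - s)" for n
    have YX: "Y s * (X t - X s) \<in> M" using YM st increment_M by auto
    have RY: "(l2norm \<tau> (sint (R n) - Y s * (X t - X s)))\<^sup>2 \<le> d n" for n
    proof -
      \<comment> \<open>On [s, t) this is \<open>L n\<close> minus \<open>Y s\<close>, that is, the
        approximation error plus \<open>Y x - Y s\<close>, whose L2 norm is at most
        \<open>e\<close>; elsewhere on [0, t] it is 0.\<close>
      define N where "N = R n @ negate [(s, t, Y s)]"
      have N: "adapted N" "\<forall>(u, v, a)\<in>set N. v \<le> t"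
        using R[of n] st Y[of s] by (simp_all add: N_def ball_Un)
      have sN: "sint N = sint (R n) - Y s * (X t - X s)" by (simp add: N_def)
      have i1: "((\<lambda>x. (l2norm \<tau> (proc N x))\<^sup>2) has_integral (l2norm \<tau> (sint (R n) - Y s * (X t - X s)))\<^sup>2) {0..t}"
        using ito_isometry[OF N] by (simp add: sN)
      have "((\<lambda>x. indicat_real {s..<t} x) has_integral (t - s)) {0..t}"
        using has_integral_indicator_atLeastLessThan[of s t t] st by simp
      from has_integral_add[OF has_integral_mult_right[OF integrable_integral[OF L(3)], of 2 n]
          has_integral_mult_right[OF this, of "2 * e\<^sup>2"]]
      have i2: "((\<lambda>x. 2 * (l2norm \<tau> (proc (L n) x - Y x))\<^sup>2 + 2 * e\<^sup>2 * indicat_real {s..<t} x)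
          has_integral d n) {0..t}"
        by (simp add: d_def)
      show ?thesis
      proof (rule has_integral_le[OF i1 i2])
        fix x assume x: "x \<in> {0..t}"
        show "(l2norm \<tau> (proc N x))\<^sup>2 \<le> 2 * (l2norm \<tau> (proc (L n) x - Y x))\<^sup>2 + 2 * e\<^sup>2 * indicat_real {s..<t} x"
        proof (cases "s \<le> x \<and> x < t")
          case False
          then have "proc N x = 0" using proc_eq_0[OF L(2)[of n]] x
            by (auto simp: N_def R_def proc_from_time)
          then show ?thesis by simp
        next
          case True
          then have "proc N x = (proc (L n) x - Y x) + (Y x - Y s)"
            by (simp add: N_def R_def proc_from_time)
          moreover have YY: "proc (L n) x - Y x \<in> M" "Y x - Y s \<in> M"
            using mems YM[of x] YM[of s] x st by auto
          ultimately have "(l2norm \<tau> (proc N x))\<^sup>2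
              \<le> 2 * (l2norm \<tau> (proc (L n) x - Y x))\<^sup>2 + 2 * (l2norm \<tau> (Y x - Y s))\<^sup>2"
            using l2_add_sq_le by metis
          moreover have "l2norm \<tau> (Y x - Y s) \<le> e"
            using l2_le_norm[OF YY(2)] e[of x] True by simp
          then have "(l2norm \<tau> (Y x - Y s))\<^sup>2 \<le> e\<^sup>2" using YY by (intro power_mono) auto
          ultimately show ?thesis using True by simp
        qed
      qed
    qed
    have d: "(\<lambda>n. d n) \<longlonglongrightarrow> 2 * e\<^sup>2 * (t - s)"
      unfolding d_def using tendsto_add[OF tendsto_mult_left[OF L(4), of 2] tendsto_const[of "2 * e\<^sup>2 * (t - s)"]]
      by simp
    have "(\<lambda>n. l2norm \<tau> (I - J - sint (R n)) + sqrt (d n)) \<longlonglongrightarrow> sqrt (2 * e\<^sup>2 * (t - s))"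
      using tendsto_add[OF IJR tendsto_real_sqrt[OF d]] by simp
    then show "l2norm \<tau> (I - J - Y s * (X t - X s)) \<le> sqrt (2 * e\<^sup>2 * (t - s))"
    proof (rule LIMSEQ_le_const, intro exI allI impI)
      fix n
      have "l2norm \<tau> ((I - J - sint (R n)) + (sint (R n) - Y s * (X t - X s)))
          \<le> l2norm \<tau> (I - J - sint (R n)) + l2norm \<tau> (sint (R n) - Y s * (X t - X s))"
        using mems YX by (intro l2_triangle diff_mem)
      moreover have "l2norm \<tau> (sint (R n) - Y s * (X t - X s)) \<le> sqrt (d n)"
        using RY[of n] by (simp add: real_le_rsqrt)
      ultimately show "l2norm \<tau> (I - J - Y s * (X t - X s)) \<le> l2norm \<tau> (I - J - sint (R n)) + sqrt (d n)"
        by simp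
    qed
  }
qed

end

section \<open>Moments of the free unitary Brownian motion\<close>

text \<open>The powers of \<open>b\<close> stand on the left and those of \<open>a\<close> on the
  right, so the right-hand power can be telescoped once more to reach second order.\<close>

lemma power_diff_telescope:
  fixes a b :: "'h::complex_hilbert_space bop"
  shows "a ^ n - b ^ n = (\<Sum>k<n. b ^ k * (a - b) * a ^ (n - 1 - k))"
proof (induction n)
  case (Suc n)
  have "(\<Sum>k<Suc n. b ^ k * (a - b) * a ^ (Suc n - 1 - k))
      = (a - b) * a ^ n + (\<Sum>k<n. b * (b ^ k * (a - b) * a ^ (n - 1 - k)))"
    unfolding sum.lessThan_Suc_shift by (simp add: mult.assoc)
  also have "\<dots> = (a - b) * a ^ n + b * (a ^ n - b ^ n)"
    unfolding Suc.IH by (simp add: sum_distrib_left)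
  also have "\<dots> = a ^ Suc n - b ^ Suc n" by (simp add: algebra_simps)
  finally show ?case by simp
qed simp

lemma norm_power_diff_bop:
  fixes a b :: "'h::complex_hilbert_space bop"
  assumes "norm a \<le> 1" "norm b \<le> 1"
  shows "norm (a ^ n - b ^ n) \<le> of_nat n * norm (a - b)"
proof -
  have "norm (b ^ k * (a - b) * a ^ j) \<le> norm (a - b)" for k j
  proof -
    have p: "norm (a ^ j) \<le> 1" "norm (b ^ k) \<le> 1"
      using norm_power_bop[of a j] norm_power_bop[of b k] assms
      by (meson norm_ge_zero order_trans power_le_one)+
    have "norm (b ^ k * (a - b) * a ^ j) \<le> norm (b ^ k) * norm (a - b) * norm (a ^ j)"
      by (meson norm_mult_ineq mult_right_mono norm_ge_zero order_trans)
    also have "\<dots> \<le> 1 * norm (a - b) * 1"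
      using p by (intro mult_mono) auto
    finally show ?thesis by simp
  qed
  then have "norm (\<Sum>k<n. b ^ k * (a - b) * a ^ (n - 1 - k)) \<le> of_nat (card {..<n}) * norm (a - b)"
    by (intro sum_norm_bound) auto
  then show ?thesis by (simp add: power_diff_telescope)
qed

text \<open>The second order contributions depend only on the gap \<open>j\<close> between the two
  increments, by cyclicity of the trace; this counts the positions for each gap.\<close>

lemma sum_triangle_swap:
  fixes f :: "nat \<Rightarrow> complex"
  shows "(\<Sum>k<n. \<Sum>j<n - 1 - k. f j) = (\<Sum>j<n. of_nat (n - 1 - j) * f j)"
proof -
  have "(\<Sum>k<n. \<Sum>j<n - 1 - k. f j) = (\<Sum>k<n. \<Sum>j<k. f j)"
    using sum.nat_diff_reindex[of "\<lambda>k. \<Sum>j<k. f j" n] by simp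
  also have "\<dots> = (\<Sum>j<n. of_nat (n - 1 - j) * f j)"
  proof (induction n)
    case (Suc n)
    have "(\<Sum>j<n. of_nat (n - j) * f j) = (\<Sum>j<n. of_nat (n - 1 - j) * f j + f j)"
      by (intro sum.cong refl) (auto simp: of_nat_diff algebra_simps)
    then show ?case by (simp add: Suc.IH sum.distrib)
  qed simp
  finally show ?thesis .
qed

context tracial
begin

text \<open>Cauchy-Schwarz for the two factors \<open>x\<close> and \<open>y\<close>, with operator
  norms for the rest. The norm of \<open>c\<close> is kept because \<open>c\<close> will also be the
  small difference of two powers.\<close>

lemma tr_two_factor_bound:
  assumes "a \<in> M" "b \<in> M" "c \<in> M" "x \<in> M" "y \<in> M" "norm a \<le> 1" "norm b \<le> 1"
  shows "cmod (\<tau> (a * x * b * y * c)) \<le> norm c * (l2norm \<tau> x * l2norm \<tau> y)"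
proof -
  have "l2norm \<tau> (a * x * b) \<le> norm b * l2norm \<tau> (a * x)" using assms by (intro l2_mult_right) auto
  also have "\<dots> \<le> 1 * (norm a * l2norm \<tau> x)"
    using assms by (intro mult_mono l2_mult_left l2_nonneg mult_mem) auto
  also have "\<dots> \<le> 1 * (1 * l2norm \<tau> x)"
    using assms by (intro mult_mono) auto
  finally have 1: "l2norm \<tau> (a * x * b) \<le> l2norm \<tau> x" by simp
  have 2: "l2norm \<tau> (y * c) \<le> norm c * l2norm \<tau> y" using assms by (intro l2_mult_right) auto
  have "cmod (\<tau> ((a * x * b) * (y * c))) \<le> l2norm \<tau> (a * x * b) * l2norm \<tau> (y * c)"
    using assms by (intro tr_mult_le_l2) auto
  also have "\<dots> \<le> l2norm \<tau> x * (norm c * l2norm \<tau> y)"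
    using assms 1 2 by (intro mult_mono l2_nonneg mult_mem) auto
  finally show ?thesis by (simp add: mult_ac)
qed

end

section \<open>Second order expansion of the moments\<close>

locale free_ubm = free_bm M \<tau> \<F> X
  for M :: "'h::complex_hilbert_space bop set" and \<tau> \<F> X +
  fixes Y :: "real \<Rightarrow> 'h bop"
  assumes Y_cont: "continuous_on {0..} Y"
    and Y_F: "0 \<le> t \<Longrightarrow> Y t \<in> \<F> t"
    and Y_unitary: "0 \<le> t \<Longrightarrow> star (Y t) * Y t = 1"
    and Y_sde: "0 \<le> t \<Longrightarrow> \<exists>I. has_free_ito_integral M \<tau> \<F> X Y t I \<and>
             Y t = 1 + \<i> \<cdot>\<^sub>C I - (1/2) *\<^sub>R integral {0..t} Y"
begin

lemma Y_M: "0 \<le> t \<Longrightarrow> Y t \<in> M"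
  using Y_F F_M by auto

lemma norm_Y: "0 \<le> t \<Longrightarrow> norm (Y t) \<le> 1"
  using Y_unitary norm_unitary by auto

lemma norm_Y_power: "0 \<le> t \<Longrightarrow> norm (Y t ^ n) \<le> 1"
  using norm_power_bop[of "Y t" n] norm_Y[of t] by (meson norm_ge_zero order_trans power_le_one)

text \<open>Here \<open>e\<close> measures the oscillation of \<open>Y\<close> on [s, t]. In the
  first bound the martingale property removes the stochastic integral, so the error is of order
  \<open>e * (t - s)\<close> and not merely sqrt(t - s). Unitarity of \<open>Y s\<close> cancels in
  the norm of \<open>G\<close>. The constant 3 is 2 (above sqrt 2) for the integral plus 1 for the
  drift, and 4 is 3 + 1.\<close>

lemma increment_expansion:
  assumes st: "0 \<le> s" "s < t" and e: "0 < e" "e \<le> 1" "t - s \<le> e\<^sup>2"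
    and Ye: "\<And>x. s \<le> x \<Longrightarrow> x \<le> t \<Longrightarrow> norm (Y x - Y s) \<le> e"
  defines "D \<equiv> Y t - Y s" and "G \<equiv> Y s * (X t - X s)"
  shows "cmod (\<tau> (Y s ^ k * D) + of_real (t - s) / 2 * \<tau> (Y s ^ Suc k)) \<le> e * (t - s)"
    and "l2norm \<tau> G \<le> sqrt (t - s)"
    and "l2norm \<tau> (D - \<i> \<cdot>\<^sub>C G) \<le> 3 * e * sqrt (t - s)"
    and "l2norm \<tau> D \<le> 4 * sqrt (t - s)"
proof -
  define h where "h = t - s"
  have h: "0 < h" "h \<le> e\<^sup>2" using st e by (auto simp: h_def)
  have YM: "Y s \<in> M" "Y t \<in> M" and XM: "X t - X s \<in> M" using Y_M increment_M st by auto
  have GM: "G \<in> M" and DM: "D \<in> M" using YM XM by (auto simp: G_def D_def)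
  obtain I where I: "has_free_ito_integral M \<tau> \<F> X Y t I" "Y t = 1 + \<i> \<cdot>\<^sub>C I - (1/2) *\<^sub>R integral {0..t} Y"
    using Y_sde[of t] st by auto
  obtain J where J: "has_free_ito_integral M \<tau> \<F> X Y s J" "Y s = 1 + \<i> \<cdot>\<^sub>C J - (1/2) *\<^sub>R integral {0..s} Y"
    using Y_sde[of s] st by auto
  have IJ: "I - J \<in> M" using I J by (auto simp: has_free_ito_integral_def)
  define V where "V = integral {s..t} Y"
  have ct: "continuous_on {a..b} Y" if "0 \<le> a" for a b
    by (rule continuous_on_subset[OF Y_cont]) (use that in auto)
  have Vs: "integral {0..t} Y = integral {0..s} Y + V"
    unfolding V_def using st ct[of 0 t]
    by (intro Henstock_Kurzweil_Integration.integral_combine[symmetric] integrable_continuous_interval) auto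
  then have D: "D = \<i> \<cdot>\<^sub>C (I - J) - (1/2) *\<^sub>R V"
    unfolding D_def I(2) J(2) Vs by (simp add: scaleC_bop_simps scaleR_add_right)
  then have "V = 2 *\<^sub>R (\<i> \<cdot>\<^sub>C (I - J) - D)" by simp
  then have VM: "V \<in> M" using IJ DM by (metis scaleR_mem diff_mem scaleC_mem)
  have "V - h *\<^sub>R Y s = integral {s..t} (\<lambda>x. Y x - Y s)"
    unfolding V_def h_def using st ct[of s t]
    by (subst Henstock_Kurzweil_Integration.integral_diff) (auto intro: integrable_continuous_interval)
  also have "norm \<dots> \<le> e * (t - s)"
    using st ct[of s t] Ye by (intro integral_bound continuous_intros) auto
  finally have Vh: "norm (V - h *\<^sub>R Y s) \<le> e * h" by (simp add: h_def)
  have Vn: "norm V \<le> 2 * h"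
  proof -
    have "norm V \<le> norm (V - h *\<^sub>R Y s) + norm (h *\<^sub>R Y s)" using norm_triangle_ineq[of "V - h *\<^sub>R Y s" "h *\<^sub>R Y s"] by simp
    also have "\<dots> \<le> e * h + h * 1" using Vh h norm_Y[of s] st by (intro add_mono) auto
    also have "\<dots> \<le> 2 * h" using e h by simp
    finally show ?thesis .
  qed
  show "cmod (\<tau> (Y s ^ k * D) + of_real (t - s) / 2 * \<tau> (Y s ^ Suc k)) \<le> e * (t - s)"
  proof -
    interpret F: vn_algebra "\<F> s" by (rule F_vn) fact
    have "Y s ^ k \<in> \<F> s" using Y_F st by auto
    then have "\<tau> (Y s ^ k * (I - J)) = 0" by (intro ito_increment(1)[OF st I(1) J(1)] Y_F)
    then have "\<tau> (Y s ^ k * D) = - (1/2) * \<tau> (Y s ^ k * V)"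
    proof -
      have "Y s ^ k * D = \<i> \<cdot>\<^sub>C (Y s ^ k * (I - J)) - (1/2) *\<^sub>R (Y s ^ k * V)"
        unfolding D by (simp add: right_diff_distrib)
      moreover have "Y s ^ k * (I - J) \<in> M" "Y s ^ k * V \<in> M"
        using YM IJ VM by (auto intro!: mult_mem power_mem)
      ultimately show ?thesis
        using \<open>\<tau> (Y s ^ k * (I - J)) = 0\<close> by (simp add: tr_diff tr_scaleC tr_scaleR scaleC_mem scaleR_mem)
    qed
    have "\<tau> (Y s ^ k * V) = \<tau> (Y s ^ k * (V - h *\<^sub>R Y s)) + of_real h * \<tau> (Y s ^ Suc k)"
    proof -
      have "Y s ^ k * V = Y s ^ k * (V - h *\<^sub>R Y s) + h *\<^sub>R Y s ^ Suc k"
        by (simp add: right_diff_distrib power_commutes)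
      moreover have "Y s ^ k * (V - h *\<^sub>R Y s) \<in> M" "Y s ^ Suc k \<in> M"
        using YM VM by (auto intro!: mult_mem power_mem diff_mem scaleR_mem)
      ultimately show ?thesis by (simp add: tr_add tr_scaleR scaleR_mem del: power_Suc)
    qed
    have "\<tau> (Y s ^ k * D) + of_real (t - s) / 2 * \<tau> (Y s ^ Suc k)
        = - (1/2) * \<tau> (Y s ^ k * (V - h *\<^sub>R Y s))"
    proof -
      have "x = - (1/2) * v \<Longrightarrow> v = q + c * m \<Longrightarrow> x + c / 2 * m = - (1/2) * q" for x v q c m :: complex
        by (simp add: field_simps)
      from this[OF \<open>\<tau> (Y s ^ k * D) = _\<close> \<open>\<tau> (Y s ^ k * V) = _\<close>] show ?thesis by (simp only: h_def)
    qed
    also have "cmod \<dots> \<le> 1/2 * (norm (Y s ^ k) * norm (V - h *\<^sub>R Y s))"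
      using tr_le_norm[of "Y s ^ k * (V - h *\<^sub>R Y s)"] YM VM norm_mult_ineq[of "Y s ^ k" "V - h *\<^sub>R Y s"]
      by (auto simp: norm_mult intro: order_trans)
    also have "\<dots> \<le> 1/2 * (1 * (e * h))"
      using Vh norm_Y_power[of s k] st h e by (intro mult_mono) auto
    also have "\<dots> \<le> e * (t - s)" using e h by (simp add: h_def)
    finally show ?thesis .
  qed
  show G: "l2norm \<tau> G \<le> sqrt (t - s)"
  proof -
    have "star G * G = (X t - X s) * (star (Y s) * Y s) * (X t - X s)"
      using st by (simp add: G_def mult.assoc)
    also have "\<dots> = (X t - X s) * (X t - X s)" using Y_unitary[of s] st by simp
    finally have "\<tau> (star G * G) = of_real (t - s)" using increment_moments(2)[OF st] by simp
    then show ?thesis by (simp add: l2norm_def)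
  qed
  show E: "l2norm \<tau> (D - \<i> \<cdot>\<^sub>C G) \<le> 3 * e * sqrt (t - s)"
  proof -
    have JG: "I - J - G \<in> M" using IJ GM by auto
    have "D - \<i> \<cdot>\<^sub>C G = \<i> \<cdot>\<^sub>C (I - J - G) - (1/2) *\<^sub>R V"
      unfolding D by (simp add: scaleC_bop_simps)
    then have "l2norm \<tau> (D - \<i> \<cdot>\<^sub>C G) \<le> l2norm \<tau> (\<i> \<cdot>\<^sub>C (I - J - G)) + l2norm \<tau> ((1/2) *\<^sub>R V)"
      using l2_triangle_diff[of "\<i> \<cdot>\<^sub>C (I - J - G)" "(1/2) *\<^sub>R V"] JG VM by auto
    also have "\<dots> = l2norm \<tau> (I - J - G) + l2norm \<tau> V / 2"
      using JG VM by (simp add: l2_scaleC l2_scaleR)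
    also have "l2norm \<tau> (I - J - G) \<le> sqrt (2 * e\<^sup>2 * (t - s))"
      unfolding G_def by (rule ito_increment(2)[OF st I(1) J(1) Y_F Ye])
    also have "sqrt (2 * e\<^sup>2 * (t - s)) = sqrt 2 * e * sqrt (t - s)"
      using e by (simp add: real_sqrt_mult)
    also have "\<dots> \<le> 2 * e * sqrt (t - s)"
      using e h sqrt2_less_2 by (intro mult_right_mono) (auto simp: h_def)
    \<comment> \<open>The condition \<open>t - s \<le> e\<^sup>2\<close> serves this step: it
      absorbs the drift, of order h, into \<open>e\<close> times sqrt h.\<close>
    also have "l2norm \<tau> V / 2 \<le> e * sqrt (t - s)"
    proof -
      have "h = sqrt h * sqrt h" using h by simp
      also have "\<dots> \<le> e * sqrt h"
        using h e by (intro mult_right_mono) (auto intro: real_le_lsqrt)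
      finally have "h \<le> e * sqrt h" .
      then show ?thesis using Vn l2_le_norm[OF VM] by (simp add: h_def)
    qed
    finally show ?thesis by simp
  qed
  show "l2norm \<tau> D \<le> 4 * sqrt (t - s)"
  proof -
    have "l2norm \<tau> ((D - \<i> \<cdot>\<^sub>C G) + \<i> \<cdot>\<^sub>C G) \<le> l2norm \<tau> (D - \<i> \<cdot>\<^sub>C G) + l2norm \<tau> (\<i> \<cdot>\<^sub>C G)"
      using DM GM by (intro l2_triangle) auto
    also have "\<dots> \<le> 3 * e * sqrt (t - s) + 1 * sqrt (t - s)"
      using E G GM by (simp add: l2_scaleC)
    also have "\<dots> \<le> 3 * 1 * sqrt (t - s) + 1 * sqrt (t - s)"
      using e h by (intro add_mono mult_right_mono mult_left_mono) (auto simp: h_def)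
    finally show ?thesis by simp
  qed
qed

text \<open>Three replacements lead to a word to which \<open>increment_free_two\<close> applies:
  \<open>Y t ^ l\<close> by \<open>Y s ^ l\<close>, at the price of an operator norm of at most
  \<open>l * e\<close>, and then each \<open>D\<close> by i times \<open>G\<close>. The errors are 4
  * 4 * l, 4 * 3 and 3 * 1 times \<open>e * (t - s)\<close>, hence 16 l + 15. The plus sign in the
  claim reflects i * i = -1.\<close>

lemma second_order_term:
  assumes st: "0 \<le> s" "s < t" and e: "0 < e" "e \<le> 1" "t - s \<le> e\<^sup>2"
    and Ye: "\<And>x. s \<le> x \<Longrightarrow> x \<le> t \<Longrightarrow> norm (Y x - Y s) \<le> e"
  shows "cmod (\<tau> (Y s ^ k * (Y t - Y s) * Y s ^ j * (Y t - Y s) * Y t ^ l)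
      + of_real (t - s) * (\<tau> (Y s ^ (k + l + 1)) * \<tau> (Y s ^ (j + 1)))) \<le> (16 * real l + 15) * e * (t - s)"
proof -
  define D where "D = Y t - Y s"
  define G where "G = Y s * (X t - X s)"
  define E where "E = D - \<i> \<cdot>\<^sub>C G"
  define a where "a = Y s ^ k"
  define b where "b = Y s ^ j"
  define c where "c = Y s ^ l"
  note ex = increment_expansion[OF st e Ye, folded D_def G_def, folded E_def]
  have h: "0 < t - s" using st by simp
  have YM: "Y s \<in> M" "Y t \<in> M" and XM: "X t - X s \<in> M" using Y_M increment_M st by auto
  have mem: "a \<in> M" "b \<in> M" "c \<in> M" "D \<in> M" "G \<in> M" "E \<in> M" "Y t ^ l - c \<in> M"
    using YM XM by (auto simp: a_def b_def c_def D_def G_def E_def)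
  have nrm: "norm a \<le> 1" "norm b \<le> 1" "norm c \<le> 1"
    using norm_Y_power[OF st(1)] by (auto simp: a_def b_def c_def)
  have nn: "0 \<le> l2norm \<tau> D" "0 \<le> l2norm \<tau> E" "0 \<le> l2norm \<tau> G" using mem by auto
  have "norm (Y t ^ l - c) \<le> real l * norm (Y t - Y s)"
    unfolding c_def using norm_Y st by (intro norm_power_diff_bop) auto
  also have "\<dots> \<le> real l * e" using Ye[of t] st by (intro mult_left_mono) auto
  finally have nc: "norm (Y t ^ l - c) \<le> real l * e" .
  have "cmod (\<tau> (a * D * b * D * (Y t ^ l - c))) \<le> norm (Y t ^ l - c) * (l2norm \<tau> D * l2norm \<tau> D)"
    using mem nrm by (intro tr_two_factor_bound) auto
  also have "\<dots> \<le> (real l * e) * ((4 * sqrt (t - s)) * (4 * sqrt (t - s)))"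
    using nc ex(4) nn e h by (intro mult_mono) auto
  also have "\<dots> = 16 * real l * e * (t - s)" using h by simp
  finally have 1: "cmod (\<tau> (a * D * b * D * (Y t ^ l - c))) \<le> 16 * real l * e * (t - s)" .
  have "cmod (\<tau> (a * D * b * E * c)) \<le> norm c * (l2norm \<tau> D * l2norm \<tau> E)"
    using mem nrm by (intro tr_two_factor_bound) auto
  also have "\<dots> \<le> 1 * ((4 * sqrt (t - s)) * (3 * e * sqrt (t - s)))"
    using nrm ex(3,4) nn e h by (intro mult_mono) auto
  also have "\<dots> = 12 * e * (sqrt (t - s) * sqrt (t - s))" by (simp only: mult_ac)
  finally have 2: "cmod (\<tau> (a * D * b * E * c)) \<le> 12 * e * (t - s)" using h by simp
  have "cmod (\<tau> (a * E * b * G * c)) \<le> norm c * (l2norm \<tau> E * l2norm \<tau> G)"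
    using mem nrm by (intro tr_two_factor_bound) auto
  also have "\<dots> \<le> 1 * ((3 * e * sqrt (t - s)) * sqrt (t - s))"
    using nrm ex(2,3) nn e h by (intro mult_mono) auto
  also have "\<dots> = 3 * e * (sqrt (t - s) * sqrt (t - s))" by (simp only: mult_ac)
  finally have 3: "cmod (\<tau> (a * E * b * G * c)) \<le> 3 * e * (t - s)" using h by simp
  have 4: "\<tau> (a * G * b * G * c) = of_real (t - s) * (\<tau> (Y s ^ (k + l + 1)) * \<tau> (Y s ^ (j + 1)))"
  proof -
    interpret F: vn_algebra "\<F> s" by (rule F_vn) fact
    have YF: "Y s \<in> \<F> s" using Y_F st by auto
    have "\<tau> (a * G * b * G * c) = \<tau> (c * (a * G * b * G))"
      using mem by (intro tr_commute) auto
    also have "c * (a * G * b * G) = Y s ^ (k + l + 1) * (X t - X s) * Y s ^ (j + 1) * (X t - X s)"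
    proof -
      have "Y s ^ (k + l + 1) = c * a * Y s"
        unfolding a_def c_def power_add[symmetric] power_Suc2[symmetric]
        by (simp add: add.commute del: power_Suc)
      moreover have "Y s ^ (j + 1) = b * Y s" by (simp add: b_def power_commutes)
      ultimately show ?thesis by (simp only: G_def mult.assoc)
    qed
    also have "\<tau> \<dots> = of_real (t - s) * (\<tau> (Y s ^ (k + l + 1)) * \<tau> (Y s ^ (j + 1)))"
      using YF st by (intro increment_free_two) auto
    finally show ?thesis .
  qed
  have DE: "D = E + \<i> \<cdot>\<^sub>C G" by (simp add: E_def)
  then have "a * D * b * D * c = a * D * b * E * c + \<i> \<cdot>\<^sub>C (a * D * b * G * c)"
    by (metis (no_types) distrib_left distrib_right mult_scaleC_bop)
  moreover have "a * D * b * G * c = a * E * b * G * c + \<i> \<cdot>\<^sub>C (a * G * b * G * c)"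
    using DE by (metis (no_types) distrib_left distrib_right mult_scaleC_bop)
  ultimately have "a * D * b * D * c = a * D * b * E * c + \<i> \<cdot>\<^sub>C (a * E * b * G * c) - a * G * b * G * c"
    by (simp add: scaleC_bop_simps scaleC_bop_minus_one[of 1, simplified])
  then have dec: "a * D * b * D * Y t ^ l = a * D * b * D * (Y t ^ l - c)
      + (a * D * b * E * c + \<i> \<cdot>\<^sub>C (a * E * b * G * c) - a * G * b * G * c)"
    by (simp add: right_diff_distrib)
  have "\<tau> (a * D * b * D * Y t ^ l) = \<tau> (a * D * b * D * (Y t ^ l - c))
      + (\<tau> (a * D * b * E * c) + \<i> * \<tau> (a * E * b * G * c) - \<tau> (a * G * b * G * c))"
    unfolding dec using mem by (simp add: tr_add tr_diff tr_scaleC mult_mem scaleC_mem add_mem diff_mem)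
  then have "\<tau> (a * D * b * D * Y t ^ l) + \<tau> (a * G * b * G * c) = \<tau> (a * D * b * D * (Y t ^ l - c))
      + (\<tau> (a * D * b * E * c) + \<i> * \<tau> (a * E * b * G * c))" by simp
  also have "cmod \<dots> \<le> 16 * real l * e * (t - s) + (12 * e * (t - s) + 3 * e * (t - s))"
    using 1 2 3 by (intro norm_triangle_mono) (auto simp: norm_mult)
  also have "\<dots> = (16 * real l + 15) * e * (t - s)" by (simp add: algebra_simps)
  finally show ?thesis using 4 unfolding D_def a_def b_def by (simp only:)
qed

text \<open>The future derivative of the n-th moment. The first term is the drift -Y/2 at each of
  the n positions. The double sum pairs the noise at positions k and k + 1 + j: together with the
  \<open>Y\<close> in front of each noise, j + 1 factors lie between the two, and the other n - 1 -
  j close up cyclically.\<close>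

definition drift :: "nat \<Rightarrow> real \<Rightarrow> complex" where
  "drift n t = - (of_nat n / 2) * \<tau> (Y t ^ n)
     - (\<Sum>k<n. \<Sum>j<n - 1 - k. \<tau> (Y t ^ (n - 1 - j)) * \<tau> (Y t ^ (j + 1)))"

text \<open>Two telescopings leave words with one increment and otherwise only \<open>Y s\<close>,
  and words with two increments followed by a power of \<open>Y t\<close>. That power absorbs all
  higher orders, so no third order terms have to be listed.\<close>

lemma moment_increment:
  assumes st: "0 \<le> s" "s < t" and e: "0 < e" "e \<le> 1" "t - s \<le> e\<^sup>2"
    and Ye: "\<And>x. s \<le> x \<Longrightarrow> x \<le> t \<Longrightarrow> norm (Y x - Y s) \<le> e"
  shows "cmod (\<tau> (Y t ^ n) - \<tau> (Y s ^ n) - of_real (t - s) * drift n s)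
    \<le> (real n * (1 + real n * (16 * real n + 15))) * e * (t - s)"
proof -
  define D where "D = Y t - Y s"
  define h where "h = t - s"
  have YM: "Y s \<in> M" "Y t \<in> M" "D \<in> M" using Y_M st by (auto simp: D_def)
  have h: "0 < h" using st by (simp add: h_def)
  define f where "f k j = \<tau> (Y s ^ k * D * Y s ^ j * D * Y t ^ (n - 2 - k - j))" for k j
  define g where "g j = \<tau> (Y s ^ (n - 1 - j)) * \<tau> (Y s ^ (j + 1))" for j
  define v where "v = \<tau> (Y s ^ (n - 1) * D)"
  have mem: "Y s ^ k * D * Y s ^ j * D * Y t ^ l \<in> M" "Y s ^ k * D * Y s ^ j \<in> M" for k j l
    using YM by (auto intro!: mult_mem power_mem)
  have "Y t ^ n - Y s ^ n = (\<Sum>k<n. Y s ^ k * D * Y s ^ (n - 1 - k)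
      + (\<Sum>j<n - 1 - k. Y s ^ k * D * Y s ^ j * D * Y t ^ (n - 2 - k - j)))"
  proof -
    have "Y s ^ k * D * Y t ^ (n - 1 - k) = Y s ^ k * D * Y s ^ (n - 1 - k)
      + (\<Sum>j<n - 1 - k. Y s ^ k * D * Y s ^ j * D * Y t ^ (n - 2 - k - j))" for k
    proof -
      have "Y t ^ (n - 1 - k) = Y s ^ (n - 1 - k) + (\<Sum>j<n - 1 - k. Y s ^ j * D * Y t ^ (n - 1 - k - 1 - j))"
        using power_diff_telescope[of "Y t" "n - 1 - k" "Y s"] by (simp add: D_def algebra_simps)
      also have "n - 1 - k - 1 = n - 2 - k" by simp
      finally show ?thesis by (simp add: distrib_left sum_distrib_left mult.assoc)
    qed
    then show ?thesis unfolding power_diff_telescope D_def[symmetric] by simp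
  qed
  moreover have "\<tau> (Y t ^ n) - \<tau> (Y s ^ n) = \<tau> (Y t ^ n - Y s ^ n)"
    using YM by (simp add: tr_diff power_mem)
  moreover have "\<tau> (Y s ^ k * D * Y s ^ (n - 1 - k)) = v" if "k < n" for k
  proof -
    have "\<tau> (Y s ^ k * D * Y s ^ (n - 1 - k)) = \<tau> (Y s ^ (n - 1 - k) * (Y s ^ k * D))"
      using YM by (intro tr_commute) auto
    also have "Y s ^ (n - 1 - k) * (Y s ^ k * D) = Y s ^ (n - 1) * D"
      using that by (simp add: mult.assoc[symmetric] flip: power_add)
    finally show ?thesis by (simp add: v_def)
  qed
  ultimately have 1: "\<tau> (Y t ^ n) - \<tau> (Y s ^ n) = of_nat n * v + (\<Sum>k<n. \<Sum>j<n - 1 - k. f k j)"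
    by (simp add: tr_sum tr_add mem sum_mem sum.distrib f_def)
  have 2: "of_real h * drift n s = - of_nat n * (of_real h / 2 * \<tau> (Y s ^ n))
      - (\<Sum>k<n. \<Sum>j<n - 1 - k. of_real h * g j)"
    by (simp add: drift_def g_def right_diff_distrib sum_distrib_left)
  have "\<tau> (Y t ^ n) - \<tau> (Y s ^ n) - of_real h * drift n s
      = of_nat n * (v + of_real h / 2 * \<tau> (Y s ^ n)) + (\<Sum>k<n. \<Sum>j<n - 1 - k. f k j + of_real h * g j)"
    unfolding 1 2 by (simp add: sum.distrib distrib_left)
  also have "cmod \<dots> \<le> real n * (e * h) + (\<Sum>k<n. real n * ((16 * real n + 15) * (e * h)))"
  proof (intro norm_triangle_mono sum_norm_le)
    show "cmod (of_nat n * (v + of_real h / 2 * \<tau> (Y s ^ n))) \<le> real n * (e * h)"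
    proof (cases "n = 0")
      case False
      then show ?thesis
        using increment_expansion(1)[OF st e Ye, of "n - 1"]
        by (simp add: norm_mult v_def D_def h_def mult_left_mono del: of_real_diff)
    qed simp
    fix k assume k: "k \<in> {..<n}"
    have "cmod (\<Sum>j<n - 1 - k. f k j + of_real h * g j) \<le> (\<Sum>j<n - 1 - k. (16 * real n + 15) * (e * h))"
    proof (rule sum_norm_le)
      fix j assume j: "j \<in> {..<n - 1 - k}"
      have "k + (n - 2 - k - j) + 1 = n - 1 - j" using j k by auto
      then have "cmod (f k j + of_real h * g j) \<le> (16 * real (n - 2 - k - j) + 15) * e * h"
        using second_order_term[OF st e Ye, of k j "n - 2 - k - j"]
        by (simp only: f_def g_def D_def h_def)
      also have "\<dots> \<le> (16 * real n + 15) * e * h"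
        using e h by (intro mult_right_mono add_mono mult_left_mono) auto
      finally show "cmod (f k j + of_real h * g j) \<le> (16 * real n + 15) * (e * h)" by (simp add: mult.assoc)
    qed
    also have "\<dots> = real (n - 1 - k) * ((16 * real n + 15) * (e * h))" by simp
    also have "\<dots> \<le> real n * ((16 * real n + 15) * (e * h))"
      using e h by (intro mult_right_mono) auto
    finally show "cmod (\<Sum>j<n - 1 - k. f k j + of_real h * g j) \<le> real n * ((16 * real n + 15) * (e * h))" .
  qed
  also have "\<dots> = (real n * (1 + real n * (16 * real n + 15))) * e * h" by (simp add: algebra_simps)
  finally show ?thesis by (simp add: h_def)
qed

lemma continuous_on_moment: "continuous_on {0..} (\<lambda>t. \<tau> (Y t ^ n))"
proof -
  have "continuous_on {0..} (\<lambda>t. Y t ^ n)" by (intro continuous_intros Y_cont)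
  moreover have "eventually (\<lambda>x. Y x ^ n \<in> M) (at t within {0..})" for t
    by (auto simp: eventually_at_filter Y_M power_mem intro!: always_eventually)
  ultimately show ?thesis
    unfolding continuous_on_def by (auto intro!: tr_tendsto Y_M power_mem)
qed

text \<open>The expansion looks forward in time only. For a point \<open>u\<close> before
  \<open>t\<close> it is therefore taken at \<open>u\<close>, and continuity of \<open>drift\<close>
  replaces its value at \<open>u\<close> by that at \<open>t\<close>.\<close>

lemma moment_has_derivative:
  assumes t: "0 \<le> t"
  shows "((\<lambda>t. \<tau> (Y t ^ n)) has_vector_derivative drift n t) (at t within {0..})"
  unfolding has_vector_derivative_def has_derivative_within_alt
proof (intro conjI allI impI bounded_linear_scaleR_left)
  fix \<epsilon> :: real assume eps: "0 < \<epsilon>"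
  define C where "C = real n * (1 + real n * (16 * real n + 15))"
  have C: "0 \<le> C" by (simp add: C_def)
  \<comment> \<open>Half of the allowed error is for the expansion, the other half for the variation
    of \<open>drift\<close>; \<open>C + 1\<close> avoids division by 0 when
    \<open>n = 0\<close>.\<close>
  define e where "e = min 1 (\<epsilon> / (2 * (C + 1)))"
  have e: "0 < e" "e \<le> 1" "C * e \<le> \<epsilon> / 2"
  proof -
    show "0 < e" "e \<le> 1" using eps C by (auto simp: e_def)
    have "C * e \<le> (C + 1) * (\<epsilon> / (2 * (C + 1)))" using eps C by (intro mult_mono) (auto simp: e_def)
    also have "\<dots> = \<epsilon> / 2" using C by (simp add: field_simps)
    finally show "C * e \<le> \<epsilon> / 2" .
  qed
  have "continuous_on {0..} (drift n)"
    unfolding drift_def by (intro continuous_intros continuous_on_moment)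
  then obtain d1 where d1: "d1 > 0" "\<And>x. 0 \<le> x \<Longrightarrow> dist x t < d1 \<Longrightarrow> dist (drift n x) (drift n t) < \<epsilon> / 2"
    using t eps unfolding continuous_on_iff by (metis atLeast_iff half_gt_zero)
  obtain d2 where d2: "d2 > 0" "\<And>x. 0 \<le> x \<Longrightarrow> dist x t < d2 \<Longrightarrow> dist (Y x) (Y t) < e / 2"
    using t e Y_cont unfolding continuous_on_iff by (metis atLeast_iff half_gt_zero)
  \<comment> \<open>The bound by \<open>e\<^sup>2\<close> provides the condition on the time step in
    \<open>moment_increment\<close>.\<close>
  define d where "d = min (min d1 d2) (e\<^sup>2)"
  have "d > 0" using d1 d2 e by (simp add: d_def)
  moreover have "norm (\<tau> (Y u ^ n) - \<tau> (Y t ^ n) - (u - t) *\<^sub>R drift n t) \<le> \<epsilon> * norm (u - t)"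
    if u: "u \<in> {0..}" "norm (u - t) < d" for u
  proof -
    have Yd: "norm (Y x - Y y) \<le> e" if "0 \<le> x" "0 \<le> y" "dist x t \<le> dist u t" "dist y t \<le> dist u t" for x y
    proof -
      have "dist x t < d2" "dist y t < d2" using that u by (auto simp: d_def dist_norm)
      then have "dist (Y x) (Y y) < e" using that d2(2) dist_triangle_half_l by metis
      then show ?thesis by (simp add: dist_norm)
    qed
    consider "u = t" | "u > t" | "u < t" by linarith
    then show ?thesis
    proof cases
      case 2
      have "cmod (\<tau> (Y u ^ n) - \<tau> (Y t ^ n) - of_real (u - t) * drift n t) \<le> C * e * (u - t)"
        unfolding C_def using t u 2 e
        by (intro moment_increment Yd) (auto simp: d_def dist_norm)
      also have "\<dots> \<le> \<epsilon> / 2 * (u - t)" using e 2 by (intro mult_right_mono) auto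
      also have "\<dots> \<le> \<epsilon> * (u - t)" using eps 2 by (intro mult_right_mono) auto
      finally show ?thesis using 2 by (simp add: scaleR_conv_of_real)
    next
      case 3
      have "cmod (\<tau> (Y t ^ n) - \<tau> (Y u ^ n) - of_real (t - u) * drift n u) \<le> C * e * (t - u)"
        unfolding C_def using t u 3 e
        by (intro moment_increment Yd) (auto simp: d_def dist_norm)
      also have "\<dots> \<le> \<epsilon> / 2 * (t - u)" using e 3 by (intro mult_right_mono) auto
      finally have A: "cmod (\<tau> (Y t ^ n) - \<tau> (Y u ^ n) - of_real (t - u) * drift n u) \<le> \<epsilon> / 2 * (t - u)" .
      have B: "cmod (of_real (t - u) * (drift n u - drift n t)) \<le> (t - u) * (\<epsilon> / 2)"
        using d1(2)[of u] u 3 by (auto simp: norm_mult d_def dist_norm simp del: of_real_diff intro!: mult_mono)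
      have "\<tau> (Y u ^ n) - \<tau> (Y t ^ n) - (u - t) *\<^sub>R drift n t
        = - (\<tau> (Y t ^ n) - \<tau> (Y u ^ n) - of_real (t - u) * drift n u) - of_real (t - u) * (drift n u - drift n t)"
        by (simp add: scaleR_conv_of_real algebra_simps)
      also have "cmod \<dots> \<le> \<epsilon> / 2 * (t - u) + (t - u) * (\<epsilon> / 2)"
        using A B by (intro order_trans[OF norm_triangle_ineq4] add_mono) (simp_all add: norm_minus_commute)
      also have "\<dots> = \<epsilon> * norm (u - t)" using 3 by (simp add: algebra_simps)
      finally show ?thesis .
    qed simp
  qed
  ultimately show "\<exists>d>0. \<forall>u\<in>{0..}. norm (u - t) < d \<longrightarrow>
      norm (\<tau> (Y u ^ n) - \<tau> (Y t ^ n) - (u - t) *\<^sub>R drift n t) \<le> \<epsilon> * norm (u - t)" by blast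
qed

text \<open>With i = n - 1 - j the quadratic part becomes a Cauchy product of the moments with their
  Euler derivatives, as the Burgers equation requires.\<close>

lemma drift_eq: "drift n t = - (of_nat n / 2) * \<tau> (Y t ^ n)
    - (\<Sum>i\<in>{1..<n}. of_nat i * \<tau> (Y t ^ i) * \<tau> (Y t ^ (n - i)))"
proof -
  let ?f = "\<lambda>i. of_nat i * \<tau> (Y t ^ i) * \<tau> (Y t ^ (n - i))"
  have "(\<Sum>k<n. \<Sum>j<n - 1 - k. \<tau> (Y t ^ (n - 1 - j)) * \<tau> (Y t ^ (j + 1)))
      = (\<Sum>j<n. of_nat (n - 1 - j) * (\<tau> (Y t ^ (n - 1 - j)) * \<tau> (Y t ^ (j + 1))))"
    by (rule sum_triangle_swap)
  also have "\<dots> = (\<Sum>j<n. ?f (n - Suc j))"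
    by (intro sum.cong refl) (auto simp: mult.assoc Suc_diff_Suc)
  also have "\<dots> = (\<Sum>i<n. ?f i)" by (rule sum.nat_diff_reindex)
  also have "\<dots> = (\<Sum>i\<in>{1..<n}. ?f i)"
    by (intro sum.mono_neutral_right) auto
  finally show ?thesis by (simp add: drift_def)
qed

end

section \<open>The Burgers equation for formal power series\<close>

text \<open>Unlike \<open>fps_deriv\<close>, this derivation acts diagonally on coefficients, so
  recursions do not shift the index.\<close>

definition fps_euler :: "complex fps \<Rightarrow> complex fps" where
  "fps_euler F = fps_X * fps_deriv F"

lemma fps_euler_nth [simp]: "fps_nth (fps_euler F) n = of_nat n * fps_nth F n"
  by (cases n) (auto simp: fps_euler_def)

lemma fps_euler_simps:
  "fps_euler (F + G) = fps_euler F + fps_euler G"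
  "fps_euler (F - G) = fps_euler F - fps_euler G"
  "fps_euler (- F) = - fps_euler F"
  "fps_euler (F * G) = fps_euler F * G + F * fps_euler G"
  "fps_euler (fps_const c) = 0" "fps_euler 1 = 0"
  by (simp_all add: fps_euler_def algebra_simps)

text \<open>Coefficientwise differentiation in time needs no topology on series: each coefficient of
  a product is a finite sum, so the Leibniz rule holds coefficient by coefficient.\<close>

definition has_coeff_derivative ::
    "(real \<Rightarrow> complex fps) \<Rightarrow> complex fps \<Rightarrow> real filter \<Rightarrow> bool" where
  "has_coeff_derivative F F' A \<longleftrightarrow>
    (\<forall>n. ((\<lambda>s. fps_nth (F s) n) has_vector_derivative fps_nth F' n) A)"

lemma has_coeff_derivative_const: "has_coeff_derivative (\<lambda>_. F) 0 A"
  by (simp add: has_coeff_derivative_def)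

lemma has_coeff_derivative_parameter: "has_coeff_derivative (\<lambda>s. fps_const (of_real s)) 1 (at t within S)"
  unfolding has_coeff_derivative_def
  by (auto intro!: derivative_eq_intros simp: has_vector_derivative_of_real)

lemma has_coeff_derivative_add:
  "has_coeff_derivative F F' A \<Longrightarrow> has_coeff_derivative G G' A \<Longrightarrow>
    has_coeff_derivative (\<lambda>s. F s + G s) (F' + G') A"
  by (auto simp: has_coeff_derivative_def intro: has_vector_derivative_add)

lemma has_coeff_derivative_diff:
  "has_coeff_derivative F F' A \<Longrightarrow> has_coeff_derivative G G' A \<Longrightarrow>
    has_coeff_derivative (\<lambda>s. F s - G s) (F' - G') A"
  by (auto simp: has_coeff_derivative_def intro: has_vector_derivative_diff)

lemma has_coeff_derivative_mult:
  assumes "has_coeff_derivative F F' (at t within S)" "has_coeff_derivative G G' (at t within S)"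
  shows "has_coeff_derivative (\<lambda>s. F s * G s) (F' * G t + F t * G') (at t within S)"
  unfolding has_coeff_derivative_def fps_mult_nth fps_add_nth
proof
  fix n
  have "((\<lambda>s. \<Sum>i=0..n. fps_nth (F s) i * fps_nth (G s) (n - i)) has_vector_derivative
      (\<Sum>i=0..n. fps_nth (F t) i * fps_nth G' (n - i) + fps_nth F' i * fps_nth (G t) (n - i))) (at t within S)"
    using assms unfolding has_coeff_derivative_def
    by (intro has_vector_derivative_sum has_vector_derivative_mult) auto
  then show "((\<lambda>s. \<Sum>i=0..n. fps_nth (F s) i * fps_nth (G s) (n - i)) has_vector_derivative
      (\<Sum>i=0..n. fps_nth F' i * fps_nth (G t) (n - i)) + (\<Sum>i=0..n. fps_nth (F t) i * fps_nth G' (n - i)))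
      (at t within S)"
    by (simp add: sum.distrib add.commute)
qed

lemma has_coeff_derivative_euler:
  "has_coeff_derivative F F' A \<Longrightarrow> has_coeff_derivative (\<lambda>s. fps_euler (F s)) (fps_euler F') A"
  by (auto simp: has_coeff_derivative_def intro!: has_vector_derivative_mult_right)

text \<open>In the n-th coefficient of the product, the n-th coefficient of either factor meets the
  zero constant term of the other, so agreement below n suffices.\<close>

lemma fps_mult_nth_cong:
  fixes A B :: "complex fps"
  assumes "fps_nth A 0 = 0" "fps_nth A' 0 = 0" "fps_nth B 0 = 0" "fps_nth B' 0 = 0"
    and "\<And>k. k < n \<Longrightarrow> fps_nth A k = fps_nth A' k" "\<And>k. k < n \<Longrightarrow> fps_nth B k = fps_nth B' k"
  shows "fps_nth (A * B) n = fps_nth (A' * B') n"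
  unfolding fps_mult_nth
proof (intro sum.cong refl)
  fix i assume "i \<in> {0..n}"
  then consider "i = 0" | "i = n" | "i < n" "n - i < n" by fastforce
  then show "fps_nth A i * fps_nth B (n - i) = fps_nth A' i * fps_nth B' (n - i)"
    by cases (use assms in auto)
qed

text \<open>
  Along \<open>\<partial>\<^sub>s \<psi> = - \<psi> \<delta>\<psi>\<close> with \<open>\<delta> = X d/dX\<close>, the defect \<open>D\<close> of the claimed equation satisfies
  \<open>\<partial>\<^sub>s D = - \<psi> \<delta>D - (\<delta>\<psi>) D\<close>. The coefficients of \<open>D\<close> therefore vanish one after the other.
\<close>

lemma burgers_invariant:
  fixes \<psi> :: "real \<Rightarrow> complex fps"
  assumes zero: "\<And>s. fps_nth (\<psi> s) 0 = 0"
    and init: "\<And>n. 0 < n \<Longrightarrow> fps_nth (\<psi> 0) n = 1"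
    and burgers: "\<And>s. 0 \<le> s \<Longrightarrow> has_coeff_derivative \<psi> (- (\<psi> s * fps_euler (\<psi> s))) (at s within {0..})"
    and t: "0 \<le> t"
  shows "fps_euler (\<psi> t) * (1 + fps_const (of_real t) * (\<psi> t * (1 + \<psi> t))) = \<psi> t * (1 + \<psi> t)"
proof -
  define D where "D s = fps_euler (\<psi> s) * (1 + fps_const (of_real s) * (\<psi> s * (1 + \<psi> s))) - \<psi> s * (1 + \<psi> s)" for s
  have deriv: "has_coeff_derivative D (- (\<psi> s * fps_euler (D s)) - fps_euler (\<psi> s) * D s) (at s within {0..})"
    if "0 \<le> s" for s
  proof -
    let ?p = "\<psi> s" and ?th = "fps_euler (\<psi> s)" and ?c = "fps_const (complex_of_real s)"
    let ?p' = "- (?p * ?th)"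
    note b = burgers[OF that]
    have "has_coeff_derivative D
      (fps_euler ?p' * (1 + ?c * (?p * (1 + ?p)))
        + ?th * (0 + (1 * (?p * (1 + ?p)) + ?c * (?p' * (1 + ?p) + ?p * (0 + ?p')))) - (?p' * (1 + ?p) + ?p * (0 + ?p')))
      (at s within {0..})"
      unfolding D_def
      by (intro has_coeff_derivative_diff has_coeff_derivative_mult has_coeff_derivative_add
          has_coeff_derivative_const has_coeff_derivative_parameter has_coeff_derivative_euler b)
    also have "fps_euler ?p' * (1 + ?c * (?p * (1 + ?p)))
        + ?th * (0 + (1 * (?p * (1 + ?p)) + ?c * (?p' * (1 + ?p) + ?p * (0 + ?p')))) - (?p' * (1 + ?p) + ?p * (0 + ?p'))
      = - (?p * fps_euler (D s)) - ?th * D s"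
      unfolding D_def fps_euler_simps by (simp add: algebra_simps)
    finally show ?thesis .
  qed
  have "fps_nth (D s) n = 0" if "0 \<le> s" for s n
    using that
  proof (induction n arbitrary: s rule: less_induct)
    case (less n)
    have "((\<lambda>s. fps_nth (D s) n) has_vector_derivative 0) (at s within {0..})" if s: "0 \<le> s" for s
    proof -
      \<comment> \<open>As \<open>\<psi>\<close> has no constant term, the n-th coefficient of the
        right-hand side involves only coefficients of \<open>D\<close> below n. These vanish by
        induction, so the n-th one is constant in time.\<close>
      have "fps_nth (\<psi> s) i * fps_nth (D s) (n - i) = 0" if "i \<le> n" for i
        using that less.IH[of "n - i" s] s zero by (cases i) auto
      then have z: "fps_nth (\<psi> s) i = 0 \<or> fps_nth (D s) (n - i) = 0" if "i \<le> n" for i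
        using that by auto
      have "fps_nth (\<psi> s * fps_euler (D s)) n = 0" "fps_nth (fps_euler (\<psi> s) * D s) n = 0"
        unfolding fps_mult_nth by (intro sum.neutral ballI; use z in fastforce)+
      then show ?thesis using deriv[OF s] by (simp add: has_coeff_derivative_def) (metis diff_zero minus_zero)
    qed
    then obtain c where c: "\<And>s. 0 \<le> s \<Longrightarrow> fps_nth (D s) n = c"
      using has_vector_derivative_zero_constant[of "{0..}" "\<lambda>s. fps_nth (D s) n"] by auto
    \<comment> \<open>At time 0 the series is X / (1 - X), whose Euler derivative X / (1 - X)^2
      equals psi (1 + psi).\<close>
    have "fps_nth (D 0) n = 0"
    proof -
      have "fps_nth (\<psi> 0 * (1 + \<psi> 0)) n = (\<Sum>i=0..n. if i = 0 then 0 else 1)"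
        unfolding fps_mult_nth using init zero by (intro sum.cong refl) auto
      also have "\<dots> = of_nat n" by (induction n) auto
      finally show ?thesis using init[of n] by (cases "n = 0") (auto simp: D_def)
    qed
    with c less.prems show ?case by force
  qed
  then have "D t = 0" using t by (simp add: fps_eq_iff)
  then show ?thesis by (simp add: D_def)
qed

text \<open>Comparing coefficients expresses alpha (n - 1) F_n through lower coefficients. The
  factor n - 1 vanishes at n = 1, which is why the linear coefficient is prescribed as well.\<close>

lemma fps_ode_unique:
  fixes G H :: "complex fps"
  assumes \<alpha>: "\<alpha> \<noteq> 0"
    and G: "fps_euler G * (fps_const \<alpha> + c * (G * (G + fps_const \<alpha>))) = G * (G + fps_const \<alpha>)"
    and H: "fps_euler H * (fps_const \<alpha> + c * (H * (H + fps_const \<alpha>))) = H * (H + fps_const \<alpha>)"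
    and 0: "fps_nth G 0 = 0" "fps_nth H 0 = 0" and 1: "fps_nth G 1 = fps_nth H 1"
  shows "G = H"
proof (rule fps_ext)
  have rec: "\<alpha> * (of_nat n - 1) * fps_nth F n
      = fps_nth (F * F) n - fps_nth (c * (fps_euler F * F * (F + fps_const \<alpha>))) n"
    if "fps_euler F * (fps_const \<alpha> + c * (F * (F + fps_const \<alpha>))) = F * (F + fps_const \<alpha>)" for F n
  proof -
    have "fps_const \<alpha> * fps_euler F - fps_const \<alpha> * F = F * F - c * (fps_euler F * F * (F + fps_const \<alpha>))"
      using that by (simp add: algebra_simps)
    then have "fps_nth (fps_const \<alpha> * fps_euler F - fps_const \<alpha> * F) n
        = fps_nth (F * F - c * (fps_euler F * F * (F + fps_const \<alpha>))) n" by simp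
    then show ?thesis by (simp add: algebra_simps)
  qed
  fix n show "fps_nth G n = fps_nth H n"
  proof (induction n rule: less_induct)
    case (less n)
    consider "n = 0" | "n = 1" | "n \<ge> 2" by linarith
    then show ?case
    proof cases
      case 3
      have e: "fps_nth (fps_euler G * G) m = fps_nth (fps_euler H * H) m" if "m \<le> n" for m
        using 0 less.IH that by (intro fps_mult_nth_cong) auto
      have q: "fps_nth (G * G) n = fps_nth (H * H) n"
        using 0 less.IH by (intro fps_mult_nth_cong) auto
      \<comment> \<open>The last factor has a constant term, so \<open>fps_mult_nth_cong\<close>
        does not apply; but the product before it has none, so only coefficients of \<open>G\<close>
        and \<open>H\<close> below n meet its nonzero terms.\<close>
      have r: "fps_nth (fps_euler G * G * (G + fps_const \<alpha>)) m = fps_nth (fps_euler H * H * (H + fps_const \<alpha>)) m"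
        if "m \<le> n" for m
        unfolding fps_mult_nth[of _ "_ + _"]
      proof (intro sum.cong refl)
        fix i assume i: "i \<in> {0..m}"
        show "fps_nth (fps_euler G * G) i * fps_nth (G + fps_const \<alpha>) (m - i)
            = fps_nth (fps_euler H * H) i * fps_nth (H + fps_const \<alpha>) (m - i)"
          using i that e[of i] less.IH[of "m - i"] by (cases "i = 0") auto
      qed
      have "fps_nth (c * (fps_euler G * G * (G + fps_const \<alpha>))) n = fps_nth (c * (fps_euler H * H * (H + fps_const \<alpha>))) n"
        unfolding fps_mult_nth[of c] using r by (intro sum.cong refl) auto
      then have "\<alpha> * (of_nat n - 1) * fps_nth G n = \<alpha> * (of_nat n - 1) * fps_nth H n"
        unfolding rec[OF G] rec[OF H] q by simp
      moreover have "of_nat n - 1 \<noteq> (0::complex)" using 3 by (metis eq_iff_diff_eq_0 of_nat_1_eq_iff one_neq_zero numeral_le_one_iff semiring_norm(69))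
      ultimately show ?thesis using \<alpha> by simp
    qed (use 0 1 in auto)
  qed
qed

text \<open>
  The equation of \<open>burgers_invariant\<close> is the logarithmic derivative of \<open>\<psi> e\<^bsup>t\<psi>\<^esup> = X (1 + \<psi>)\<close>, that for
  \<open>G\<close> of \<open>G e\<^bsup>tG\<^esup> = X (\<alpha> + G)\<close>; the substitution \<open>Z\<close> takes \<open>X (\<alpha> + G)\<close> to \<open>X (1 + \<psi>)\<close>.
\<close>

lemma subordination_ode:
  fixes \<psi> G Z :: "complex fps"
  assumes \<alpha>: "\<alpha> \<noteq> 0" and zero: "fps_nth \<psi> 0 = 0"
    and \<psi>: "fps_euler \<psi> * (1 + fps_const c * (\<psi> * (1 + \<psi>))) = \<psi> * (1 + \<psi>)"
    and Z: "Z * (\<psi> + fps_const \<alpha>) = fps_X * (1 + \<psi>)"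
    and G: "G oo Z = \<psi>"
  shows "fps_euler G * (fps_const \<alpha> + fps_const c * (G * (G + fps_const \<alpha>))) = G * (G + fps_const \<alpha>)"
    and "fps_nth G 1 = \<alpha> * fps_nth \<psi> 1"
proof -
  have "fps_nth (Z * (\<psi> + fps_const \<alpha>)) 0 = 0" "fps_nth (Z * (\<psi> + fps_const \<alpha>)) 1 = 1"
    unfolding Z using zero by simp_all
  then have Z0: "fps_nth Z 0 = 0" and Z1: "fps_nth Z 1 * \<alpha> = 1"
    using \<alpha> zero by (auto simp: fps_mult_nth)
  have "fps_nth (G oo Z) 1 = fps_nth G 1 * fps_nth Z 1" by (simp add: fps_compose_nth Z0)
  then show "fps_nth G 1 = \<alpha> * fps_nth \<psi> 1" using Z1 \<alpha> unfolding G by (simp add: field_simps)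
  define a where "a = 1 + \<psi>"
  define b where "b = \<psi> + fps_const \<alpha>"
  define \<theta> where "\<theta> = fps_euler \<psi>"
  define G' where "G' = fps_deriv G oo Z"
  define g where "g = Z * G'"
  \<comment> \<open>From Z = X a / b, the logarithmic Euler derivative of \<open>Z\<close> is q / (a
    b). Since \<open>g\<close> is the Euler derivative of \<open>G\<close> composed with
    \<open>Z\<close>, the chain rule reads theta a b = g q. The constant term of \<open>q\<close> is
    alpha, so \<open>q\<close> can be cancelled later.\<close>
  define q where "q = a * b - (1 - fps_const \<alpha>) * \<theta>"
  have ZX: "Z * b = fps_X * a" using Z by (simp add: a_def b_def)
  have "fps_deriv \<psi> = G' * fps_deriv Z"
    using fps_compose_deriv[OF Z0, of G] by (simp add: G G'_def)
  then have th: "\<theta> = G' * fps_euler Z" by (simp add: \<theta>_def fps_euler_def)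
  have "fps_euler (Z * b) = fps_euler (fps_X * a)" using ZX by simp
  then have eZ: "fps_euler Z * b = fps_X * a + fps_X * \<theta> - Z * \<theta>"
    by (simp add: fps_euler_simps \<theta>_def a_def b_def) (simp add: fps_euler_def algebra_simps)
  have "\<theta> * a * b = G' * (fps_euler Z * b) * a" by (simp add: th mult_ac)
  also have "\<dots> = G' * (fps_X * a * a + (fps_X * a) * \<theta> - Z * a * \<theta>)"
    unfolding eZ by (simp add: algebra_simps)
  also have "\<dots> = g * (a * b + b * \<theta> - a * \<theta>)"
    unfolding ZX[symmetric] g_def by (simp add: algebra_simps)
  also have "a * b + b * \<theta> - a * \<theta> = q" by (simp add: q_def a_def b_def algebra_simps)
  finally have gq: "\<theta> * a * b = g * q" .
  have "fps_nth q 0 = \<alpha>" using zero by (simp add: q_def a_def b_def \<theta>_def)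
  then have q: "q \<noteq> 0" using \<alpha> by auto
  have hyp: "\<theta> * (1 + fps_const c * (\<psi> * a)) = \<psi> * a" using \<psi> by (simp add: \<theta>_def a_def)
  have "\<theta> * a * (fps_const \<alpha> + fps_const c * (\<psi> * b))
      = a * fps_const \<alpha> * \<theta> + b * (\<theta> * (1 + fps_const c * (\<psi> * a)) - \<theta>)"
    by (simp add: algebra_simps)
  also have "\<dots> = \<psi> * q" unfolding hyp by (simp add: q_def a_def b_def algebra_simps)
  finally have "\<theta> * a * (fps_const \<alpha> + fps_const c * (\<psi> * b)) = \<psi> * q" .
  then have "\<theta> * a * b * (fps_const \<alpha> + fps_const c * (\<psi> * b)) = \<psi> * b * q"
    by (metis (no_types) mult.assoc mult.commute)
  then have "(g * (fps_const \<alpha> + fps_const c * (\<psi> * b))) * q = (\<psi> * b) * q"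
    unfolding gq by (simp add: mult_ac)
  then have "g * (fps_const \<alpha> + fps_const c * (\<psi> * b)) = \<psi> * b" using q by simp
  moreover have "(fps_euler G * (fps_const \<alpha> + fps_const c * (G * (G + fps_const \<alpha>)))) oo Z
      = g * (fps_const \<alpha> + fps_const c * (\<psi> * b))" "(G * (G + fps_const \<alpha>)) oo Z = \<psi> * b"
    using Z0 by (simp_all add: fps_compose_mult_distrib fps_compose_add_distrib G fps_euler_def g_def G'_def b_def)
  ultimately have "(fps_euler G * (fps_const \<alpha> + fps_const c * (G * (G + fps_const \<alpha>))) - G * (G + fps_const \<alpha>)) oo Z = 0"
    by (simp add: fps_compose_sub_distrib)
  \<comment> \<open>Composition with a nonzero series without constant term is injective, so the
    equation for \<open>G oo Z\<close> descends to \<open>G\<close>.\<close>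
  moreover have "Z \<noteq> 0" using Z1 by auto
  ultimately show "fps_euler G * (fps_const \<alpha> + fps_const c * (G * (G + fps_const \<alpha>))) = G * (G + fps_const \<alpha>)"
    using Z0 by (simp add: fps_compose_eq_0_iff)
qed

section \<open>Free multiplication by a projection\<close>

lemma summable_power_bop:
  fixes x :: "'h::complex_hilbert_space bop"
  assumes "norm x < 1"
  shows "summable (\<lambda>n. x ^ n)"
  by (rule summable_comparison_test'[of "\<lambda>n. norm x ^ n" 0])
    (use assms norm_power_bop in \<open>auto intro: summable_geometric\<close>)

definition neumann :: "'h::complex_hilbert_space bop \<Rightarrow> 'h bop" where
  "neumann x = (\<Sum>n. x ^ n)"

lemma neumann_inverse:
  fixes x :: "'h::complex_hilbert_space bop"
  assumes x: "norm x < 1"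
  shows "neumann x * (1 - x) = 1" "(1 - x) * neumann x = 1"
proof -
  note s = summable_power_bop[OF x]
  have 1: "neumann x = 1 + (\<Sum>n. x ^ Suc n)"
    using suminf_split_head[OF s] by (simp add: neumann_def)
  have "(\<Sum>n. x ^ Suc n) = x * neumann x"
    using suminf_mult[OF s, of x] by (simp add: neumann_def)
  with 1 show "(1 - x) * neumann x = 1" by (simp add: algebra_simps)
  have "(\<Sum>n. x ^ Suc n) = neumann x * x"
    using suminf_mult2[OF s, of x] by (simp add: neumann_def power_commutes)
  with 1 show "neumann x * (1 - x) = 1" by (simp add: algebra_simps)
qed

lemma norm_neumann_diff_one:
  fixes x :: "'h::complex_hilbert_space bop"
  assumes x: "norm x \<le> 1/2"
  shows "norm (neumann x - 1) \<le> 2 * norm x"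
proof -
  have x1: "norm x < 1" using x by simp
  have "norm (neumann x) \<le> (\<Sum>n. norm x ^ n)"
    unfolding neumann_def using x1 norm_power_bop
    by (intro norm_suminf_le summable_geometric) auto
  also have "\<dots> = 1 / (1 - norm x)" using x1 by (intro suminf_geometric) simp
  also have "\<dots> \<le> 2" using x by (simp add: field_simps)
  finally have 2: "norm (neumann x) \<le> 2" .
  have "neumann x - 1 = neumann x * x" using neumann_inverse(1)[OF x1] by (simp add: algebra_simps)
  then have "norm (neumann x - 1) \<le> norm (neumann x) * norm x" by (simp add: norm_mult_ineq)
  also have "\<dots> \<le> 2 * norm x" using 2 by (intro mult_right_mono) auto
  finally show ?thesis .
qed

text \<open>Indexing by parity lets \<open>even\<close> itself label the algebras in the definition
  of freeness; starting at index 1 gives the word that begins with \<open>r\<close>.\<close>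

lemma prod_list_alternating:
  fixes p r :: "'a::monoid_mult"
  shows "prod_list (map (\<lambda>i. if even i then p else r) [0..<2 * k]) = (p * r) ^ k"
    and "prod_list (map (\<lambda>i. if even i then p else r) [1..<2 * k + 2]) = r * (p * r) ^ k"
proof -
  let ?f = "\<lambda>i. if even i then p else r"
  show "prod_list (map ?f [0..<2 * k]) = (p * r) ^ k"
    by (induction k) (simp_all add: power_Suc2 mult.assoc del: power_Suc)
  show "prod_list (map ?f [1..<2 * k + 2]) = r * (p * r) ^ k"
  proof (induction k)
    case (Suc k)
    have "2 * Suc k + 2 = Suc (Suc (2 * k + 2))" by simp
    then have "[1..<2 * Suc k + 2] = [1..<2 * k + 2] @ [2 * k + 2, 2 * k + 3]"
      by (simp only: upt_Suc) simp
    then have "prod_list (map ?f [1..<2 * Suc k + 2]) = prod_list (map ?f [1..<2 * k + 2]) * (p * r)"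
      by (simp del: upt_Suc)
    also have "\<dots> = r * (p * r) ^ Suc k"
      unfolding Suc.IH by (simp only: power_Suc2 mult.assoc)
    finally show ?case .
  qed simp
qed

lemma star_free_alternating:
  assumes "star_free \<tau> S T" "p \<in> star_algebra S" "\<tau> p = 0" "r \<in> star_algebra T" "\<tau> r = 0"
  shows "\<tau> ((p * r) ^ Suc k) = 0" "\<tau> (r * (p * r) ^ k) = 0"
proof -
  have *: "\<tau> (prod_list (map (\<lambda>i. if even i then p else r) [a..<b])) = 0" if "a < b" for a b
    by (rule star_freeD[OF assms(1), where bs = "map even [a..<b]"]) (use assms that in auto)
  show "\<tau> ((p * r) ^ Suc k) = 0" using *[of 0 "2 * Suc k"] unfolding prod_list_alternating by simp
  show "\<tau> (r * (p * r) ^ k) = 0" using *[of 1 "2 * k + 2"] unfolding prod_list_alternating by simp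
qed

context tracial
begin

lemma neumann_M:
  assumes "x \<in> M" "norm x < 1"
  shows "neumann x \<in> M"
proof (rule closed_sequentially[OF closed])
  show "(\<lambda>n. \<Sum>k<n. x ^ k) \<longlonglongrightarrow> neumann x"
    unfolding neumann_def by (intro summable_LIMSEQ summable_power_bop assms)
qed (use assms in auto)

lemma tr_neumann:
  assumes "x \<in> M" "b \<in> M" "norm x < 1"
  shows "(\<lambda>n. \<tau> (b * x ^ n)) sums \<tau> (b * neumann x)"
  unfolding sums_def
proof -
  have "(\<lambda>n. \<Sum>k<n. x ^ k) \<longlonglongrightarrow> neumann x"
    unfolding neumann_def by (intro summable_LIMSEQ summable_power_bop assms)
  then have "(\<lambda>n. b * (\<Sum>k<n. x ^ k)) \<longlonglongrightarrow> b * neumann x" by (intro tendsto_intros)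
  then have "(\<lambda>n. \<tau> (b * (\<Sum>k<n. x ^ k))) \<longlonglongrightarrow> \<tau> (b * neumann x)"
    using assms neumann_M by (intro tr_tendsto always_eventually) auto
  then show "(\<lambda>n. \<Sum>k<n. \<tau> (b * x ^ k)) \<longlonglongrightarrow> \<tau> (b * neumann x)"
    using assms by (simp add: sum_distrib_left tr_sum mult_mem power_mem)
qed

text \<open>
  The factorisation \<open>1 - z P y = A (1 - S R\<degree>) (1 - w y)\<close> with \<open>S\<close> and \<open>R\<degree>\<close> centred determines \<open>z\<close> as a
  function of \<open>w\<close>. By freeness only the zeroth term of the Neumann series of \<open>1 - S R\<degree>\<close> has a trace.
\<close>

lemma projection_resolvent:
  fixes P y :: "'h bop" and \<alpha> w z m :: complex
  assumes mem: "P \<in> M" "y \<in> M" "P * P = P" and \<alpha>: "\<tau> P = \<alpha>" "\<alpha> \<noteq> 0"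
    and free: "star_free \<tau> {P} T" "y \<in> star_algebra T"
    and m: "m = \<tau> (neumann (w \<cdot>\<^sub>C y))" "m \<noteq> 0" "m - 1 + \<alpha> \<noteq> 0" and z: "z = w * m / (m - 1 + \<alpha>)"
    and small: "norm (w \<cdot>\<^sub>C y) < 1" "norm (z \<cdot>\<^sub>C (P * y)) < 1"
      "norm ((1 / (\<alpha> * m)) \<cdot>\<^sub>C (P - \<alpha> \<cdot>\<^sub>C 1)) * norm (neumann (w \<cdot>\<^sub>C y) - m \<cdot>\<^sub>C 1) < 1"
  shows "m * \<tau> (neumann (z \<cdot>\<^sub>C (P * y)))
    - (m - 1) * (m / (m - 1 + \<alpha>)) * \<tau> (P * neumann (z \<cdot>\<^sub>C (P * y))) = m"
proof -
  define R where "R = neumann (w \<cdot>\<^sub>C y)"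
  define R0 where "R0 = R - m \<cdot>\<^sub>C 1"
  define P0 where "P0 = P - \<alpha> \<cdot>\<^sub>C 1"
  \<comment> \<open>With R the resolvent, 1 - z P y = ((1 - kappa P) R + kappa P) (1 - w y).
    Inserting R = m + R0 gives the first factor as A + (1 - kappa P) R0, so \<open>S\<close> has to
    satisfy A S = kappa P - 1. The value of \<open>\<kappa>\<close> below is the one for which this
    \<open>S\<close> is centred, a multiple of \<open>P0\<close>.\<close>
  define S where "S = (1 / (\<alpha> * m)) \<cdot>\<^sub>C P0"
  define U where "U = neumann (z \<cdot>\<^sub>C (P * y))"
  define \<kappa> where "\<kappa> = m / (m - 1 + \<alpha>)"
  define A where "A = m \<cdot>\<^sub>C 1 - ((m - 1) * \<kappa>) \<cdot>\<^sub>C P"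
  \<comment> \<open>The factorisation becomes \<open>W * (1 - S * R0) = R\<close>, so
    \<open>W\<close> is \<open>R\<close> times a Neumann series and \<open>A\<close> never has to be
    inverted.\<close>
  define W where "W = U * A"
  have zl: "z = \<kappa> * w" by (simp add: z \<kappa>_def)
  have M: "R \<in> M" "U \<in> M"
    using mem small by (auto simp: R_def U_def intro!: neumann_M)
  then have M': "R0 \<in> M" "P0 \<in> M" "S \<in> M" "A \<in> M" "W \<in> M"
    using mem by (auto simp: R0_def P0_def S_def A_def W_def)
  have SR: "norm (S * R0) < 1"
    using small(3) norm_mult_ineq[of S R0] by (simp add: S_def P0_def R0_def R_def)
  have Ry: "R * (1 - w \<cdot>\<^sub>C y) = 1" "(1 - w \<cdot>\<^sub>C y) * R = 1"
    using neumann_inverse[OF small(1)] by (simp_all add: R_def)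
  have AS: "A * S = \<kappa> \<cdot>\<^sub>C P - 1"
  proof -
    have "A * S = (1 / (\<alpha> * m)) \<cdot>\<^sub>C ((m - (m - 1) * \<kappa> + (m - 1) * \<kappa> * \<alpha>) \<cdot>\<^sub>C P - (m * \<alpha>) \<cdot>\<^sub>C 1)"
      by (simp add: A_def S_def P0_def left_diff_distrib right_diff_distrib mem(3) scaleC_bop_simps)
    also have "m - (m - 1) * \<kappa> + (m - 1) * \<kappa> * \<alpha> = \<kappa> * (\<alpha> * m)"
    proof -
      have "\<kappa> * (m - 1 + \<alpha>) = m" using m(3) by (simp add: \<kappa>_def)
      moreover have "m - (m - 1) * \<kappa> + (m - 1) * \<kappa> * \<alpha> - \<kappa> * (\<alpha> * m) = m - \<kappa> * (m - 1 + \<alpha>)"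
        by (simp add: algebra_simps)
      ultimately show ?thesis by simp
    qed
    finally show ?thesis using m(2) \<alpha>(2) by (simp add: scaleC_bop_simps(3,5) mult.commute)
  qed
  have "A * (1 - S * R0) = A - (\<kappa> \<cdot>\<^sub>C P - 1) * R0"
    by (simp add: right_diff_distrib mult.assoc[symmetric] AS)
  also have "\<dots> = \<kappa> \<cdot>\<^sub>C P - (\<kappa> \<cdot>\<^sub>C P - 1) * R"
    by (simp add: A_def R0_def left_diff_distrib right_diff_distrib scaleC_bop_simps algebra_simps)
  finally have "A * (1 - S * R0) * (1 - w \<cdot>\<^sub>C y) = \<kappa> \<cdot>\<^sub>C P * (1 - w \<cdot>\<^sub>C y) - (\<kappa> \<cdot>\<^sub>C P - 1)"
    using Ry(1) by (simp add: left_diff_distrib mult.assoc)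
  also have "\<dots> = 1 - z \<cdot>\<^sub>C (P * y)"
    by (simp add: right_diff_distrib zl scaleC_bop_simps mult.commute)
  finally have fact: "A * (1 - S * R0) * (1 - w \<cdot>\<^sub>C y) = 1 - z \<cdot>\<^sub>C (P * y)" .
  have "W * (1 - S * R0) = U * (A * (1 - S * R0) * (1 - w \<cdot>\<^sub>C y)) * R"
    by (simp add: W_def mult.assoc Ry(2))
  also have "\<dots> = R"
    unfolding fact U_def using neumann_inverse(1)[OF small(2)] by simp
  finally have "W - W * (S * R0) = R" by (simp add: right_diff_distrib)
  then have WR: "W = R + W * (S * R0)" by (metis diff_add_cancel)
  have expand: "W = (\<Sum>k<N. R * (S * R0) ^ k) + W * (S * R0) ^ N" for N
  proof (induction N)
    case (Suc N)
    have "W * (S * R0) ^ N = R * (S * R0) ^ N + W * (S * R0) ^ Suc N"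
      by (subst WR) (simp add: distrib_right mult.assoc)
    with Suc show ?case by (simp add: add.assoc)
  qed simp
  \<comment> \<open>Freeness is a statement about algebraic words, while \<open>R0\<close> is only a
    norm limit of polynomials in \<open>y\<close>; the centred partial sums carry the freeness
    relations to the limit.\<close>
  define r where "r n = (\<Sum>k<n. (w \<cdot>\<^sub>C y) ^ k) - \<tau> (\<Sum>k<n. (w \<cdot>\<^sub>C y) ^ k) \<cdot>\<^sub>C 1" for n
  have rM: "r n \<in> M" for n using mem by (auto simp: r_def)
  have P0a: "P0 \<in> star_algebra {P}" "\<tau> P0 = 0"
  proof -
    have "P0 = P + (- \<alpha>) \<cdot>\<^sub>C 1" by (simp add: P0_def scaleC_bop_minus_one)
    then show "P0 \<in> star_algebra {P}" by (simp only:) (intro star_algebra.intros(1-3,5); simp)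
    show "\<tau> P0 = 0" using mem \<alpha> by (simp add: P0_def tr_diff tr_scaleC scaleC_mem)
  qed
  have ra: "r n \<in> star_algebra T" "\<tau> (r n) = 0" for n
  proof -
    have wy: "w \<cdot>\<^sub>C y \<in> star_algebra T" by (intro star_algebra.intros(5) free(2))
    have p: "(w \<cdot>\<^sub>C y) ^ k \<in> star_algebra T" for k
      by (induction k) (simp_all add: star_algebra.intros(2) star_algebra.intros(5)[OF star_algebra.intros(4)[OF free(2)]])
    have "0 \<cdot>\<^sub>C 1 \<in> star_algebra T" by (intro star_algebra.intros(5) star_algebra.intros(2))
    then have "(\<Sum>k<n. (w \<cdot>\<^sub>C y) ^ k) \<in> star_algebra T"
      by (induction n) (simp_all add: p star_algebra.intros(3))
    then have "(\<Sum>k<n. (w \<cdot>\<^sub>C y) ^ k) + (- \<tau> (\<Sum>k<n. (w \<cdot>\<^sub>C y) ^ k)) \<cdot>\<^sub>C 1 \<in> star_algebra T"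
      by (intro star_algebra.intros(2,3,5))
    then show "r n \<in> star_algebra T" by (simp add: r_def scaleC_bop_minus_one)
    show "\<tau> (r n) = 0" using mem by (simp add: r_def tr_diff tr_scaleC scaleC_mem sum_mem power_mem)
  qed
  have r: "r \<longlonglongrightarrow> R0"
  proof -
    have s: "(\<lambda>n. \<Sum>k<n. (w \<cdot>\<^sub>C y) ^ k) \<longlonglongrightarrow> R"
      unfolding R_def neumann_def by (intro summable_LIMSEQ summable_power_bop small)
    then have "(\<lambda>n. \<tau> (\<Sum>k<n. (w \<cdot>\<^sub>C y) ^ k)) \<longlonglongrightarrow> m"
      unfolding m(1) R_def[symmetric] using mem M by (intro tr_tendsto always_eventually) auto
    then have "(\<lambda>n. \<tau> (\<Sum>k<n. (w \<cdot>\<^sub>C y) ^ k) \<cdot>\<^sub>C (1 :: 'h bop)) \<longlonglongrightarrow> m \<cdot>\<^sub>C 1"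
    proof -
      assume l: "(\<lambda>n. \<tau> (\<Sum>k<n. (w \<cdot>\<^sub>C y) ^ k)) \<longlonglongrightarrow> m"
      have "bounded_linear (\<lambda>c. c \<cdot>\<^sub>C (1 :: 'h bop))"
        by (rule bounded_linear_intro[where K = "norm (1 :: 'h bop)"])
          (auto simp: scaleC_bop_simps norm_scaleC_bop scaleR_conv_of_real scaleC_bop_of_real[symmetric])
      from bounded_linear.tendsto[OF this l] show ?thesis .
    qed
    with s show ?thesis unfolding r_def R0_def by (intro tendsto_diff)
  qed
  have lim0: "\<tau> (f R0) = 0" if "\<And>n. \<tau> (f (r n)) = 0" "(\<lambda>n. f (r n)) \<longlonglongrightarrow> f R0" "\<And>x. x \<in> M \<Longrightarrow> f x \<in> M" for f
  proof -
    have "(\<lambda>n. \<tau> (f (r n))) \<longlonglongrightarrow> \<tau> (f R0)"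
      using that rM M' by (intro tr_tendsto always_eventually) auto
    then show ?thesis using that(1) by (simp add: LIMSEQ_const_iff)
  qed
  have f1: "\<tau> ((P0 * R0) ^ Suc k) = 0" for k
  proof (rule lim0[of "\<lambda>x. (P0 * x) ^ Suc k"])
    show "\<tau> ((P0 * r n) ^ Suc k) = 0" for n
      by (rule star_free_alternating(1)[OF free(1) P0a ra])
    show "(\<lambda>n. (P0 * r n) ^ Suc k) \<longlonglongrightarrow> (P0 * R0) ^ Suc k" by (intro tendsto_intros r)
    show "(P0 * x) ^ Suc k \<in> M" if "x \<in> M" for x using that M' by (intro power_mem mult_mem)
  qed
  have f2: "\<tau> (R0 * (P0 * R0) ^ k) = 0" for k
  proof (rule lim0[of "\<lambda>x. x * (P0 * x) ^ k"])
    show "\<tau> (r n * (P0 * r n) ^ k) = 0" for n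
      by (rule star_free_alternating(2)[OF free(1) P0a ra])
    show "(\<lambda>n. r n * (P0 * r n) ^ k) \<longlonglongrightarrow> R0 * (P0 * R0) ^ k" by (intro tendsto_intros r)
    show "x * (P0 * x) ^ k \<in> M" if "x \<in> M" for x using that M' by (intro power_mem mult_mem)
  qed
  \<comment> \<open>The split R = m + R0 produces one alternating word of even and one of odd
    length, both of trace 0.\<close>
  have "\<tau> (R * (S * R0) ^ Suc k) = 0" for k
  proof -
    have "(S * R0) ^ Suc k = (1 / (\<alpha> * m)) ^ Suc k \<cdot>\<^sub>C (P0 * R0) ^ Suc k"
      by (simp add: S_def power_scaleC_bop del: power_Suc)
    moreover have "R = m \<cdot>\<^sub>C 1 + R0" by (simp add: R0_def)
    moreover have "(P0 * R0) ^ Suc k \<in> M" using M' by blast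
    ultimately show ?thesis
      using f1[of k] f2[of "Suc k"] M'
      by (simp add: distrib_right tr_add tr_scaleC scaleC_mem mult_mem add_mem scaleC_bop_simps del: power_Suc)
  qed
  then have t0: "\<tau> (R * (S * R0) ^ k) = (if k = 0 then m else 0)" for k
    by (cases k) (auto simp: R_def m(1) simp del: power_Suc)
  have "\<tau> W = (if N = 0 then 0 else m) + \<tau> (W * (S * R0) ^ N)" for N
  proof -
    have "\<tau> W = \<tau> ((\<Sum>k<N. R * (S * R0) ^ k) + W * (S * R0) ^ N)" using expand[of N] by simp
    also have "\<dots> = (\<Sum>k<N. \<tau> (R * (S * R0) ^ k)) + \<tau> (W * (S * R0) ^ N)"
      using M M' by (subst tr_add) (auto simp: tr_sum mult_mem power_mem intro!: sum_mem)
    finally show ?thesis by (simp add: t0)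
  qed
  then have "\<tau> W - m = \<tau> (W * (S * R0) ^ Suc N)" for N by (metis add_diff_cancel_left' nat.distinct(2))
  moreover have "cmod (\<tau> (W * (S * R0) ^ Suc N)) \<le> norm W * norm (S * R0) ^ Suc N" for N
  proof -
    have "cmod (\<tau> (W * (S * R0) ^ Suc N)) \<le> norm (W * (S * R0) ^ Suc N)"
      using M' by (intro tr_le_norm) auto
    also have "\<dots> \<le> norm W * norm ((S * R0) ^ Suc N)" by (rule norm_mult_ineq)
    also have "\<dots> \<le> norm W * norm (S * R0) ^ Suc N" by (intro mult_left_mono norm_power_bop) auto
    finally show ?thesis .
  qed
  ultimately have le: "cmod (\<tau> W - m) \<le> norm W * norm (S * R0) ^ Suc N" for N by metis
  have "(\<lambda>N. norm W * norm (S * R0) ^ Suc N) \<longlonglongrightarrow> norm W * 0"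
    using SR by (intro tendsto_mult_left LIMSEQ_Suc[OF LIMSEQ_realpow_zero]) auto
  then have "cmod (\<tau> W - m) \<le> norm W * 0"
    by (rule LIMSEQ_le_const) (use le in auto)
  then have "\<tau> W = m" by simp
  moreover have "\<tau> W = m * \<tau> U - (m - 1) * \<kappa> * \<tau> (U * P)"
    using M mem by (simp add: W_def A_def right_diff_distrib tr_diff tr_scaleC scaleC_mem mult_mem)
  ultimately show ?thesis
    using tr_commute[of U P] M mem by (simp add: U_def \<kappa>_def)
qed

text \<open>The leading 1 of the moment series is dropped: the Burgers equation and the uniqueness
  argument concern series without constant term.\<close>

definition moment_fps :: "'h bop \<Rightarrow> complex fps" where
  "moment_fps x = Abs_fps (\<lambda>n. if n = 0 then 0 else \<tau> (x ^ n))"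

lemma moment_fps_sums:
  assumes x: "x \<in> M" "norm (w \<cdot>\<^sub>C x) < 1"
  shows "(\<lambda>n. fps_nth (moment_fps x) n * w ^ n) sums (\<tau> (neumann (w \<cdot>\<^sub>C x)) - 1)"
proof -
  have "(\<lambda>n. \<tau> (1 * (w \<cdot>\<^sub>C x) ^ n)) sums \<tau> (1 * neumann (w \<cdot>\<^sub>C x))"
    using x by (intro tr_neumann) auto
  from sums_diff[OF this sums_single[of 0 "\<lambda>_. 1"]]
  have "(\<lambda>n. \<tau> ((w \<cdot>\<^sub>C x) ^ n) - (if n = 0 then 1 else 0)) sums (\<tau> (neumann (w \<cdot>\<^sub>C x)) - 1)" by simp
  moreover have "\<tau> ((w \<cdot>\<^sub>C x) ^ n) - (if n = 0 then 1 else 0) = fps_nth (moment_fps x) n * w ^ n" for n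
    using x by (simp add: power_scaleC_bop tr_scaleC power_mem moment_fps_def)
  ultimately show ?thesis by simp
qed

lemma eval_moment_fps:
  "x \<in> M \<Longrightarrow> norm (w \<cdot>\<^sub>C x) < 1 \<Longrightarrow> eval_fps (moment_fps x) w = \<tau> (neumann (w \<cdot>\<^sub>C x)) - 1"
  unfolding eval_fps_def by (rule sums_unique[symmetric, OF moment_fps_sums])

lemma moment_fps_expansion:
  assumes x: "x \<in> M"
  shows "eval_fps (moment_fps x) has_fps_expansion moment_fps x"
proof (rule eval_fps_has_fps_expansion)
  define w where "w = complex_of_real (1 / (norm x + 1))"
  have pos: "norm x + 1 > 0" by (simp add: add_nonneg_pos)
  have nw: "norm w = 1 / (norm x + 1)" unfolding w_def norm_of_real using pos by simp
  have "norm (w \<cdot>\<^sub>C x) < 1" unfolding norm_scaleC_bop nw using pos by (simp add: field_simps)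
  then have "summable (\<lambda>n. fps_nth (moment_fps x) n * w ^ n)"
    using moment_fps_sums[OF x] by (simp add: sums_iff)
  then have "ereal (norm w) \<le> fps_conv_radius (moment_fps x)"
    unfolding fps_conv_radius_def by (rule conv_radius_geI)
  moreover have "norm w > 0" unfolding nw using pos by simp
  ultimately show "fps_conv_radius (moment_fps x) > 0" by (metis ereal_less(2) less_le_trans)
qed

text \<open>Near w = 0 all smallness conditions of \<open>projection_resolvent\<close> hold, and the
  resulting linear equation for the value at z has the solution m - 1. The identity of analytic
  functions then passes to formal series by uniqueness of power series expansions.\<close>

lemma moment_fps_projection:
  fixes P y :: "'h bop" and \<alpha> :: complex
  assumes mem: "P \<in> M" "y \<in> M" "P * P = P" and \<alpha>: "\<tau> P = \<alpha>" "\<alpha> \<noteq> 0"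
    and free: "star_free \<tau> {P} T" "y \<in> star_algebra T"
  defines "Z \<equiv> fps_X * (1 + moment_fps y) * inverse (moment_fps y + fps_const \<alpha>)"
  shows "moment_fps (P * y) oo Z = moment_fps y"
proof -
  define f where "f = eval_fps (moment_fps y)"
  define g where "g = eval_fps (moment_fps (P * y))"
  define \<zeta> where "\<zeta> w = w * (1 + f w) * inverse (f w + \<alpha>)" for w
  have exf: "f has_fps_expansion moment_fps y" unfolding f_def by (rule moment_fps_expansion[OF mem(2)])
  have exg: "g has_fps_expansion moment_fps (P * y)" unfolding g_def using mem by (intro moment_fps_expansion) auto
  have c0: "fps_nth (moment_fps y) 0 = 0" by (simp add: moment_fps_def)
  have ex\<zeta>: "\<zeta> has_fps_expansion Z"
    unfolding \<zeta>_def Z_def using c0 \<alpha>(2) exf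
    by (intro fps_expansion_intros) auto
  have Z0: "fps_nth Z 0 = 0" by (simp add: Z_def)
  have f0: "f 0 = 0" using eval_moment_fps[OF mem(2), of 0] neumann_inverse(1)[of "0 :: 'h bop"] by (simp add: f_def)
  have lf: "(f \<longlongrightarrow> 0) (nhds 0)"
    using has_fps_expansion_imp_continuous[OF exf, of UNIV] f0
    by (simp add: isCont_def tendsto_at_iff_tendsto_nhds[of f 0, simplified f0])
  have lw: "((\<lambda>w. w) \<longlongrightarrow> (0 :: complex)) (nhds 0)" by (rule filterlim_ident)
  have l\<zeta>: "(\<zeta> \<longlongrightarrow> 0 * (1 + 0) * inverse (0 + \<alpha>)) (nhds 0)"
    unfolding \<zeta>_def using \<alpha> by (intro tendsto_intros lf lw) auto
  let ?P0 = "P - \<alpha> \<cdot>\<^sub>C 1"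
  \<comment> \<open>Bounds norm(S) norm(R0) through R0 = (R - 1) - (m - 1) and
    \<open>norm_neumann_diff_one\<close>; it tends to 0 because f(0) = 0.\<close>
  let ?b = "\<lambda>w. cmod (1 / (\<alpha> * (1 + f w))) * norm ?P0 * (2 * (cmod w * norm y) + cmod (f w))"
  have t1: "((\<lambda>w. cmod w * norm y) \<longlongrightarrow> cmod 0 * norm y) (nhds 0)"
    by (intro tendsto_intros lw)
  have t2: "((\<lambda>w. cmod (\<zeta> w) * norm (P * y)) \<longlongrightarrow> cmod (0 * (1 + 0) * inverse (0 + \<alpha>)) * norm (P * y)) (nhds 0)"
    by (intro tendsto_intros l\<zeta>)
  have t3: "((\<lambda>w. 1 + f w) \<longlongrightarrow> 1 + 0) (nhds 0)" and t4: "((\<lambda>w. f w + \<alpha>) \<longlongrightarrow> 0 + \<alpha>) (nhds 0)"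
    by (intro tendsto_intros lf)+
  have t5: "(?b \<longlongrightarrow> cmod (1 / (\<alpha> * (1 + 0))) * norm ?P0 * (2 * (cmod 0 * norm y) + cmod 0)) (nhds 0)"
    using \<alpha>(2) by (intro tendsto_intros lf lw) auto
  have "eventually (\<lambda>w. cmod w * norm y < 1/2) (nhds 0)"
    using order_tendstoD(2)[OF t1, of "1/2"] by simp
  moreover have "eventually (\<lambda>w. cmod (\<zeta> w) * norm (P * y) < 1) (nhds 0)"
    using order_tendstoD(2)[OF t2, of 1] by simp
  moreover have "eventually (\<lambda>w. 1 + f w \<noteq> 0) (nhds 0)"
    using tendsto_imp_eventually_ne[OF t3, of 0] by simp
  moreover have "eventually (\<lambda>w. f w + \<alpha> \<noteq> 0) (nhds 0)"
    using tendsto_imp_eventually_ne[OF t4, of 0] \<alpha>(2) by simp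
  moreover have "eventually (\<lambda>w. ?b w < 1) (nhds 0)"
    using order_tendstoD(2)[OF t5, of 1] by simp
  ultimately have "eventually (\<lambda>w. g (\<zeta> w) = f w) (nhds 0)"
  proof eventually_elim
    case (elim w)
    define m where "m = \<tau> (neumann (w \<cdot>\<^sub>C y))"
    define z where "z = \<zeta> w"
    have ny: "norm (w \<cdot>\<^sub>C y) \<le> 1/2" "norm (w \<cdot>\<^sub>C y) < 1" and nz: "norm (z \<cdot>\<^sub>C (P * y)) < 1"
      using elim(1,2) by (simp_all add: norm_scaleC_bop z_def)
    have fm: "f w = m - 1" using eval_moment_fps[OF mem(2) ny(2)] by (simp add: f_def m_def)
    have m: "m \<noteq> 0" "m - 1 + \<alpha> \<noteq> 0" using elim(3,4) by (simp_all add: fm)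
    have zm: "z = w * m / (m - 1 + \<alpha>)" by (simp add: z_def \<zeta>_def fm field_simps)
    have "neumann (w \<cdot>\<^sub>C y) - m \<cdot>\<^sub>C 1 = (neumann (w \<cdot>\<^sub>C y) - 1) - (m - 1) \<cdot>\<^sub>C 1"
      by (simp add: scaleC_bop_simps)
    also have "norm \<dots> \<le> norm (neumann (w \<cdot>\<^sub>C y) - 1) + norm ((m - 1) \<cdot>\<^sub>C (1 :: 'h bop))"
      by (rule norm_triangle_ineq4)
    also have "\<dots> \<le> 2 * norm (w \<cdot>\<^sub>C y) + cmod (m - 1) * 1"
      unfolding norm_scaleC_bop[of "m - 1"]
      by (intro add_mono norm_neumann_diff_one ny mult_left_mono norm_one_bop) auto
    finally have "norm (neumann (w \<cdot>\<^sub>C y) - m \<cdot>\<^sub>C 1) \<le> 2 * (cmod w * norm y) + cmod (f w)"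
      by (simp add: norm_scaleC_bop fm)
    then have "norm ((1 / (\<alpha> * m)) \<cdot>\<^sub>C ?P0) * norm (neumann (w \<cdot>\<^sub>C y) - m \<cdot>\<^sub>C 1) \<le> ?b w"
      unfolding norm_scaleC_bop[of "1 / (\<alpha> * m)"] by (intro mult_mono) (auto simp: fm)
    then have small: "norm ((1 / (\<alpha> * m)) \<cdot>\<^sub>C ?P0) * norm (neumann (w \<cdot>\<^sub>C y) - m \<cdot>\<^sub>C 1) < 1"
      using elim(5) by linarith
    have Py: "P * y \<in> M" using mem by auto
    have gz: "\<tau> (neumann (z \<cdot>\<^sub>C (P * y))) = 1 + g z"
      using eval_moment_fps[OF Py nz] by (simp add: g_def)
    have "\<tau> (P * neumann (z \<cdot>\<^sub>C (P * y))) = \<alpha> + g z"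
    proof -
      \<comment> \<open>Left multiplication by the projection fixes every positive power of z P y,
        so only the zeroth term of the Neumann series changes, from 1 to \<open>P\<close>.\<close>
      have PP: "P * neumann (z \<cdot>\<^sub>C (P * y)) = P + (neumann (z \<cdot>\<^sub>C (P * y)) - 1)"
      proof -
        let ?x = "z \<cdot>\<^sub>C (P * y)"
        have n: "neumann ?x = 1 + ?x * neumann ?x"
          using neumann_inverse(2)[OF nz] by (simp only: left_diff_distrib mult_1_left diff_eq_eq)
        have "P * ?x = ?x" using mem(3) by (simp add: mult.assoc[symmetric])
        then have "P * (?x * neumann ?x) = ?x * neumann ?x" by (metis mult.assoc)
        then show ?thesis using n by (metis add_diff_cancel_left' distrib_left mult.right_neutral)
      qed
      have "\<tau> (P * neumann (z \<cdot>\<^sub>C (P * y))) = \<alpha> + (\<tau> (neumann (z \<cdot>\<^sub>C (P * y))) - 1)"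
        unfolding PP using mem(1) neumann_M[OF scaleC_mem[OF Py] nz] \<alpha>
        by (simp add: tr_add tr_diff diff_mem)
      then show ?thesis by (simp add: gz)
    qed
    with gz projection_resolvent[OF mem \<alpha> free m_def m zm ny(2) nz small]
    have "m * (1 + g z) - (m - 1) * (m / (m - 1 + \<alpha>)) * (\<alpha> + g z) = m" by simp
    then have "m * (1 + g z) * (m - 1 + \<alpha>) - (m - 1) * m * (\<alpha> + g z) = m * (m - 1 + \<alpha>)"
      using m(2) by (simp add: field_simps)
    then have "(m * \<alpha>) * (g z - (m - 1)) = 0" by (simp add: algebra_simps)
    then have "g z = m - 1" using m \<alpha> by simp
    then show ?case by (simp add: z_def fm)
  qed
  moreover have "(g \<circ> \<zeta>) has_fps_expansion (moment_fps (P * y) oo Z)"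
    by (rule has_fps_expansion_compose[OF exg ex\<zeta> Z0])
  ultimately have "f has_fps_expansion (moment_fps (P * y) oo Z)"
    by (subst (asm) has_fps_expansion_cong[of "g \<circ> \<zeta>" f, OF _ refl]) (auto simp: o_def)
  with exf show ?thesis
    by (intro fps_ext) (simp add: fps_nth_fps_expansion)
qed

end

section \<open>The Burgers equation for the scaled moments\<close>

context free_ubm
begin

text \<open>The coefficients for n > 0 are the Q_n(s). The scaling by e^(s/2) is put on the operator
  so that the projection argument applies to the same series.\<close>

definition scaled_moments :: "real \<Rightarrow> complex fps" where
  "scaled_moments s = moment_fps (of_real (exp (s / 2)) \<cdot>\<^sub>C Y s)"

lemma scaled_moments_nth:
  assumes "0 \<le> s"
  shows "fps_nth (scaled_moments s) n = (if n = 0 then 0 else of_real (exp (real n * s / 2)) * \<tau> (Y s ^ n))"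
proof -
  have "complex_of_real (exp (s / 2)) ^ n = of_real (exp (real n * s / 2))"
    by (simp add: exp_of_nat_mult[symmetric] flip: of_real_power)
  then show ?thesis
    using Y_M[OF assms] by (simp add: scaled_moments_def moment_fps_def power_scaleC_bop tr_scaleC power_mem)
qed

text \<open>The factor e^(nt/2) is an integrating factor for the linear part of
  \<open>drift\<close>. On the quadratic part it splits as e^(it/2) e^((n-i)t/2), which leaves a
  Cauchy product of the scaled series.\<close>

lemma scaled_moments_burgers:
  assumes t: "0 \<le> t"
  shows "has_coeff_derivative scaled_moments (- (scaled_moments t * fps_euler (scaled_moments t))) (at t within {0..})"
  unfolding has_coeff_derivative_def
proof
  fix n
  define q where "q k s = complex_of_real (exp (real k * s / 2)) * \<tau> (Y s ^ k)" for k s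
  show "((\<lambda>s. fps_nth (scaled_moments s) n) has_vector_derivative
      fps_nth (- (scaled_moments t * fps_euler (scaled_moments t))) n) (at t within {0..})"
  proof (cases "n = 0")
    case True
    then show ?thesis by (simp add: scaled_moments_def moment_fps_def)
  next
    case False
    have "((\<lambda>s. complex_of_real (exp (real n * s / 2))) has_vector_derivative
        of_real (real n / 2 * exp (real n * t / 2))) (at t within {0..})"
      by (intro has_vector_derivative_of_real) (auto intro!: derivative_eq_intros simp: has_real_derivative_iff_has_vector_derivative[symmetric])
    from has_vector_derivative_mult[OF this moment_has_derivative[OF t, of n]]
    have "(q n has_vector_derivative
        of_real (exp (real n * t / 2)) * drift n t + of_real (real n / 2 * exp (real n * t / 2)) * \<tau> (Y t ^ n))
        (at t within {0..})"
      by (simp add: q_def[abs_def])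
    also have "of_real (exp (real n * t / 2)) * drift n t + of_real (real n / 2 * exp (real n * t / 2)) * \<tau> (Y t ^ n)
        = - (\<Sum>i\<in>{1..<n}. of_real (exp (real n * t / 2)) * (of_nat i * \<tau> (Y t ^ i) * \<tau> (Y t ^ (n - i))))"
      by (simp add: drift_eq right_diff_distrib sum_distrib_left)
    also have "\<dots> = - (\<Sum>i\<in>{1..<n}. of_nat i * q i t * q (n - i) t)"
    proof -
      have "of_real (exp (real n * t / 2)) * (of_nat i * \<tau> (Y t ^ i) * \<tau> (Y t ^ (n - i))) = of_nat i * q i t * q (n - i) t"
        if "i \<in> {1..<n}" for i
      proof -
        have "real n * t / 2 = real i * t / 2 + real (n - i) * t / 2"
          using that by (simp add: of_nat_diff algebra_simps add_divide_distrib[symmetric])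
        then have "complex_of_real (exp (real n * t / 2)) = of_real (exp (real i * t / 2)) * of_real (exp (real (n - i) * t / 2))"
          by (simp only: exp_add of_real_mult)
        then show ?thesis by (simp add: q_def)
      qed
      then show ?thesis by (intro arg_cong[of _ _ uminus] sum.cong refl)
    qed
    also have "(\<Sum>i\<in>{1..<n}. of_nat i * q i t * q (n - i) t)
        = (\<Sum>i=0..n. of_nat i * fps_nth (scaled_moments t) i * fps_nth (scaled_moments t) (n - i))"
      using t by (intro sum.mono_neutral_cong_left) (auto simp: scaled_moments_nth q_def)
    also have "\<dots> = fps_nth (scaled_moments t * fps_euler (scaled_moments t)) n"
      by (subst mult.commute) (simp add: fps_mult_nth)
    finally have "(q n has_vector_derivative fps_nth (- (scaled_moments t * fps_euler (scaled_moments t))) n) (at t within {0..})"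
      by simp
    then show ?thesis
      by (rule has_vector_derivative_transform[rotated 2]) (use t False in \<open>auto simp: scaled_moments_nth q_def\<close>)
  qed
qed

text \<open>Over [0, 0] every simple integral is 0, so \<open>I\<close> has L2 norm 0; faithfulness
  turns this into \<open>I = 0\<close>.\<close>

lemma Y_zero:
  assumes "faithful_on M \<tau>"
  shows "Y 0 = 1"
proof -
  obtain I where I: "has_free_ito_integral M \<tau> \<F> X Y 0 I" "Y 0 = 1 + \<i> \<cdot>\<^sub>C I - (1/2) *\<^sub>R integral {0..0} Y"
    using Y_sde[of 0] by auto
  have IM: "I \<in> M" using I by (simp add: has_free_ito_integral_def)
  obtain L where L: "\<And>n. adapted (L n)" "\<And>n. \<forall>(u, v, a)\<in>set (L n). v \<le> 0"
    "(\<lambda>n. l2norm \<tau> (sint (L n) - I)) \<longlonglongrightarrow> 0"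
    by (rule ito_integral_approx[OF I(1)]) (rule that)
  have "sint K = 0" if "adapted K" "\<forall>(u, v, a)\<in>set K. v \<le> 0" for K
    using that
  proof (induction K)
    case (Cons l K)
    obtain u v a where l: "l = (u, v, a)" by (cases l) auto
    have "u = v" using Cons.prems by (auto simp: l)
    with Cons show ?case by (simp add: l)
  qed simp
  then have "l2norm \<tau> I = 0" using L IM by (simp add: l2_uminus LIMSEQ_const_iff)
  then have "I = 0" using assms IM tr_star_self[OF IM] by (simp add: faithful_on_def)
  then show ?thesis using I by (simp add: scaleC_bop_simps)
qed

end

theorem proposition2p1:
  fixes M :: "'h::complex_hilbert_space bop set"
    and \<tau> :: "'h bop \<Rightarrow> complex"
    and P :: "'h bop"
    and Y :: "real \<Rightarrow> 'h bop"
    and \<alpha> t :: real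
    and n :: nat
  assumes "nc_probability_space M \<tau>"
    and "P \<in> M" "star P = P" "P * P = P"
    and "\<tau> P = complex_of_real \<alpha>" "0 < \<alpha>" "\<alpha> \<le> 1"
    and "free_unitary_brownian_motion M \<tau> Y"
    and "star_free \<tau> {P} (Y ` {0..})"
    and "0 \<le> t"
  shows "\<tau> (if n = 0 then P else (P * Y t) ^ n) =
    complex_of_real (\<alpha> * exp (- real n * t / 2)) * normalized_moment \<tau> Y n (\<alpha> * t)"
proof (cases "n = 0")
  case True
  then show ?thesis using assms by (simp add: normalized_moment_def)
next
  case n: False
  obtain \<F> X where FX: "filtration M \<F>" "free_brownian_motion \<tau> \<F> X" "continuous_on {0..} Y"
    "\<forall>t\<ge>0. Y t \<in> \<F> t \<and> star (Y t) * Y t = 1 \<and> Y t * star (Y t) = 1 \<and>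
        (\<exists>I. has_free_ito_integral M \<tau> \<F> X Y t I \<and> Y t = 1 + \<i> \<cdot>\<^sub>C I - (1/2) *\<^sub>R integral {0..t} Y)"
    using assms(8) unfolding free_unitary_brownian_motion_def by blast
  interpret free_ubm M \<tau> \<F> X Y
    using assms(1) FX by unfold_locales (auto simp: nc_probability_space_def)
  let ?\<psi> = scaled_moments
  define a where "a = complex_of_real \<alpha>"
  define c where "c = complex_of_real (exp (t / 2))"
  define y where "y = c \<cdot>\<^sub>C Y t"
  define G where "G = moment_fps (P * y)"
  \<comment> \<open>The series claimed by the theorem; it remains to show \<open>G = H\<close>,
    since the factor e^(nt/2) in \<open>G\<close> is removed at the end.\<close>
  define H where "H = fps_const a * ?\<psi> (\<alpha> * t)"
  have a0: "a \<noteq> 0" and at: "0 \<le> \<alpha> * t" using assms by (auto simp: a_def)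
  have zero: "fps_nth (?\<psi> s) 0 = 0" for s by (simp add: scaled_moments_def moment_fps_def)
  have "Y 0 = 1" using Y_zero assms(1) by (simp add: nc_probability_space_def)
  then have init: "fps_nth (?\<psi> 0) k = 1" if "0 < k" for k using that by (simp add: scaled_moments_nth)
  have invariant: "fps_euler (?\<psi> s) * (1 + fps_const (of_real s) * (?\<psi> s * (1 + ?\<psi> s))) = ?\<psi> s * (1 + ?\<psi> s)"
    if "0 \<le> s" for s
    by (rule burgers_invariant) (use zero init scaled_moments_burgers that in auto)
  \<comment> \<open>The product of psi with its Euler derivative starts in degree 2, so the linear
    coefficient does not move. This fixes the constant that the differential equation leaves
    open.\<close>
  have first: "fps_nth (?\<psi> s) 1 = 1" if "0 \<le> s" for s
  proof -
    have "((\<lambda>s. fps_nth (?\<psi> s) 1) has_vector_derivative 0) (at s within {0..})" if "0 \<le> s" for s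
    proof -
      have "fps_nth (- (?\<psi> s * fps_euler (?\<psi> s))) 1 = 0" by (simp add: fps_mult_nth zero)
      then show ?thesis using scaled_moments_burgers[OF that] unfolding has_coeff_derivative_def by metis
    qed
    then obtain d where "\<And>s. 0 \<le> s \<Longrightarrow> fps_nth (?\<psi> s) 1 = d"
      using has_vector_derivative_zero_constant[of "{0..}" "\<lambda>s. fps_nth (?\<psi> s) 1"] by auto
    then show ?thesis using init[of 1] that by force
  qed
  have y: "y \<in> M" "y \<in> star_algebra (Y ` {0..})"
    unfolding y_def using Y_M assms(10)
    by (blast intro: scaleC_mem, intro star_algebra.intros(5) star_algebra.intros(1)) auto
  have \<psi>t: "?\<psi> t = moment_fps y" by (simp add: scaled_moments_def y_def c_def)
  define Z where "Z = fps_X * (1 + moment_fps y) * inverse (moment_fps y + fps_const a)"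
  have "fps_nth (moment_fps y + fps_const a) 0 \<noteq> 0" using zero[of t] a0 by (simp add: \<psi>t)
  then have Z: "Z * (?\<psi> t + fps_const a) = fps_X * (1 + ?\<psi> t)"
    unfolding Z_def \<psi>t by (simp add: mult.assoc inverse_mult_eq_1)
  have "G oo Z = ?\<psi> t"
    unfolding G_def Z_def \<psi>t using moment_fps_projection[OF assms(2) y(1) assms(4) _ a0 assms(9) y(2)] assms(5)
    by (simp add: a_def)
  note sub = subordination_ode[OF a0 zero invariant[OF assms(10)] Z this]
  \<comment> \<open>This is alpha^2 times the invariant equation at time alpha t: one factor alpha
    of the time stays with the coefficient, and t remains.\<close>
  have "fps_euler H * (fps_const a + fps_const (of_real t) * (H * (H + fps_const a))) = H * (H + fps_const a)"
  proof -
    define p where "p = ?\<psi> (\<alpha> * t)"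
    define A where "A = fps_const a"
    define T where "T = fps_const (complex_of_real t)"
    have inv: "fps_euler p * (1 + A * T * (p * (1 + p))) = p * (1 + p)"
      using invariant[OF at] by (simp add: p_def A_def T_def a_def)
    have "fps_euler H = A * fps_euler p" by (simp add: H_def p_def A_def fps_euler_simps)
    then have "fps_euler H * (A + T * (H * (H + A))) = A * A * (fps_euler p * (1 + A * T * (p * (1 + p))))"
      unfolding H_def[folded p_def A_def] by (simp add: algebra_simps)
    also have "\<dots> = H * (H + A)"
      unfolding inv H_def[folded p_def A_def] by (simp add: algebra_simps)
    finally show ?thesis by (simp add: A_def T_def)
  qed
  moreover have "fps_nth G 0 = 0" "fps_nth H 0 = 0" by (simp_all add: G_def moment_fps_def H_def zero)
  moreover have "fps_nth G 1 = fps_nth H 1" using sub(2) first[OF assms(10)] first[OF at] by (simp add: H_def)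
  ultimately have "G = H" using fps_ode_unique[OF a0 sub(1)] by blast
  moreover have "fps_nth G n = c ^ n * \<tau> ((P * Y t) ^ n)"
    using n assms(2,10) Y_M[of t]
    by (simp add: G_def moment_fps_def y_def power_scaleC_bop tr_scaleC power_mem mult_mem)
  moreover have "fps_nth H n = a * normalized_moment \<tau> Y n (\<alpha> * t)"
    using n at by (simp add: H_def scaled_moments_nth normalized_moment_def)
  ultimately have eq: "c ^ n * \<tau> ((P * Y t) ^ n) = a * normalized_moment \<tau> Y n (\<alpha> * t)" by simp
  have "exp (- real n * t / 2) * exp (t / 2) ^ n = 1"
    by (simp add: exp_of_nat_mult[symmetric] exp_minus)
  then have one: "complex_of_real (exp (- real n * t / 2)) * c ^ n = 1"
    unfolding c_def by (metis of_real_1 of_real_mult of_real_power)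
  have "\<tau> ((P * Y t) ^ n) = complex_of_real (exp (- real n * t / 2)) * (c ^ n * \<tau> ((P * Y t) ^ n))"
    unfolding mult.assoc[symmetric] one by simp
  then show ?thesis using n unfolding eq by (simp add: a_def mult_ac)
qed

end
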